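(* Let $X$ be a metric surface and $p\geq1$. If $u\colon X\to\mathbb{R}$ is a weakly monotone function with a locally $p$-integrable $p$-weak upper gradient $\rho$, then, for $\kappa=(4/\pi)\cdot200$, $$\int_{\mathbb{R}}^{*}\int_{\overline{u^{-1}(t)}} g\,d\mathcal{H}^{1}\,dt\leq\kappa\int_X g\rho\,d\mathcal{H}^{2}\quad\text{for every Borel } g\colon X\to[0,\infty].$$
   Context: $\mathcal{H}^k$ is the $k$-dimensional Hausdorff measure, normalized to equal Lebesgue measure on $\mathbb{R}^k$. A metric surface is a metric space $X$ that is a (second countable) topological surface without boundary, i.e. every point has an open neighbourhood homeomorphic to an open subset of the plane, and such that $\mathcal{H}^2$ is finite on compact subsets of $X$. A function $u\colon X\to\mathbb{R}$ is weakly monotone if for every open $V$ compactly contained in $X$ (i.e. $\overline V$ is compact in $X$), $\sup_V u\leq\sup_{\partial V}u<\infty$ and $\inf_V u\geq\inf_{\partial V}u>-\infty$. For a path $\gamma$ (continuous map from a compact interval) and Borel $\rho\colon X\to[0,\infty]$, $\int_\gamma\rho\,ds:=\int_X\#(\gamma^{-1}(x))\rho(x)\,d\mathcal{H}^1(x)$ (the usual arclength integral when $\gamma$ is rectifiable). A path family $\Gamma$ is $p$-negligible if $\operatorname{mod}_p\Gamma=0$, where $\operatorname{mod}_p\Gamma=\inf\int_X h^p\,d\mathcal{H}^2$ over Borel $h\colon X\to[0,\infty]$ with $\int_\gamma h\,ds\geq1$ for all $\gamma\in\Gamma$. A Borel function $\rho\colon X\to[0,\infty]$ is a $p$-weak upper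 gradient of $u$ if $|u(\gamma(a))-u(\gamma(b))|\leq\int_\gamma\rho\,ds$ for all rectifiable paths $\gamma\colon[a,b]\to X$ outside a $p$-negligible family; it is locally $p$-integrable if it is $p$-integrable with respect to $\mathcal{H}^2$ on each compact subset of $X$. $u^{-1}(t)=\{x:u(x)=t\}$ and $\overline{u^{-1}(t)}$ is its closure in $X$. $\int^*$ denotes the upper integral: the infimum of integrals of measurable functions dominating the integrand almost everywhere. *)

theory Defs
  imports "HOL-Analysis.Analysis"
begin

section \<open>Hausdorff measure\<close>

text \<open>
  The factor \<^term>\<open>unit_ball_vol (real k) / 2 ^ k\<close> is the normalization for which the
  \<open>k\<close>-dimensional Hausdorff measure agrees with Lebesgue measure on \<open>k\<close>-space.
  The empty set is treated separately only because of \<open>k = 0\<close>, where \<open>0 ^ 0 = 1\<close>.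
\<close>

definition hausdorff_gauge :: "nat \<Rightarrow> 'a::metric_space set \<Rightarrow> ennreal" where
  "hausdorff_gauge k A =
     (if A = {} then 0 else ennreal (unit_ball_vol (real k) * (diameter A / 2) ^ k))"

text \<open>
  Boundedness of the covering sets has to be required explicitly:
  \<^const>\<open>diameter\<close> is real-valued and unspecified on unbounded sets.
\<close>

definition hausdorff_pre :: "nat \<Rightarrow> real \<Rightarrow> 'a::metric_space set \<Rightarrow> ennreal" where
  "hausdorff_pre k \<delta> E =
     (INF C \<in> {C :: nat \<Rightarrow> 'a set. E \<subseteq> (\<Union>i. C i) \<and> (\<forall>i. bounded (C i) \<and> diameter (C i) \<le> \<delta>)}.
        \<Sum>i. hausdorff_gauge k (C i))"

definition hausdorff_outer :: "nat \<Rightarrow> 'a::metric_space set \<Rightarrow> ennreal" where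
  "hausdorff_outer k E = (SUP \<delta> \<in> {0<..}. hausdorff_pre k \<delta> E)"

definition hausdorff_measure :: "nat \<Rightarrow> 'a::metric_space measure" where
  "hausdorff_measure k = measure_of UNIV (sets borel) (hausdorff_outer k)"

text \<open>
  \<^const>\<open>measure_of\<close> returns the zero measure unless its argument is countably additive on the
  given sets, so we verify (by Caratheodory's criterion for metric outer measures) that
  \<^term>\<open>emeasure (hausdorff_measure k)\<close> is \<^term>\<open>hausdorff_outer k\<close> on Borel sets.
\<close>

lemma hausdorff_pre_empty: "\<delta> > 0 \<Longrightarrow> hausdorff_pre k \<delta> {} = 0"
  unfolding hausdorff_pre_def
  by (rule antisym, rule INF_lower2[of "\<lambda>_. {}"]) (auto simp: hausdorff_gauge_def)

lemma hausdorff_pre_mono: "A \<subseteq> B \<Longrightarrow> hausdorff_pre k \<delta> A \<le> hausdorff_pre k \<delta> B"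
  unfolding hausdorff_pre_def by (rule INF_superset_mono) auto

lemma hausdorff_pre_antimono: "\<delta> \<le> \<epsilon> \<Longrightarrow> hausdorff_pre k \<epsilon> A \<le> hausdorff_pre k \<delta> A"
  unfolding hausdorff_pre_def by (rule INF_superset_mono) (auto intro: order_trans)

lemma hausdorff_pre_subadditive:
  fixes A :: "nat \<Rightarrow> 'a::metric_space set"
  shows "hausdorff_pre k \<delta> (\<Union>i. A i) \<le> (\<Sum>n. hausdorff_pre k \<delta> (A n))"
proof (rule ennreal_le_epsilon)
  let ?O = "hausdorff_pre k \<delta> :: 'a set \<Rightarrow> ennreal"
  fix e :: real assume "0 < e" "(\<Sum>n. ?O (A n)) < top"
  then have *: "?O (A n) < ?O (A n) + e * (1/2)^Suc n" for n
    by (auto simp add: less_top dest!: ennreal_suminf_lessD)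
  have "\<exists>C. A n \<subseteq> (\<Union>i. C i) \<and> (\<forall>i. bounded (C i) \<and> diameter (C i) \<le> \<delta>)
      \<and> (\<Sum>i. hausdorff_gauge k (C i)) < ?O (A n) + e * (1/2)^Suc n" for n
    using *[of n] unfolding hausdorff_pre_def[of k \<delta> "A n"] INF_less_iff by blast
  then obtain B where sbB: "\<And>n. A n \<subseteq> (\<Union>i. B n i)"
      and bB: "\<And>n i. bounded (B n i) \<and> diameter (B n i) \<le> \<delta>"
      and Ble: "\<And>n. (\<Sum>i. hausdorff_gauge k (B n i)) < ?O (A n) + e * (1/2)^Suc n"
    by metis
  define C where "C = case_prod B o prod_decode"
  have A_C: "(\<Union>i. A i) \<subseteq> (\<Union>i. C i)"
    using sbB by (auto simp add: C_def subset_eq) (metis prod.case prod_encode_inverse)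
  have "?O (\<Union>i. A i) \<le> (\<Sum>i. hausdorff_gauge k (C i))"
    unfolding hausdorff_pre_def
    using A_C bB by (intro INF_lower) (auto simp: C_def split_def)
  also have "\<dots> = (\<Sum>n. \<Sum>i. hausdorff_gauge k (B n i))"
    using suminf_ennreal_2dimen[of "\<lambda>n. \<Sum>i. hausdorff_gauge k (B n i)"
        "\<lambda>(n, i). hausdorff_gauge k (B n i)"]
    by (simp add: C_def split_def)
  also have "\<dots> \<le> (\<Sum>n. ?O (A n) + e * (1/2) ^ Suc n)"
    using Ble by (intro suminf_le) (auto intro: less_imp_le)
  also have "\<dots> = (\<Sum>n. ?O (A n)) + (\<Sum>n. ennreal e * ennreal ((1/2) ^ Suc n))"
    using \<open>0 < e\<close> by (subst suminf_add[symmetric])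
                     (auto simp del: ennreal_suminf_cmult simp add: ennreal_mult[symmetric])
  also have "\<dots> = (\<Sum>n. ?O (A n)) + e"
    unfolding ennreal_suminf_cmult
    by (subst suminf_ennreal_eq[OF zero_le_power power_half_series]) auto
  finally show "?O (\<Union>i. A i) \<le> (\<Sum>n. ?O (A n)) + e" .
qed

lemma hausdorff_outer_empty [simp]: "hausdorff_outer k {} = 0"
  unfolding hausdorff_outer_def by (auto simp: hausdorff_pre_empty intro!: antisym SUP_least)

lemma hausdorff_outer_mono: "A \<subseteq> B \<Longrightarrow> hausdorff_outer k A \<le> hausdorff_outer k B"
  unfolding hausdorff_outer_def by (intro SUP_mono) (auto intro: hausdorff_pre_mono)

lemma hausdorff_outer_subadditive:
  "hausdorff_outer k (\<Union>i. A i) \<le> (\<Sum>n. hausdorff_outer k (A n))"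
  unfolding hausdorff_outer_def[of k "\<Union>i. A i"]
proof (rule SUP_least)
  fix \<delta> :: real assume "\<delta> \<in> {0<..}"
  then show "hausdorff_pre k \<delta> (\<Union>i. A i) \<le> (\<Sum>n. hausdorff_outer k (A n))"
    by (intro order_trans[OF hausdorff_pre_subadditive] suminf_le)
       (auto simp: hausdorff_outer_def intro: SUP_upper)
qed

lemma outer_measure_space_hausdorff:
  "outer_measure_space (Pow UNIV) (hausdorff_outer k)"
  by (auto simp: outer_measure_space_def positive_def increasing_def countably_subadditive_def
      intro: hausdorff_outer_mono hausdorff_outer_subadditive)

lemma hausdorff_outer_Un: "hausdorff_outer k (A \<union> B) \<le> hausdorff_outer k A + hausdorff_outer k B"
proof -
  have "hausdorff_outer k (\<Union>i. binaryset A B i) \<le> (\<Sum>n. hausdorff_outer k (binaryset A B n))"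
    by (rule hausdorff_outer_subadditive)
  then show ?thesis
    by (simp add: UN_binaryset_eq suminf_binaryset_eq)
qed

lemma hausdorff_pre_separated:
  fixes A B :: "'a::metric_space set"
  assumes "\<delta> > 0" "\<And>x y. x \<in> A \<Longrightarrow> y \<in> B \<Longrightarrow> \<delta> < dist x y"
  shows "hausdorff_pre k \<delta> A + hausdorff_pre k \<delta> B \<le> hausdorff_pre k \<delta> (A \<union> B)"
  unfolding hausdorff_pre_def[of k \<delta> "A \<union> B"]
proof (rule INF_greatest, safe)
  fix C :: "nat \<Rightarrow> 'a set"
  assume C: "A \<union> B \<subseteq> (\<Union>i. C i)" "\<forall>i. bounded (C i) \<and> diameter (C i) \<le> \<delta>"
  define D where "D S = (\<lambda>i. if C i \<inter> S = {} then {} else C i)" for S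
  have D: "hausdorff_pre k \<delta> S \<le> (\<Sum>i. hausdorff_gauge k (D S i))" if "S \<subseteq> A \<union> B" for S
    unfolding hausdorff_pre_def
  proof (rule INF_lower, safe)
    fix x assume "x \<in> S"
    then show "x \<in> (\<Union>i. D S i)"
      using C(1) that by (auto simp: D_def) blast
  qed (use C(2) assms(1) in \<open>auto simp: D_def\<close>)
  have disj: "C i \<inter> A = {} \<or> C i \<inter> B = {}" for i
    using diameter_bounded_bound[of "C i"] C(2) assms(2) by fastforce
  have "hausdorff_pre k \<delta> A + hausdorff_pre k \<delta> B
      \<le> (\<Sum>i. hausdorff_gauge k (D A i)) + (\<Sum>i. hausdorff_gauge k (D B i))"
    by (intro add_mono D) auto
  also have "\<dots> = (\<Sum>i. hausdorff_gauge k (D A i) + hausdorff_gauge k (D B i))"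
    by (intro suminf_add) auto
  also have "\<dots> \<le> (\<Sum>i. hausdorff_gauge k (C i))"
    using disj by (intro suminf_le) (auto simp: D_def hausdorff_gauge_def)
  finally show "hausdorff_pre k \<delta> A + hausdorff_pre k \<delta> B \<le> (\<Sum>i. hausdorff_gauge k (C i))" .
qed

lemma hausdorff_outer_separated:
  fixes A B :: "'a::metric_space set"
  assumes "d > 0" "\<And>x y. x \<in> A \<Longrightarrow> y \<in> B \<Longrightarrow> d \<le> dist x y"
  shows "hausdorff_outer k A + hausdorff_outer k B \<le> hausdorff_outer k (A \<union> B)"
proof -
  have "hausdorff_pre k \<delta> A + hausdorff_pre k \<epsilon> B \<le> hausdorff_outer k (A \<union> B)"
    if "\<delta> > 0" "\<epsilon> > 0" for \<delta> \<epsilon>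
  proof -
    define m where "m = min (d / 2) (min \<delta> \<epsilon>)"
    have m: "m > 0" "m < d" "m \<le> \<delta>" "m \<le> \<epsilon>"
      using that assms(1) by (auto simp: m_def min_def)
    have "hausdorff_pre k \<delta> A + hausdorff_pre k \<epsilon> B \<le> hausdorff_pre k m A + hausdorff_pre k m B"
      using m by (intro add_mono hausdorff_pre_antimono) auto
    also have "\<dots> \<le> hausdorff_pre k m (A \<union> B)"
      using m assms(2) by (intro hausdorff_pre_separated) force+
    also have "\<dots> \<le> hausdorff_outer k (A \<union> B)"
      using m by (auto simp: hausdorff_outer_def intro: SUP_upper)
    finally show ?thesis .
  qed
  then have "hausdorff_pre k \<delta> A + hausdorff_outer k B \<le> hausdorff_outer k (A \<union> B)"
    if "\<delta> > 0" for \<delta>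
    unfolding hausdorff_outer_def[of k B] using that
    by (subst ennreal_SUP_add_right) (auto intro: SUP_least)
  then show ?thesis
    unfolding hausdorff_outer_def[of k A]
    by (subst ennreal_SUP_add_left[symmetric]) (auto intro: SUP_least)
qed

lemma suminf_tail_tendsto_0:
  fixes f :: "nat \<Rightarrow> ennreal"
  assumes "suminf f \<noteq> top"
  shows "(\<lambda>n. \<Sum>j. f (j + n)) \<longlonglongrightarrow> 0"
proof -
  have fin: "sum f {..<n} \<noteq> top" for n
    using sum_le_suminf[of f "{..<n}"] assms
    by (metis finite_lessThan summableI top.extremum_unique zero_le)
  have "(\<lambda>n. suminf f - sum f {..<n}) \<longlonglongrightarrow> suminf f - suminf f"
    using assms by (intro tendsto_diff_ennreal tendsto_const summable_LIMSEQ) auto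
  moreover have "suminf f - sum f {..<n} = (\<Sum>j. f (j + n))" for n
    using suminf_offset[of f n] fin[of n] by (simp add: add.commute)
  ultimately show ?thesis
    using assms by (simp add: ennreal_minus_cancel_iff diff_eq_0_iff_ennreal less_top)
qed

lemma closed_in_lambda_system_hausdorff:
  fixes F :: "'a::metric_space set"
  assumes "closed F"
  shows "F \<in> lambda_system UNIV (Pow UNIV) (hausdorff_outer k)"
proof -
  let ?H = "hausdorff_outer k :: 'a set \<Rightarrow> ennreal"
  interpret sigma_algebra UNIV "Pow UNIV :: 'a set set" by (rule sigma_algebra_Pow)
  have main: "?H (E \<inter> F) + ?H (E - F) \<le> ?H E" if fin: "?H E \<noteq> top" and ne: "F \<noteq> {}" for E
  proof -
    define B where "B m = {x \<in> E. 1 \<le> real m * infdist x F}" for m :: nat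
    define R where "R n = {x \<in> E. 1 \<le> real (n + 2) * infdist x F \<and> real (n + 1) * infdist x F < 1}"
      for n :: nat
    have dist0: "infdist x F = 0 \<longleftrightarrow> x \<in> F" for x
      using assms ne by (simp add: in_closed_iff_infdist_zero)
    have Bmono: "B m \<subseteq> B n" if "m \<le> n" for m n
    proof
      fix x assume "x \<in> B m"
      then show "x \<in> B n"
        using mult_right_mono[of "real m" "real n" "infdist x F"] that infdist_nonneg[of x F]
        by (auto simp: B_def)
    qed
    have sep: "?H (B m) + ?H (R m) \<le> ?H (B m \<union> R m)" for m
    proof (cases "m = 0")
      case True
      then show ?thesis by (simp add: B_def)
    next
      case False
      show ?thesis
      proof (rule hausdorff_outer_separated)
        show "0 < 1 / real m - 1 / real (m + 1)"
          using False by (simp add: frac_less2 del: of_nat_add of_nat_Suc)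
        fix x y assume "x \<in> B m" "y \<in> R m"
        then have "1 / real m \<le> infdist x F" "infdist y F < 1 / real (m + 1)"
          using False by (auto simp: B_def R_def field_simps)
        then show "1 / real m - 1 / real (m + 1) \<le> dist x y"
          using infdist_triangle[of x F y] by linarith
      qed
    qed
    have partial: "(\<Sum>j<n. ?H (R (2 * j + s))) \<le> ?H (B (2 * n + s))" for n s
    proof (induction n)
      case (Suc n)
      have "(\<Sum>j<Suc n. ?H (R (2 * j + s))) \<le> ?H (B (2 * n + s)) + ?H (R (2 * n + s))"
        using Suc by (simp add: add_right_mono)
      also have "\<dots> \<le> ?H (B (2 * n + s) \<union> R (2 * n + s))"
        by (rule sep)
      also have "\<dots> \<le> ?H (B (2 * Suc n + s))"
        using Bmono[of "2 * n + s" "2 * Suc n + s"]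
        by (intro hausdorff_outer_mono) (auto simp: B_def R_def algebra_simps)
      finally show ?case .
    qed simp
    have half: "(\<Sum>j. ?H (R (2 * j + s))) \<le> ?H E" for s
      by (intro suminf_le_const summableI order_trans[OF partial] hausdorff_outer_mono)
         (auto simp: B_def)
    have "(\<Sum>j<n. ?H (R j)) \<le> ?H E + ?H E" for n
    proof -
      have "(\<Sum>j<n. ?H (R j)) \<le> (\<Sum>j<2 * n. ?H (R j))"
        by (intro sum_mono2) auto
      also have "\<dots> = (\<Sum>j<n. ?H (R (2 * j + 0))) + (\<Sum>j<n. ?H (R (2 * j + 1)))"
        by (induction n) (auto simp: algebra_simps)
      also have "\<dots> \<le> ?H E + ?H E"
        using half[of 0] half[of 1]
        by (intro add_mono order_trans[OF sum_le_suminf half]) auto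
      finally show ?thesis .
    qed
    then have "(\<Sum>j. ?H (R j)) \<le> ?H E + ?H E"
      by (intro suminf_le_const summableI)
    then have "(\<Sum>j. ?H (R j)) \<noteq> top"
      using fin by (auto simp: top_unique)
    then have tail: "(\<lambda>n. ?H E + (\<Sum>j. ?H (R (j + n)))) \<longlonglongrightarrow> ?H E + 0"
      by (intro tendsto_add tendsto_const suminf_tail_tendsto_0)
    have bound: "?H (E \<inter> F) + ?H (E - F) \<le> ?H E + (\<Sum>j. ?H (R (j + n)))" for n
    proof -
      have "E - F \<subseteq> B (n + 1) \<union> (\<Union>j. R (j + n))"
      proof
        fix x assume x: "x \<in> E - F"
        then have pos: "infdist x F > 0"
          using dist0[of x] infdist_nonneg[of x F] by auto
        obtain m where m: "1 < real m * infdist x F"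
          using reals_Archimedean3[OF pos] by blast
        define l where "l = (LEAST l. x \<in> B l)"
        have l: "x \<in> B l"
          unfolding l_def by (rule LeastI[of _ m]) (use x m in \<open>auto simp: B_def\<close>)
        show "x \<in> B (n + 1) \<union> (\<Union>j. R (j + n))"
        proof (cases "l \<le> n + 1")
          case True
          then show ?thesis using Bmono l by blast
        next
          case False
          then obtain j where j: "l = j + n + 2"
            by (metis add.commute add.left_commute le_Suc_ex nat_le_linear not_less_eq_eq
                Suc_eq_plus1 add_2_eq_Suc')
          have "x \<notin> B (j + n + 1)"
            using not_less_Least[of "j + n + 1" "\<lambda>l. x \<in> B l"] j by (simp add: l_def)
          then have "x \<in> R (j + n)"
            using l x by (auto simp: j B_def R_def algebra_simps)
          then show ?thesis by blast
        qed
      qed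
      then have "?H (E - F) \<le> ?H (B (n + 1) \<union> (\<Union>j. R (j + n)))"
        by (rule hausdorff_outer_mono)
      also have "\<dots> \<le> ?H (B (n + 1)) + ?H (\<Union>j. R (j + n))"
        by (rule hausdorff_outer_Un)
      also have "\<dots> \<le> ?H (B (n + 1)) + (\<Sum>j. ?H (R (j + n)))"
        by (intro add_left_mono hausdorff_outer_subadditive)
      finally have "?H (E \<inter> F) + ?H (E - F)
          \<le> (?H (E \<inter> F) + ?H (B (n + 1))) + (\<Sum>j. ?H (R (j + n)))"
        by (simp add: add.assoc add_left_mono)
      also have "?H (E \<inter> F) + ?H (B (n + 1)) \<le> ?H ((E \<inter> F) \<union> B (n + 1))"
      proof (rule hausdorff_outer_separated)
        show "0 < 1 / real (n + 1)" by simp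
        fix x y assume "x \<in> E \<inter> F" "y \<in> B (n + 1)"
        then have "1 / real (n + 1) \<le> infdist y F" "infdist y F \<le> dist y x"
          by (auto simp: B_def field_simps intro: infdist_le)
        then show "1 / real (n + 1) \<le> dist x y"
          by (simp add: dist_commute)
      qed
      also have "\<dots> \<le> ?H E"
        by (rule hausdorff_outer_mono) (auto simp: B_def)
      finally show ?thesis by (simp add: add_right_mono)
    qed
    show ?thesis
      using tendsto_lowerbound[OF tail, of "?H (E \<inter> F) + ?H (E - F)"] bound by simp
  qed
  have "?H (E \<inter> F) + ?H (E - F) = ?H E" for E
  proof (rule antisym)
    show "?H (E \<inter> F) + ?H (E - F) \<le> ?H E"
      using main[of E] by (cases "?H E = top"; cases "F = {}") auto
    have "?H E \<le> ?H ((E \<inter> F) \<union> (E - F))"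
      by (rule hausdorff_outer_mono) auto
    also have "\<dots> \<le> ?H (E \<inter> F) + ?H (E - F)"
      by (rule hausdorff_outer_Un)
    finally show "?H E \<le> ?H (E \<inter> F) + ?H (E - F)" .
  qed
  then show ?thesis
    by (simp add: lambda_system_eq del: Pow_UNIV)
qed

lemma measure_space_hausdorff:
  "measure_space UNIV (sets borel) (hausdorff_outer k :: 'a::metric_space set \<Rightarrow> ennreal)"
proof -
  let ?L = "lambda_system UNIV (Pow UNIV) (hausdorff_outer k :: 'a set \<Rightarrow> ennreal)"
  have ms: "measure_space UNIV ?L (hausdorff_outer k)"
    by (rule sigma_algebra.caratheodory_lemma[OF sigma_algebra_Pow outer_measure_space_hausdorff])
  then have "sigma_sets UNIV (Collect closed) \<subseteq> ?L"
    using closed_in_lambda_system_hausdorff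
    by (intro sigma_algebra.sigma_sets_subset) (auto simp: measure_space_def simp del: Pow_UNIV)
  then have "sets (borel :: 'a measure) \<subseteq> ?L"
    by (simp add: borel_eq_closed)
  with ms show ?thesis
    by (rule measure_down[OF _ sets.sigma_algebra_axioms[of borel, simplified]])
qed

lemma sets_hausdorff_measure [simp, measurable_cong]: "sets (hausdorff_measure k) = sets borel"
  unfolding hausdorff_measure_def
  using sets.sigma_sets_eq[of "borel :: 'a measure"] by (simp add: sets_measure_of_conv)

lemma space_hausdorff_measure [simp]: "space (hausdorff_measure k) = UNIV"
  by (simp add: hausdorff_measure_def space_measure_of_conv)

lemma emeasure_hausdorff_measure:
  "A \<in> sets borel \<Longrightarrow> emeasure (hausdorff_measure k) A = hausdorff_outer k A"
  unfolding hausdorff_measure_def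
  using measure_space_hausdorff[of k]
  by (intro emeasure_measure_of_sigma) (auto simp: measure_space_def)

section \<open>Metric surfaces and weakly monotone functions\<close>

text \<open>
  The metric space is the whole type; second countability is imposed by the sort.
\<close>

definition metric_surface :: "'a::{metric_space, second_countable_topology} itself \<Rightarrow> bool" where
  "metric_surface _ \<longleftrightarrow>
     (\<forall>x::'a. \<exists>U (W :: (real^2) set). open U \<and> x \<in> U \<and> open W \<and> U homeomorphic W) \<and>
     (\<forall>K::'a set. compact K \<longrightarrow> emeasure (hausdorff_measure 2) K < \<infinity>)"

text \<open>
  Suprema and infima are taken in the extended reals, so that they are \<open>-\<infinity>\<close> and \<open>\<infinity>\<close>,
  respectively, over an empty \<open>V\<close> or an empty boundary.
\<close>

definition weakly_monotone :: "('a::metric_space \<Rightarrow> real) \<Rightarrow> bool" where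
  "weakly_monotone u \<longleftrightarrow>
     (\<forall>V. open V \<and> compact (closure V) \<longrightarrow>
        (SUP x\<in>V. ereal (u x)) \<le> (SUP x\<in>frontier V. ereal (u x)) \<and>
        (SUP x\<in>frontier V. ereal (u x)) < \<infinity> \<and>
        (INF x\<in>V. ereal (u x)) \<ge> (INF x\<in>frontier V. ereal (u x)) \<and>
        (INF x\<in>frontier V. ereal (u x)) > -\<infinity>)"

section \<open>Paths, modulus and weak upper gradients\<close>

text \<open>
  A path with domain \<open>{a..b}\<close> is represented by the triple \<open>(a, b, \<gamma>)\<close>; the values of \<open>\<gamma>\<close>
  outside \<open>{a..b}\<close> are never used.
\<close>

type_synonym 'a cpath = "real \<times> real \<times> (real \<Rightarrow> 'a)"

definition cpaths :: "'a::metric_space cpath set" where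
  "cpaths = {(a, b, \<gamma>). a \<le> b \<and> continuous_on {a..b} \<gamma>}"

definition cpath_length :: "'a::metric_space cpath \<Rightarrow> ennreal" where
  "cpath_length = (\<lambda>(a, b, \<gamma>).
     SUP (n, t) \<in> {(n :: nat, t :: nat \<Rightarrow> real). mono_on {..n} t \<and> t ` {..n} \<subseteq> {a..b}}.
       \<Sum>i<n. ennreal (dist (\<gamma> (t i)) (\<gamma> (t (Suc i)))))"

definition rectifiable :: "'a::metric_space cpath \<Rightarrow> bool" where
  "rectifiable c \<longleftrightarrow> cpath_length c < \<infinity>"

definition path_integral :: "('a::metric_space \<Rightarrow> ennreal) \<Rightarrow> 'a cpath \<Rightarrow> ennreal" where
  "path_integral \<rho> = (\<lambda>(a, b, \<gamma>).
     \<integral>\<^sup>+ x. emeasure (count_space UNIV) {s \<in> {a..b}. \<gamma> s = x} * \<rho> x \<partial>hausdorff_measure 1)"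

text \<open>Powers of extended nonnegative reals, for positive exponents \<open>p\<close>.\<close>

definition ennreal_powr :: "ennreal \<Rightarrow> real \<Rightarrow> ennreal" where
  "ennreal_powr x p = (if x = \<infinity> then \<infinity> else ennreal (enn2real x powr p))"

definition modulus :: "real \<Rightarrow> 'a::metric_space cpath set \<Rightarrow> ennreal" where
  "modulus p \<Gamma> =
     (INF h \<in> {h \<in> borel_measurable borel. \<forall>c\<in>\<Gamma>. path_integral h c \<ge> 1}.
        \<integral>\<^sup>+ x. ennreal_powr (h x) p \<partial>hausdorff_measure 2)"

definition weak_upper_gradient ::
    "real \<Rightarrow> ('a::metric_space \<Rightarrow> real) \<Rightarrow> ('a \<Rightarrow> ennreal) \<Rightarrow> bool" where
  "weak_upper_gradient p u \<rho> \<longleftrightarrow>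
     \<rho> \<in> borel_measurable borel \<and>
     (\<exists>\<Gamma>\<subseteq>cpaths. modulus p \<Gamma> = 0 \<and>
        (\<forall>a b \<gamma>. (a, b, \<gamma>) \<in> cpaths - \<Gamma> \<and> rectifiable (a, b, \<gamma>) \<longrightarrow>
           ennreal \<bar>u (\<gamma> a) - u (\<gamma> b)\<bar> \<le> path_integral \<rho> (a, b, \<gamma>)))"

definition locally_p_integrable :: "real \<Rightarrow> ('a::metric_space \<Rightarrow> ennreal) \<Rightarrow> bool" where
  "locally_p_integrable p \<rho> \<longleftrightarrow>
     \<rho> \<in> borel_measurable borel \<and>
     (\<forall>K. compact K \<longrightarrow> (\<integral>\<^sup>+ x\<in>K. ennreal_powr (\<rho> x) p \<partial>hausdorff_measure 2) < \<infinity>)"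

section \<open>Upper integral\<close>

definition upper_integral :: "'b measure \<Rightarrow> ('b \<Rightarrow> ennreal) \<Rightarrow> ennreal" where
  "upper_integral M f =
     (INF \<phi> \<in> {\<phi> \<in> borel_measurable M. AE t in M. f t \<le> \<phi> t}. \<integral>\<^sup>+ t. \<phi> t \<partial>M)"

end

theory Submission
  imports Defs
begin

text \<open>
  Write \<open>|T|\<close> for the outer Lebesgue measure of \<open>T\<close>. If every cover of \<open>E\<close> by small sets \<open>A\<^sub>i\<close> can be
  chosen with \<open>\<Sum> diam A\<^sub>i |{t. L\<^sub>t meets A\<^sub>i}| \<le> M\<close>, then Fatou's lemma bounds the upper integral of
  \<open>H\<^sup>1(E \<inter> L\<^sub>t)\<close> by \<open>M\<close>. For the level sets of a distance function this is Eilenberg's inequality.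

  For \<open>L\<^sub>t\<close> the closure of \<open>u = t\<close>, an open ball \<open>B\<close> meets \<open>L\<^sub>t\<close> iff \<open>t \<in> u(B)\<close>, and
  \<open>r |u(B(x,r))| \<le> (4/\<pi>) \<integral> \<rho> dH\<^sup>2\<close> over \<open>B(x,2r)\<close>: for \<open>r < s < 2r\<close> every point \<open>y\<close> of \<open>B(x,s)\<close>
  is separated from the outside of a chart by a single component \<open>K\<close> of the sphere of radius \<open>s\<close>,
  so weak monotonicity places \<open>u(y)\<close> between the extrema of \<open>u\<close> on \<open>K\<close>. If \<open>H\<^sup>1(K)\<close> is finite,
  any two points of \<open>K\<close> are joined in \<open>K\<close> by an injective Lipschitz path, whence the oscillation of
  \<open>u\<close> on \<open>K\<close> is at most the integral of \<open>\<rho>\<close> over \<open>K\<close>. Summing over the components, integrating over \<open>s\<close> and applying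
  Eilenberg's inequality gives the claim.

  Points with \<open>\<nu>(B(x,8r)) \<le> 100 \<nu>(B(x,r))\<close> for arbitrarily small \<open>r\<close>, where \<open>\<nu> = \<rho> H\<^sup>2\<close>, are covered by a Vitali
  argument, the radii growing by the factor \<open>4\<close> only: \<open>diam B(x,4r) |u(B(x,4r))| \<le> 2 (4/\<pi>) 100 \<nu>(B(x,r))\<close>.
  Elsewhere \<open>\<nu>(B(x,r)) = o(r\<^sup>2)\<close>, since \<open>100 > 8\<^sup>2\<close>, so an efficient cover for \<open>H\<^sup>2\<close> shows that
  these points do not contribute.
\<close>

section \<open>Upper integrals and slices\<close>

lemma upper_integral_le:
  assumes "\<phi> \<in> borel_measurable M" "AE t in M. f t \<le> \<phi> t"
  shows "upper_integral M f \<le> (\<integral>\<^sup>+ t. \<phi> t \<partial>M)"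
  unfolding upper_integral_def using assms by (intro INF_lower) auto

text \<open>A minimizing sequence of measurable majorants has a measurable pointwise infimum, which
  is again a majorant almost everywhere because only countably many null sets are involved. With
  such an optimal majorant, rules for ordinary integrals carry over to upper integrals as
  inequalities.\<close>

lemma upper_integral_attained:
  obtains \<phi> where "\<phi> \<in> borel_measurable M" "AE t in M. f t \<le> \<phi> t"
    "(\<integral>\<^sup>+ t. \<phi> t \<partial>M) = upper_integral M f"
proof -
  let ?S = "{\<phi> \<in> borel_measurable M. AE t in M. f t \<le> \<phi> t}"
  have "(\<lambda>_. top) \<in> ?S" by auto
  then have "(\<lambda>\<phi>. \<integral>\<^sup>+ t. \<phi> t \<partial>M) ` ?S \<noteq> {}" by blast
  from ennreal_Inf_countable_INF[OF this] obtain F :: "nat \<Rightarrow> ennreal" where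
    F: "range F \<subseteq> (\<lambda>\<phi>. \<integral>\<^sup>+ t. \<phi> t \<partial>M) ` ?S" "upper_integral M f = (INF i. F i)"
    unfolding upper_integral_def by blast
  then have "\<exists>\<phi>. \<phi> \<in> ?S \<and> F i = (\<integral>\<^sup>+ t. \<phi> t \<partial>M)" for i by blast
  then obtain \<phi> where \<phi>: "\<And>i. \<phi> i \<in> ?S" "\<And>i. F i = (\<integral>\<^sup>+ t. \<phi> i t \<partial>M)" by metis
  define \<psi> where "\<psi> t = (INF i. \<phi> i t)" for t
  have m: "\<psi> \<in> borel_measurable M"
    unfolding \<psi>_def using \<phi>(1) by (intro borel_measurable_INF) auto
  have "AE t in M. \<forall>i. f t \<le> \<phi> i t" using \<phi>(1) by (subst AE_all_countable) auto
  then have ae: "AE t in M. f t \<le> \<psi> t" by (auto simp: \<psi>_def intro: INF_greatest)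
  have "(\<integral>\<^sup>+ t. \<psi> t \<partial>M) \<le> F i" for i
    unfolding \<phi>(2) \<psi>_def by (intro nn_integral_mono INF_lower) auto
  then have "(\<integral>\<^sup>+ t. \<psi> t \<partial>M) = upper_integral M f"
    using upper_integral_le[OF m ae] F(2) by (intro antisym) (auto intro: INF_greatest)
  with m ae show thesis by (rule that)
qed

lemma upper_integral_mono:
  assumes "\<And>t. f t \<le> g t"
  shows "upper_integral M f \<le> upper_integral M g"
proof -
  obtain \<phi> where \<phi>: "\<phi> \<in> borel_measurable M" "AE t in M. g t \<le> \<phi> t"
    "(\<integral>\<^sup>+ t. \<phi> t \<partial>M) = upper_integral M g" by (rule upper_integral_attained)
  have "AE t in M. f t \<le> \<phi> t" using \<phi>(2) by eventually_elim (rule order_trans[OF assms])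
  from upper_integral_le[OF \<phi>(1) this] show ?thesis using \<phi>(3) by simp
qed

lemma upper_integral_suminf:
  "upper_integral M (\<lambda>t. \<Sum>i. f i t) \<le> (\<Sum>i. upper_integral M (f i))"
proof -
  have "\<exists>\<phi>. \<phi> \<in> borel_measurable M \<and> (AE t in M. f i t \<le> \<phi> t) \<and>
    (\<integral>\<^sup>+ t. \<phi> t \<partial>M) = upper_integral M (f i)" for i
    by (rule upper_integral_attained[of M "f i"]) blast
  then obtain \<phi> where \<phi>: "\<And>i. \<phi> i \<in> borel_measurable M" "\<And>i. AE t in M. f i t \<le> \<phi> i t"
    "\<And>i. (\<integral>\<^sup>+ t. \<phi> i t \<partial>M) = upper_integral M (f i)" by metis
  have "AE t in M. \<forall>i. f i t \<le> \<phi> i t" using \<phi>(2) by (simp add: AE_all_countable)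
  then have "AE t in M. (\<Sum>i. f i t) \<le> (\<Sum>i. \<phi> i t)"
    by eventually_elim (auto intro: suminf_le)
  then have "upper_integral M (\<lambda>t. \<Sum>i. f i t) \<le> (\<integral>\<^sup>+ t. (\<Sum>i. \<phi> i t) \<partial>M)"
    using \<phi>(1) by (intro upper_integral_le) auto
  also have "\<dots> = (\<Sum>i. upper_integral M (f i))"
    using \<phi>(1,3) by (subst nn_integral_suminf) auto
  finally show ?thesis .
qed

lemma upper_integral_add:
  "upper_integral M (\<lambda>t. f t + g t) \<le> upper_integral M f + upper_integral M g"
proof -
  obtain \<phi> where \<phi>: "\<phi> \<in> borel_measurable M" "AE t in M. f t \<le> \<phi> t"
    "(\<integral>\<^sup>+ t. \<phi> t \<partial>M) = upper_integral M f" by (rule upper_integral_attained)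
  obtain \<psi> where \<psi>: "\<psi> \<in> borel_measurable M" "AE t in M. g t \<le> \<psi> t"
    "(\<integral>\<^sup>+ t. \<psi> t \<partial>M) = upper_integral M g" by (rule upper_integral_attained)
  have "AE t in M. f t + g t \<le> \<phi> t + \<psi> t"
    using \<phi>(2) \<psi>(2) by eventually_elim (rule add_mono)
  then have "upper_integral M (\<lambda>t. f t + g t) \<le> (\<integral>\<^sup>+ t. \<phi> t + \<psi> t \<partial>M)"
    using \<phi>(1) \<psi>(1) by (intro upper_integral_le) auto
  also have "\<dots> = upper_integral M f + upper_integral M g"
    using \<phi> \<psi> by (subst nn_integral_add) auto
  finally show ?thesis .
qed

lemma upper_integral_cmult:
  "upper_integral M (\<lambda>t. c * f t) \<le> c * upper_integral M f"
proof -
  obtain \<phi> where \<phi>: "\<phi> \<in> borel_measurable M" "AE t in M. f t \<le> \<phi> t"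
    "(\<integral>\<^sup>+ t. \<phi> t \<partial>M) = upper_integral M f" by (rule upper_integral_attained)
  have "AE t in M. c * f t \<le> c * \<phi> t" using \<phi>(2) by eventually_elim (rule mult_left_mono; simp)
  then have "upper_integral M (\<lambda>t. c * f t) \<le> (\<integral>\<^sup>+ t. c * \<phi> t \<partial>M)"
    using \<phi>(1) by (intro upper_integral_le) auto
  also have "\<dots> = c * upper_integral M f"
    using \<phi> by (subst nn_integral_cmult) auto
  finally show ?thesis .
qed

lemma upper_integral_Fatou:
  assumes "\<And>t. f t \<le> liminf (\<lambda>n. F n t)"
  shows "upper_integral M f \<le> liminf (\<lambda>n. upper_integral M (F n))"
proof -
  have "\<exists>\<phi>. \<phi> \<in> borel_measurable M \<and> (AE t in M. F i t \<le> \<phi> t) \<and>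
    (\<integral>\<^sup>+ t. \<phi> t \<partial>M) = upper_integral M (F i)" for i
    by (rule upper_integral_attained[of M "F i"]) blast
  then obtain \<phi> where \<phi>: "\<And>i. \<phi> i \<in> borel_measurable M" "\<And>i. AE t in M. F i t \<le> \<phi> i t"
    "\<And>i. (\<integral>\<^sup>+ t. \<phi> i t \<partial>M) = upper_integral M (F i)" by metis
  have "AE t in M. \<forall>i. F i t \<le> \<phi> i t" using \<phi>(2) by (simp add: AE_all_countable)
  then have "AE t in M. f t \<le> liminf (\<lambda>i. \<phi> i t)"
    by eventually_elim (rule order_trans[OF assms Liminf_mono], auto)
  then have "upper_integral M f \<le> (\<integral>\<^sup>+ t. liminf (\<lambda>i. \<phi> i t) \<partial>M)"
    using \<phi>(1) by (intro upper_integral_le) auto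
  also have "\<dots> \<le> liminf (\<lambda>i. upper_integral M (F i))"
    using nn_integral_liminf[OF \<phi>(1)] \<phi>(3) by simp
  finally show ?thesis .
qed

lemma upper_integral_ge_interval:
  fixes a b :: real
  assumes "a \<le> b" "\<And>t. t \<in> {a<..<b} \<Longrightarrow> c \<le> f t"
  shows "c * ennreal (b - a) \<le> upper_integral lebesgue f"
proof -
  obtain \<phi> where \<phi>: "\<phi> \<in> borel_measurable lebesgue" "AE t in lebesgue. f t \<le> \<phi> t"
    "(\<integral>\<^sup>+ t. \<phi> t \<partial>lebesgue) = upper_integral lebesgue f" by (rule upper_integral_attained)
  have le: "AE t in lebesgue. c * indicator {a<..<b} t \<le> \<phi> t"
    using \<phi>(2)
  proof eventually_elim
    case (elim t)
    then show ?case using assms(2)[of t] by (auto split: split_indicator)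
  qed
  have "c * ennreal (b - a) = (\<integral>\<^sup>+ t. c * indicator {a<..<b} t \<partial>lebesgue)"
    using assms(1) by (subst nn_integral_cmult_indicator) auto
  also have "\<dots> \<le> (\<integral>\<^sup>+ t. \<phi> t \<partial>lebesgue)"
    using le by (rule nn_integral_mono_AE)
  finally show ?thesis using \<phi>(3) by simp
qed

text \<open>\<open>S\<close> lies between \<open>Inf S\<close> and \<open>Sup S\<close>, whose
  difference is at most \<open>m\<close>. The upper integral of an indicator plays the role of
  Lebesgue outer measure, so that arbitrary images under \<open>u\<close> can be measured.\<close>

lemma upper_integral_indicator_le:
  fixes m :: real
  assumes "0 \<le> m" "\<And>s t. s \<in> S \<Longrightarrow> t \<in> S \<Longrightarrow> \<bar>s - t\<bar> \<le> m"
  shows "upper_integral lebesgue (indicator S) \<le> ennreal m"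
proof (cases "S = {}")
  case True
  then show ?thesis using upper_integral_le[of "\<lambda>_. 0" lebesgue "indicator S"] by simp
next
  case False
  then obtain s0 where s0: "s0 \<in> S" by blast
  have bd: "bdd_below S" "bdd_above S"
    using assms(2)[OF s0] by (force intro!: bdd_belowI[of _ "s0 - m"] bdd_aboveI[of _ "s0 + m"])+
  have "Sup S \<le> Inf S + m"
  proof (rule cSup_least[OF False])
    fix s assume s: "s \<in> S"
    have "s - m \<le> Inf S"
      using assms(2)[OF s] by (intro cInf_greatest[OF False]) force
    then show "s \<le> Inf S + m" by simp
  qed
  have "indicator S t \<le> (indicator {Inf S..Sup S} t :: ennreal)" for t
    using bd by (auto split: split_indicator intro: cInf_lower cSup_upper)
  then have "upper_integral lebesgue (indicator S) \<le> (\<integral>\<^sup>+ t. indicator {Inf S..Sup S} t \<partial>lebesgue)"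
    by (intro upper_integral_le borel_measurable_indicator) auto
  also have "\<dots> = ennreal (Sup S - Inf S)"
    using cInf_lower[OF s0 bd(1)] cSup_upper[OF s0 bd(2)] by (subst nn_integral_indicator) auto
  also have "\<dots> \<le> ennreal m" using \<open>Sup S \<le> Inf S + m\<close> by (intro ennreal_leI) simp
  finally show ?thesis .
qed

section \<open>Slices of Hausdorff measure\<close>

text \<open>The one-dimensional gauge of a nonempty set is its diameter, so the diameters of those
  \<open>A i\<close> that meet \<open>L t\<close> bound the premeasure of the slice. Integrating in
  \<open>t\<close> multiplies each diameter by the outer measure of the parameters met, and Fatou's
  lemma passes to vanishing scale.\<close>

lemma upper_integral_hausdorff_slices:
  fixes L :: "real \<Rightarrow> 'a::metric_space set" and E :: "'a set"
  assumes "\<And>\<delta>::real. \<delta> > 0 \<Longrightarrow> \<exists>A :: nat \<Rightarrow> 'a set. E \<subseteq> (\<Union>i. A i) \<and>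
      (\<forall>i. bounded (A i) \<and> diameter (A i) \<le> \<delta>) \<and>
      (\<Sum>i. ennreal (diameter (A i)) * upper_integral lebesgue (indicator {t. L t \<inter> A i \<noteq> {}})) \<le> M"
  shows "upper_integral lebesgue (\<lambda>t. hausdorff_outer 1 (E \<inter> L t)) \<le> M"
proof -
  have "\<exists>A :: nat \<Rightarrow> 'a set. E \<subseteq> (\<Union>i. A i) \<and>
      (\<forall>i. bounded (A i) \<and> diameter (A i) \<le> 1 / real (Suc n)) \<and>
      (\<Sum>i. ennreal (diameter (A i)) * upper_integral lebesgue (indicator {t. L t \<inter> A i \<noteq> {}})) \<le> M" for n
    by (rule assms) simp
  then have "\<exists>A. \<forall>n. E \<subseteq> (\<Union>i. A n i) \<and>
      (\<forall>i. bounded (A n i) \<and> diameter (A n i) \<le> 1 / real (Suc n)) \<and>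
      (\<Sum>i. ennreal (diameter (A n i)) * upper_integral lebesgue (indicator {t. L t \<inter> A n i \<noteq> {}})) \<le> M"
    by (intro choice allI)
  then obtain A :: "nat \<Rightarrow> nat \<Rightarrow> 'a set" where A: "\<And>n. E \<subseteq> (\<Union>i. A n i)"
    "\<And>n i. bounded (A n i)" "\<And>n i. diameter (A n i) \<le> 1 / real (Suc n)"
    "\<And>n. (\<Sum>i. ennreal (diameter (A n i)) * upper_integral lebesgue (indicator {t. L t \<inter> A n i \<noteq> {}})) \<le> M"
    by blast
  define F where "F n t = (\<Sum>i. ennreal (diameter (A n i)) * indicator {t. L t \<inter> A n i \<noteq> {}} t)" for n t
  have pre: "hausdorff_pre 1 \<delta> (E \<inter> L t) \<le> F n t" if "1 / real (Suc n) \<le> \<delta>" "\<delta> > 0" for n t \<delta>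
  proof -
    define C where "C i = (if L t \<inter> A n i \<noteq> {} then A n i else {})" for i
    have "hausdorff_pre 1 \<delta> (E \<inter> L t) \<le> (\<Sum>i. hausdorff_gauge 1 (C i))"
      unfolding hausdorff_pre_def
    proof (rule INF_lower, safe)
      fix x assume "x \<in> E" "x \<in> L t"
      then show "x \<in> (\<Union>i. C i)" using A(1)[of n] unfolding C_def by fastforce
    next
      fix i show "bounded (C i)" "diameter (C i) \<le> \<delta>"
        using A(2,3)[of n i] that by (auto simp: C_def)
    qed
    also have "\<dots> \<le> F n t"
      unfolding F_def C_def
      by (intro suminf_le) (auto simp: hausdorff_gauge_def unit_ball_vol_1 split: split_indicator)
    finally show ?thesis .
  qed
  have "upper_integral lebesgue (\<lambda>t. hausdorff_outer 1 (E \<inter> L t)) \<le>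
      liminf (\<lambda>n. upper_integral lebesgue (F n))"
  proof (rule upper_integral_Fatou)
    fix t
    show "hausdorff_outer 1 (E \<inter> L t) \<le> liminf (\<lambda>n. F n t)"
      unfolding hausdorff_outer_def
    proof (rule SUP_least, rule Liminf_bounded)
      fix \<delta> :: real assume d: "\<delta> \<in> {0<..}"
      have "\<forall>\<^sub>F n in sequentially. 1 / real (Suc n) < \<delta>"
        using d LIMSEQ_inverse_real_of_nat by (intro order_tendstoD(2)) (auto simp: inverse_eq_divide)
      then show "\<forall>\<^sub>F n in sequentially. hausdorff_pre 1 \<delta> (E \<inter> L t) \<le> F n t"
        by eventually_elim (use pre d in auto)
    qed
  qed
  also have "upper_integral lebesgue (F n) \<le> M" for n
  proof -
    have "upper_integral lebesgue (F n) \<le> 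
      (\<Sum>i. upper_integral lebesgue (\<lambda>t. ennreal (diameter (A n i)) * indicator {t. L t \<inter> A n i \<noteq> {}} t))"
      unfolding F_def by (rule upper_integral_suminf)
    also have "\<dots> \<le> (\<Sum>i. ennreal (diameter (A n i)) * upper_integral lebesgue (indicator {t. L t \<inter> A n i \<noteq> {}}))"
      by (intro suminf_le upper_integral_cmult) auto
    finally show ?thesis using A(4)[of n] by simp
  qed
  then have "liminf (\<lambda>n. upper_integral lebesgue (F n)) \<le> liminf (\<lambda>n. M)"
    by (intro Liminf_mono always_eventually allI)
  finally show ?thesis by (simp add: Liminf_const)
qed

text \<open>Induction over Borel functions, from indicators through multiples, sums and increasing
  limits. Subadditivity and Fatou's lemma for upper integrals both act in the direction of the
  claimed inequality.\<close>

lemma upper_integral_slices_measurable: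
  fixes L :: "real \<Rightarrow> 'a::metric_space set" and \<rho> g :: "'a \<Rightarrow> ennreal"
  assumes L: "\<And>t. closed (L t)"
    and \<rho>: "\<rho> \<in> borel_measurable borel"
    and E: "\<And>E. E \<in> sets borel \<Longrightarrow> upper_integral lebesgue (\<lambda>t. hausdorff_outer 1 (E \<inter> L t))
      \<le> c * (\<integral>\<^sup>+ x\<in>E. \<rho> x \<partial>hausdorff_measure 2)"
    and g: "g \<in> borel_measurable borel"
  shows "upper_integral lebesgue (\<lambda>t. \<integral>\<^sup>+ x\<in>L t. g x \<partial>hausdorff_measure 1)
      \<le> c * (\<integral>\<^sup>+ x. g x * \<rho> x \<partial>hausdorff_measure 2)"
  using g
proof (induction rule: borel_measurable_induct)
  have L': "L t \<in> sets borel" for t using L by auto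
  note [measurable] = L' \<rho>
  {
    case (cong f g)
    then have "f = g" by auto
    then show ?case using cong by simp
  next
    case (set A)
    then have A[measurable]: "A \<in> sets borel" by simp
    have "(\<integral>\<^sup>+ x\<in>L t. indicator A x \<partial>hausdorff_measure 1) = hausdorff_outer 1 (A \<inter> L t)" for t
    proof -
      have "(\<integral>\<^sup>+ x\<in>L t. indicator A x \<partial>hausdorff_measure 1) =
         (\<integral>\<^sup>+ x. indicator (A \<inter> L t) x \<partial>hausdorff_measure 1)"
        by (simp add: indicator_inter_arith)
      then show ?thesis by (simp add: nn_integral_indicator emeasure_hausdorff_measure)
    qed
    then show ?case using E[OF A] by (simp add: mult.commute)
  next
    case (mult u c')
    have [measurable]: "u \<in> borel_measurable borel" using mult by simp
    have "(\<integral>\<^sup>+ x\<in>L t. (c' * u x) \<partial>hausdorff_measure 1) =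
        c' * (\<integral>\<^sup>+ x\<in>L t. u x \<partial>hausdorff_measure 1)" for t
      by (subst nn_integral_cmult[symmetric]) (auto simp: mult.assoc)
    moreover have "(\<integral>\<^sup>+ x. (c' * u x) * \<rho> x \<partial>hausdorff_measure 2) =
        c' * (\<integral>\<^sup>+ x. u x * \<rho> x \<partial>hausdorff_measure 2)"
      by (subst nn_integral_cmult[symmetric]) (auto simp: mult.assoc)
    moreover have "c' * upper_integral lebesgue (\<lambda>t. \<integral>\<^sup>+ x\<in>L t. u x \<partial>hausdorff_measure 1)
        \<le> c' * (c * (\<integral>\<^sup>+ x. u x * \<rho> x \<partial>hausdorff_measure 2))"
      using mult.IH by (rule mult_left_mono) simp
    ultimately show ?case
      using order_trans[OF upper_integral_cmult] by (simp add: mult.left_commute)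
  next
    case (add u v)
    have [measurable]: "u \<in> borel_measurable borel" "v \<in> borel_measurable borel" using add by auto
    have "(\<integral>\<^sup>+ x\<in>L t. (v x + u x) \<partial>hausdorff_measure 1) =
        (\<integral>\<^sup>+ x\<in>L t. v x \<partial>hausdorff_measure 1) + (\<integral>\<^sup>+ x\<in>L t. u x \<partial>hausdorff_measure 1)" for t
      by (subst nn_integral_add[symmetric]) (auto simp: distrib_right)
    moreover have "(\<integral>\<^sup>+ x. (v x + u x) * \<rho> x \<partial>hausdorff_measure 2) =
        (\<integral>\<^sup>+ x. v x * \<rho> x \<partial>hausdorff_measure 2) + (\<integral>\<^sup>+ x. u x * \<rho> x \<partial>hausdorff_measure 2)"
      by (subst nn_integral_add[symmetric]) (auto simp: distrib_right)
    ultimately show ?case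
      using add_mono[OF add.IH(2) add.IH(1)] order_trans[OF upper_integral_add]
      by (simp add: distrib_left)
  next
    case (seq U)
    have [measurable]: "\<And>i. U i \<in> borel_measurable borel" using seq by simp
    have "upper_integral lebesgue (\<lambda>t. \<integral>\<^sup>+ x\<in>L t. (SUP i. U i) x \<partial>hausdorff_measure 1) \<le>
      liminf (\<lambda>n. upper_integral lebesgue (\<lambda>t. \<integral>\<^sup>+ x\<in>L t. U n x \<partial>hausdorff_measure 1))"
    proof (rule upper_integral_Fatou)
      fix t
      have "(\<integral>\<^sup>+ x\<in>L t. (SUP i. U i) x \<partial>hausdorff_measure 1) =
          (\<integral>\<^sup>+ x. (SUP i. U i x * indicator (L t) x) \<partial>hausdorff_measure 1)"
        by (intro nn_integral_cong) (auto split: split_indicator simp: image_image)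
      also have "\<dots> = (SUP i. \<integral>\<^sup>+ x\<in>L t. U i x \<partial>hausdorff_measure 1)"
        using seq(3) by (intro nn_integral_monotone_convergence_SUP)
          (auto simp: incseq_def le_fun_def intro!: mult_right_mono)
      also have "\<dots> = liminf (\<lambda>i. \<integral>\<^sup>+ x\<in>L t. U i x \<partial>hausdorff_measure 1)"
        using seq(3) by (intro lim_imp_Liminf[symmetric] LIMSEQ_SUP)
          (auto simp: incseq_def le_fun_def intro!: nn_integral_mono mult_right_mono)
      finally show "(\<integral>\<^sup>+ x\<in>L t. (SUP i. U i) x \<partial>hausdorff_measure 1) \<le>
          liminf (\<lambda>i. \<integral>\<^sup>+ x\<in>L t. U i x \<partial>hausdorff_measure 1)" by simp
    qed
    also have "\<dots> \<le> liminf (\<lambda>n. c * (\<integral>\<^sup>+ x. (SUP i. U i) x * \<rho> x \<partial>hausdorff_measure 2))"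
    proof (intro Liminf_mono always_eventually allI)
      fix n
      have "U n x \<le> (SUP i. U i) x" for x by (simp add: image_image SUP_upper[of n UNIV "\<lambda>i. U i x"])
      then have "c * (\<integral>\<^sup>+ x. U n x * \<rho> x \<partial>hausdorff_measure 2) \<le>
          c * (\<integral>\<^sup>+ x. (SUP i. U i) x * \<rho> x \<partial>hausdorff_measure 2)"
        by (intro mult_left_mono nn_integral_mono mult_right_mono) auto
      with seq.IH[of n] show "upper_integral lebesgue (\<lambda>t. \<integral>\<^sup>+ x\<in>L t. U n x \<partial>hausdorff_measure 1) \<le>
          c * (\<integral>\<^sup>+ x. (SUP i. U i) x * \<rho> x \<partial>hausdorff_measure 2)" by (rule order_trans)
    qed
    finally show ?case by (simp add: Liminf_const)
  }
qed

section \<open>Rectifiable continua\<close>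

lemma upper_integral_levels_le_diameter:
  fixes \<phi> :: "'a::metric_space \<Rightarrow> real"
  assumes "\<And>x y. \<bar>\<phi> x - \<phi> y\<bar> \<le> dist x y" "bounded A"
  shows "upper_integral lebesgue (indicator {t. {x. \<phi> x = t} \<inter> A \<noteq> {}}) \<le> ennreal (diameter A)"
  using assms by (intro upper_integral_indicator_le diameter_ge_0)
    (auto intro: order_trans[OF assms(1) diameter_bounded_bound])

text \<open>The levels met by a set \<open>C i\<close> form a set of diameter at most
  \<open>diameter (C i)\<close>, so each term of the sum is at most a squared diameter. The factor
  \<open>4 / pi\<close> compares it with the two-dimensional gauge
  \<open>pi * (diameter (C i) / 2)\<^sup>2\<close>.\<close>

lemma eilenberg_set:
  fixes \<phi> :: "'a::metric_space \<Rightarrow> real"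
  assumes \<phi>: "\<And>x y. \<bar>\<phi> x - \<phi> y\<bar> \<le> dist x y"
  shows "upper_integral lebesgue (\<lambda>s. hausdorff_outer 1 (E \<inter> {x. \<phi> x = s}))
    \<le> ennreal (4 / pi) * hausdorff_outer 2 E"
proof (rule ennreal_le_epsilon)
  fix e :: real
  assume e: "0 < e" and fin: "ennreal (4 / pi) * hausdorff_outer 2 E < top"
  then have fin: "hausdorff_outer 2 E < top"
    by (auto simp: ennreal_mult_less_top)
  define M where "M = ennreal (4 / pi) * (hausdorff_outer 2 E + ennreal (e * pi / 4))"
  have "upper_integral lebesgue (\<lambda>s. hausdorff_outer 1 (E \<inter> {x. \<phi> x = s})) \<le> M"
  proof (rule upper_integral_hausdorff_slices)
    fix \<delta> :: real assume "\<delta> > 0"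
    then have "hausdorff_pre 2 \<delta> E \<le> hausdorff_outer 2 E"
      unfolding hausdorff_outer_def by (intro SUP_upper) auto
    also have "\<dots> < hausdorff_outer 2 E + ennreal (e * pi / 4)"
      using fin e by (cases "hausdorff_outer 2 E") (auto simp: ennreal_plus[symmetric] ennreal_less_iff simp del: ennreal_plus)
    finally obtain C :: "nat \<Rightarrow> 'a set" where C: "E \<subseteq> (\<Union>i. C i)"
      "\<And>i. bounded (C i)" "\<And>i. diameter (C i) \<le> \<delta>"
      "(\<Sum>i. hausdorff_gauge 2 (C i)) < hausdorff_outer 2 E + ennreal (e * pi / 4)"
      unfolding hausdorff_pre_def INF_less_iff by blast
    have "(\<Sum>i. ennreal (diameter (C i)) *
        upper_integral lebesgue (indicator {t. {x. \<phi> x = t} \<inter> C i \<noteq> {}}))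
        \<le> (\<Sum>i. ennreal (4 / pi) * hausdorff_gauge 2 (C i))"
    proof (intro suminf_le summableI)
      fix i
      have "ennreal (diameter (C i)) *
        upper_integral lebesgue (indicator {t. {x. \<phi> x = t} \<inter> C i \<noteq> {}}) \<le>
        ennreal (diameter (C i)) * ennreal (diameter (C i))"
        using upper_integral_levels_le_diameter[OF \<phi> C(2)] by (intro mult_left_mono) auto
      also have "\<dots> = ennreal (4 / pi) * hausdorff_gauge 2 (C i)"
        using diameter_ge_0[OF C(2)[of i]]
        by (simp add: hausdorff_gauge_def unit_ball_vol_2 power2_eq_square flip: ennreal_mult)
      finally show "ennreal (diameter (C i)) *
        upper_integral lebesgue (indicator {t. {x. \<phi> x = t} \<inter> C i \<noteq> {}}) \<le> \<dots>" .
    qed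
    also have "\<dots> \<le> M"
      unfolding M_def using C(4) by (subst ennreal_suminf_cmult) (intro mult_left_mono, auto)
    finally show "\<exists>A::nat \<Rightarrow> 'a set. E \<subseteq> (\<Union>i. A i) \<and>
      (\<forall>i. bounded (A i) \<and> diameter (A i) \<le> \<delta>) \<and>
      (\<Sum>i. ennreal (diameter (A i)) *
        upper_integral lebesgue (indicator {t. {x. \<phi> x = t} \<inter> A i \<noteq> {}})) \<le> M"
      using C by blast
  qed
  also have "M = ennreal (4 / pi) * hausdorff_outer 2 E + ennreal e"
    using e by (simp add: M_def distrib_left flip: ennreal_mult)
  finally show "upper_integral lebesgue (\<lambda>s. hausdorff_outer 1 (E \<inter> {x. \<phi> x = s})) \<le> \<dots>" .
qed

lemma eilenberg:
  fixes \<phi> :: "'a::metric_space \<Rightarrow> real"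
  assumes \<phi>: "\<And>x y. \<bar>\<phi> x - \<phi> y\<bar> \<le> dist x y" and g: "g \<in> borel_measurable borel"
  shows "upper_integral lebesgue (\<lambda>s. \<integral>\<^sup>+ x\<in>{x. \<phi> x = s}. g x \<partial>hausdorff_measure 1)
    \<le> ennreal (4 / pi) * (\<integral>\<^sup>+ x. g x \<partial>hausdorff_measure 2)"
proof -
  have "continuous_on UNIV \<phi>"
    using \<phi> by (intro lipschitz_on_continuous_on[of 1] lipschitz_onI) (auto simp: dist_real_def)
  then have "closed {x. \<phi> x = s}" for s
    by (intro closed_Collect_eq continuous_intros)
  moreover have "upper_integral lebesgue (\<lambda>t. hausdorff_outer 1 (E \<inter> {x. \<phi> x = t}))
      \<le> ennreal (4 / pi) * (\<integral>\<^sup>+ x\<in>E. 1 \<partial>hausdorff_measure 2)" if "E \<in> sets borel" for E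
    using eilenberg_set[OF \<phi>, of E] that by (simp add: emeasure_hausdorff_measure)
  ultimately show ?thesis
    using upper_integral_slices_measurable[of "\<lambda>s. {x. \<phi> x = s}" "\<lambda>_. 1" "ennreal (4 / pi)" g] g
    by simp
qed

section \<open>Continua of finite length\<close>

text \<open>The distance from \<open>a\<close> takes on \<open>K\<close> all values from
  \<open>0\<close> to \<open>dist a b\<close>. The sets of any cover have images of outer measure at
  most their diameters, so these diameters sum to at least \<open>dist a b\<close>.\<close>

lemma hausdorff_outer_1_ge_dist:
  fixes K :: "'a::metric_space set"
  assumes "connected K" "a \<in> K" "b \<in> K"
  shows "ennreal (dist a b) \<le> hausdorff_outer 1 K"
proof -
  have "ennreal (dist a b) \<le> hausdorff_pre 1 1 K"
    unfolding hausdorff_pre_def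
  proof (rule INF_greatest, safe)
    fix C :: "nat \<Rightarrow> 'a set"
    assume C: "K \<subseteq> (\<Union>i. C i)" "\<forall>i. bounded (C i) \<and> diameter (C i) \<le> 1"
    have "connected (dist a ` K)"
      using assms by (intro connected_continuous_image continuous_intros)
    moreover have "0 \<in> dist a ` K" "dist a b \<in> dist a ` K" using assms by force+
    ultimately have sub: "{0..dist a b} \<subseteq> dist a ` K"
      by (rule connected_contains_Icc)
    have "1 * ennreal (dist a b - 0) \<le>
      upper_integral lebesgue (\<lambda>t. \<Sum>i. indicator {t. {x. dist a x = t} \<inter> C i \<noteq> {}} t)"
    proof (rule upper_integral_ge_interval)
      fix t assume "t \<in> {0<..<dist a b}"
      then have "t \<in> dist a ` K" using sub by (auto simp: subset_iff)
      then obtain x where "x \<in> K" "dist a x = t" by blast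
      with C obtain i where "x \<in> C i" "dist a x = t" by blast
      then have "t \<in> {t. {x. dist a x = t} \<inter> C i \<noteq> {}}" by blast
      then have "1 \<le> (\<Sum>i\<in>{i}. indicator {t. {x. dist a x = t} \<inter> C i \<noteq> {}} t :: ennreal)"
        by auto
      also have "\<dots> \<le> (\<Sum>i. indicator {t. {x. dist a x = t} \<inter> C i \<noteq> {}} t)"
        by (rule sum_le_suminf) auto
      finally show "1 \<le> (\<Sum>i. indicator {t. {x. dist a x = t} \<inter> C i \<noteq> {}} t :: ennreal)" .
    qed simp
    also have "\<dots> \<le> (\<Sum>i. upper_integral lebesgue (indicator {t. {x. dist a x = t} \<inter> C i \<noteq> {}}))"
      by (rule upper_integral_suminf)
    also have "\<dots> \<le> (\<Sum>i. hausdorff_gauge 1 (C i))"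
    proof (intro suminf_le summableI)
      fix i
      have "upper_integral lebesgue (indicator {t. {x. dist a x = t} \<inter> C i \<noteq> {}}) \<le> ennreal (diameter (C i))"
        using C(2) abs_dist_diff_le[of _ a] by (intro upper_integral_levels_le_diameter) (auto simp: dist_commute)
      also have "\<dots> = hausdorff_gauge 1 (C i)"
        by (simp add: hausdorff_gauge_def unit_ball_vol_1)
      finally show "upper_integral lebesgue (indicator {t. {x. dist a x = t} \<inter> C i \<noteq> {}}) \<le> \<dots>" .
    qed
    finally show "ennreal (dist a b) \<le> (\<Sum>i. hausdorff_gauge 1 (C i))" by simp
  qed
  also have "\<dots> \<le> hausdorff_outer 1 K"
    unfolding hausdorff_outer_def by (intro SUP_upper) auto
  finally show ?thesis .
qed

text \<open>Each set of a nearly optimal cover is thickened to an open set, which permits passing to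
  a finite subcover later. The bound \<open>w i\<close> on distances is kept strictly positive so
  that it can serve as a length of time.\<close>

lemma hausdorff_pre_1_open_cover:
  fixes K :: "'a::metric_space set"
  assumes "hausdorff_pre 1 \<delta> K < ennreal L" "\<delta> > 0"
  obtains U :: "nat \<Rightarrow> 'a set" and w :: "nat \<Rightarrow> real" where
    "K \<subseteq> (\<Union>i. U i)" "\<And>i. open (U i)" "\<And>i x y. x \<in> U i \<Longrightarrow> y \<in> U i \<Longrightarrow> dist x y \<le> w i"
    "\<And>i. 0 < w i" "\<And>i. w i \<le> 2 * \<delta>" "(\<Sum>i. ennreal (w i)) < ennreal L"
proof -
  obtain C :: "nat \<Rightarrow> 'a set" where C: "K \<subseteq> (\<Union>i. C i)"
      "\<And>i. bounded (C i)" "\<And>i. diameter (C i) \<le> \<delta>"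
      "(\<Sum>i. hausdorff_gauge 1 (C i)) < ennreal L"
    using assms(1) unfolding hausdorff_pre_def INF_less_iff by blast
  have gauge: "hausdorff_gauge 1 (C i) = ennreal (diameter (C i))" for i
    by (simp add: hausdorff_gauge_def unit_ball_vol_1)
  obtain S where S: "(\<Sum>i. hausdorff_gauge 1 (C i)) = ennreal S" "0 \<le> S" "S < L"
    using C(4) by (cases "(\<Sum>i. hausdorff_gauge 1 (C i))") (auto simp: ennreal_less_iff)
  \<comment> \<open>The first bound keeps \<open>w i\<close> at most \<open>2 * \<delta>\<close>;
    the second makes the terms \<open>2 * \<eta> i\<close> sum to at most half of the slack
    \<open>L - S\<close>.\<close>
  define \<eta> where "\<eta> i = min (\<delta> / 2) ((L - S) / 4 * (1/2) ^ Suc i)" for i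
  have \<eta>: "0 < \<eta> i" for i using S assms(2) by (auto simp: \<eta>_def)
  define U where "U i = (\<Union>c\<in>C i. ball c (\<eta> i))" for i
  define w where "w i = diameter (C i) + 2 * \<eta> i" for i
  have w0: "0 < w i" for i using \<eta>[of i] diameter_ge_0[OF C(2)[of i]] by (auto simp: w_def)
  show thesis
  proof (rule that)
    show "K \<subseteq> (\<Union>i. U i)" using C(1) \<eta> by (force simp: U_def)
    show "open (U i)" for i by (auto simp: U_def)
    show "dist x y \<le> w i" if xy: "x \<in> U i" "y \<in> U i" for i x y
    proof -
      obtain c where c: "c \<in> C i" "dist c x < \<eta> i" using xy unfolding U_def by (auto simp: dist_commute)
      obtain d where d: "d \<in> C i" "dist d y < \<eta> i" using xy unfolding U_def by (auto simp: dist_commute)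
      note cd = c d
      have "dist c d \<le> diameter (C i)" using cd C(2) by (intro diameter_bounded_bound)
      moreover have "dist x y \<le> dist c x + dist c d + dist d y"
        by (metis (no_types, lifting) add.commute add_left_mono dist_commute dist_triangle order_trans)
      ultimately show ?thesis using cd by (simp add: w_def)
    qed
    show "0 < w i" for i by (rule w0)
    show "w i \<le> 2 * \<delta>" for i using C(3)[of i] by (auto simp: w_def \<eta>_def)
    have "(\<Sum>i. ennreal (w i)) \<le> (\<Sum>i. ennreal (diameter (C i)) + ennreal ((L - S) / 2) * ennreal ((1/2) ^ Suc i))"
    proof (intro suminf_le summableI)
      fix i
      have "w i \<le> diameter (C i) + (L - S) / 2 * (1/2) ^ Suc i"
        by (auto simp: w_def \<eta>_def min_def)
      then show "ennreal (w i) \<le> ennreal (diameter (C i)) + ennreal ((L - S) / 2) * ennreal ((1/2) ^ Suc i)"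
        using S diameter_ge_0[OF C(2)[of i]] by (simp add: ennreal_leI flip: ennreal_mult ennreal_plus)
    qed
    also have "\<dots> = ennreal S + (\<Sum>i. ennreal ((L - S) / 2) * ennreal ((1/2) ^ Suc i))"
      using S(1) unfolding gauge by (subst suminf_add[symmetric]) auto
    also have "\<dots> = ennreal S + ennreal ((L - S) / 2)"
      unfolding ennreal_suminf_cmult
      by (subst suminf_ennreal_eq[OF zero_le_power power_half_series]) auto
    also have "\<dots> = ennreal (S + (L - S) / 2)"
      using S by (intro ennreal_plus[symmetric]) auto
    also have "\<dots> < ennreal L"
      using S(2,3) by (subst ennreal_less_iff) (auto simp: field_simps)
    finally show "(\<Sum>i. ennreal (w i)) < ennreal L" .
  qed
qed

text \<open>A step function runs through a chain of sets of a finite open cover, spending time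
  \<open>w j\<close> on \<open>U j\<close>. As no set is used twice, the total time is less than
  \<open>L\<close>, and rescaling to the unit interval gives the constant \<open>L\<close> up to the
  error \<open>e\<close> caused by the jumps.\<close>

lemma continuum_approximate_path:
  fixes K :: "'a::metric_space set"
  assumes K: "compact K" "connected K" and L: "hausdorff_outer 1 K < ennreal L"
    and ab: "a \<in> K" "b \<in> K" and e: "e > 0"
  shows "\<exists>f. f 0 = a \<and> f (1::real) = b \<and> (\<forall>t. f t \<in> K) \<and>
    (\<forall>s\<in>{0..1}. \<forall>t\<in>{0..1}. dist (f s) (f t) \<le> L * \<bar>s - t\<bar> + e)"
proof -
  \<comment> \<open>Jumps of size at most \<open>m\<close> cost \<open>2 * m = e\<close> between two
    arbitrary times. The cover is taken at scale \<open>m / 2\<close> since thickening doubles the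
    bound.\<close>
  define m where "m = e / 2"
  have m: "m > 0" using e by (simp add: m_def)
  have "hausdorff_pre 1 (m / 2) K \<le> hausdorff_outer 1 K"
    unfolding hausdorff_outer_def using m by (intro SUP_upper) auto
  then have "hausdorff_pre 1 (m / 2) K < ennreal L" using L by (rule le_less_trans)
  then obtain U :: "nat \<Rightarrow> 'a set" and w :: "nat \<Rightarrow> real" where
    U: "K \<subseteq> (\<Union>i. U i)" "\<And>i. open (U i)" "\<And>i x y. x \<in> U i \<Longrightarrow> y \<in> U i \<Longrightarrow> dist x y \<le> w i"
    and w: "\<And>i. 0 < w i" "\<And>i. w i \<le> m" "(\<Sum>i. ennreal (w i)) < ennreal L"
    using m hausdorff_pre_1_open_cover[of "m / 2" K L] by auto
  obtain J where J: "finite J" "K \<subseteq> (\<Union>i\<in>J. U i)"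
    using compactE_image[OF K(1), of UNIV U] U by (metis UNIV_I)
  \<comment> \<open>The end point carries the error \<open>m\<close> only once, so that the error does not accumulate
    when a path is extended.\<close>
  define path where "path S x \<longleftrightarrow> (\<exists>f. f 0 = a \<and> f (sum w S) = x \<and> (\<forall>t. f t \<in> K) \<and>
      (\<forall>s\<in>{0..sum w S}. dist (f s) x \<le> sum w S - s + m) \<and>
      (\<forall>s t. 0 \<le> s \<longrightarrow> s \<le> t \<longrightarrow> t \<le> sum w S \<longrightarrow> dist (f s) (f t) \<le> t - s + 2 * m))" for S x
  have path_extend: "path (insert j S) y"
    if prem: "path S x" "finite S" "j \<notin> S" "x \<in> U j" "y \<in> U j" "y \<in> K" for S x j y
  proof -
    define W where "W = sum w S"
    have W: "0 \<le> W" unfolding W_def using w(1) by (intro sum_nonneg) (auto intro: less_imp_le)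
    have W': "sum w (insert j S) = W + w j" using that by (simp add: W_def)
    obtain f where f': "f 0 = a" "f W = x" "\<forall>t. f t \<in> K"
      "\<forall>s\<in>{0..W}. dist (f s) x \<le> W - s + m"
      "\<forall>s t. 0 \<le> s \<longrightarrow> s \<le> t \<longrightarrow> t \<le> W \<longrightarrow> dist (f s) (f t) \<le> t - s + 2 * m"
      using prem(1) unfolding path_def W_def[symmetric] by blast
    then have f: "f 0 = a" "f W = x" "\<And>t. f t \<in> K"
      "\<And>s. 0 \<le> s \<Longrightarrow> s \<le> W \<Longrightarrow> dist (f s) x \<le> W - s + m"
      "\<And>s t. 0 \<le> s \<Longrightarrow> s \<le> t \<Longrightarrow> t \<le> W \<Longrightarrow> dist (f s) (f t) \<le> t - s + 2 * m"
      by auto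
    have xy: "dist x y \<le> w j" using U(3) that by blast
    define g where "g t = (if t \<le> W then f t else y)" for t
    have to_y: "dist (f s) y \<le> W - s + m + w j" if "0 \<le> s" "s \<le> W" for s
      using dist_triangle[of "f s" y x] f(4)[OF that] xy by simp
    show ?thesis unfolding path_def W'
    proof (intro exI[of _ g] conjI allI impI ballI)
      show "g 0 = a" "g (W + w j) = y" "\<And>t. g t \<in> K"
        using W f(1,3) w(1)[of j] that by (auto simp: g_def)
      show "dist (g s) y \<le> W + w j - s + m" if "s \<in> {0..W + w j}" for s
        using to_y[of s] that m w(1)[of j] by (auto simp: g_def)
      \<comment> \<open>If the new jump falls between \<open>s\<close> and \<open>t\<close>, its
        width \<open>w j \<le> m\<close> accounts for the second \<open>m\<close>.\<close>
      show "dist (g s) (g t) \<le> t - s + 2 * m" if "0 \<le> s" "s \<le> t" "t \<le> W + w j" for s t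
        using to_y[of s] that m w(2)[of j] f(5)[of s t] by (auto simp: g_def)
    qed
  qed
  have path_empty: "path {} a" unfolding path_def using ab m by (intro exI[of _ "\<lambda>_. a"]) auto
  \<comment> \<open>Paths stay inside \<open>S\<close>, so extending one to a new index \<open>j\<close> uses every \<open>w j\<close> at most once.\<close>
  define H where "H S \<longleftrightarrow> S \<subseteq> J \<and> S \<noteq> {} \<and> (\<forall>j\<in>S. U j \<inter> K \<noteq> {}) \<and>
     (\<forall>y\<in>K \<inter> (\<Union>j\<in>S. U j). \<exists>S'\<subseteq>S. path S' y)" for S
  obtain j0 where j0: "j0 \<in> J" "a \<in> U j0" using J(2) ab by auto
  have "path {j0} y" if "y \<in> K" "y \<in> U j0" for y
    using path_extend[OF path_empty, of j0 y] that j0 by simp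
  then have "H {j0}" unfolding H_def using j0 ab by auto
  then have ne: "Collect H \<noteq> {}" by blast
  have fin: "finite (Collect H)"
    by (rule finite_subset[of _ "Pow J"]) (auto simp: H_def J(1))
  obtain S where S: "H S" and max: "\<And>T. H T \<Longrightarrow> S \<subseteq> T \<Longrightarrow> T = S"
    using finite_has_maximal[OF fin ne] by auto
  have SJ: "S \<subseteq> J" "S \<noteq> {}" "\<And>j. j \<in> S \<Longrightarrow> U j \<inter> K \<noteq> {}"
    "\<And>y. y \<in> K \<Longrightarrow> y \<in> (\<Union>j\<in>S. U j) \<Longrightarrow> \<exists>S'\<subseteq>S. path S' y"
    using S unfolding H_def by auto
  \<comment> \<open>A maximal \<open>S\<close> must cover \<open>K\<close>: otherwise the open sets
    indexed by \<open>S\<close> and by \<open>J - S\<close> would overlap inside the connected set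
    \<open>K\<close>, and a path to a common point could be extended into a new set.\<close>
  have KS: "K \<subseteq> (\<Union>j\<in>S. U j)"
  proof (rule ccontr)
    assume n: "\<not> K \<subseteq> (\<Union>j\<in>S. U j)"
    have "(\<Union>j\<in>S. U j) \<inter> (\<Union>j\<in>J - S. U j) \<inter> K \<noteq> {}"
    proof
      assume disj: "(\<Union>j\<in>S. U j) \<inter> (\<Union>j\<in>J - S. U j) \<inter> K = {}"
      have cov: "K \<subseteq> (\<Union>j\<in>S. U j) \<union> (\<Union>j\<in>J - S. U j)" using J(2) by blast
      have "open (\<Union>j\<in>S. U j)" "open (\<Union>j\<in>J - S. U j)" using U(2) by auto
      from connectedD[OF K(2) this disj cov]
      have "(\<Union>j\<in>S. U j) \<inter> K = {} \<or> (\<Union>j\<in>J - S. U j) \<inter> K = {}" .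
      then show False
      proof
        assume "(\<Union>j\<in>S. U j) \<inter> K = {}"
        then show False using SJ(2,3) by blast
      next
        assume "(\<Union>j\<in>J - S. U j) \<inter> K = {}"
        then show False using cov n by blast
      qed
    qed
    then obtain x j where x: "x \<in> K" "x \<in> (\<Union>j\<in>S. U j)" "j \<in> J" "j \<notin> S" "x \<in> U j" by blast
    then obtain S' where S': "S' \<subseteq> S" "path S' x" using SJ(4) by blast
    have finS': "finite S'" using S'(1) SJ(1) J(1) by (meson finite_subset)
    have "\<exists>S''\<subseteq>insert j S. path S'' y" if yK: "y \<in> K \<inter> (\<Union>j\<in>insert j S. U j)" for y
    proof (cases "y \<in> U j")
      case True
      then have "path (insert j S') y" using x S'(1) yK by (intro path_extend[OF S'(2) finS']) auto
      then show ?thesis using S'(1) by (intro exI[of _ "insert j S'"]) auto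
    next
      case False
      then obtain S'' where "S'' \<subseteq> S" "path S'' y" using SJ(4)[of y] yK False by auto
      then show ?thesis by (intro exI[of _ S'']) auto
    qed
    moreover have "U i \<inter> K \<noteq> {}" if "i \<in> insert j S" for i
      using that SJ(3)[of i] x(1,5) by auto
    ultimately have "H (insert j S)" using SJ(1) x(3) unfolding H_def by simp
    then have "insert j S = S" by (rule max) auto
    then show False using x by blast
  qed
  then have "b \<in> (\<Union>j\<in>S. U j)" using ab by blast
  then obtain S' where S': "S' \<subseteq> S" "path S' b" using SJ(4) ab by blast
  define W where "W = sum w S'"
  have W0: "0 \<le> W" unfolding W_def using w(1) by (intro sum_nonneg) (auto intro: less_imp_le)
  have "finite S'" using S'(1) SJ(1) J(1) by (meson finite_subset)
  then have "ennreal W \<le> (\<Sum>i. ennreal (w i))"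
    unfolding W_def using w(1) by (subst sum_ennreal[symmetric]) (auto intro: sum_le_suminf less_imp_le)
  then have "ennreal W < ennreal L" using w(3) by (rule le_less_trans)
  then have WL: "W < L" using W0 by (simp add: ennreal_less_iff)
  obtain f where f: "f 0 = a" "f W = b" "\<And>t. f t \<in> K"
      "\<And>s t. 0 \<le> s \<Longrightarrow> s \<le> t \<Longrightarrow> t \<le> W \<Longrightarrow> dist (f s) (f t) \<le> t - s + 2 * m"
    using S'(2) unfolding path_def W_def by blast
  have le: "dist (f (W * s)) (f (W * t)) \<le> L * (t - s) + e" if "0 \<le> s" "s \<le> t" "t \<le> 1" for s t
  proof -
    have "dist (f (W * s)) (f (W * t)) \<le> W * t - W * s + 2 * m"
      using that W0 mult_left_mono[of s t W] mult_left_mono[of t 1 W] by (intro f(4)) auto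
    also have "\<dots> \<le> L * (t - s) + e"
      using mult_right_mono[of W L "t - s"] WL that by (simp add: m_def algebra_simps)
    finally show ?thesis .
  qed
  show ?thesis
  proof (intro exI[of _ "\<lambda>t. f (W * t)"] conjI ballI allI)
    fix s t :: real assume "s \<in> {0..1}" "t \<in> {0..1}"
    then show "dist (f (W * s)) (f (W * t)) \<le> L * \<bar>s - t\<bar> + e"
      using le[of s t] le[of t s] by (cases "s \<le> t") (auto simp: dist_commute)
  qed (use f in auto)
qed

lemma lipschitz_path_compactness:
  fixes K :: "'a::metric_space set" and L :: real
  assumes K: "compact K"
    and ex: "\<And>e. e > 0 \<Longrightarrow> \<exists>f. f 0 = a \<and> f (1::real) = b \<and> (\<forall>t. f t \<in> K) \<and>
    (\<forall>s\<in>{0..1}. \<forall>t\<in>{0..1}. dist (f s) (f t) \<le> L * \<bar>s - t\<bar> + e)"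
  obtains f where "f 0 = a" "f (1::real) = b" "\<And>t. f t \<in> K"
    "\<And>s t. s \<in> {0..1} \<Longrightarrow> t \<in> {0..1} \<Longrightarrow> dist (f s) (f t) \<le> L * \<bar>s - t\<bar>"
proof -
  \<comment> \<open>Tychonoff's theorem replaces Arzela--Ascoli, as the approximate paths need not be continuous.\<close>
  define P where "P = (\<Pi>\<^sub>E t\<in>(UNIV::real set). K)"
  define G where "G e = (\<Inter>s\<in>{0..1::real}. \<Inter>t\<in>{0..1}.
      {f. f 0 = a \<and> f 1 = b \<and> dist (f s) (f t) \<le> L * \<bar>s - t\<bar> + e})" for e
  have "compactin (product_topology (\<lambda>i::real. euclidean) UNIV) P"
    unfolding P_def using K by (subst compactin_PiE) auto
  then have cP: "compact P" unfolding euclidean_product_topology by simp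
  have closed: "closed (G e)" for e
  proof -
    have "closed {f. f 0 = a \<and> f 1 = b \<and> dist (f s) (f t) \<le> L * \<bar>s - t\<bar> + e}" for s t :: real
      by (intro closed_Collect_conj closed_Collect_eq closed_Collect_le continuous_intros
          continuous_on_product_coordinates)
    then show ?thesis unfolding G_def by (intro closed_INT) auto
  qed
  \<comment> \<open>Finitely many errors have a positive minimum \<open>e\<close>, and an
    approximate path for \<open>e\<close> satisfies all the corresponding constraints.\<close>
  have "P \<inter> \<Inter>(G ` {0<..}) \<noteq> {}"
  proof (rule compact_imp_fip_image[OF cP])
    fix I :: "real set" assume I: "finite I" "I \<subseteq> {0<..}"
    define e where "e = Min (insert 1 I)"
    have "e > 0" unfolding e_def using I by (subst Min_gr_iff) auto
    moreover have "e \<le> i" if "i \<in> I" for i unfolding e_def using I that by (intro Min_le) auto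
    ultimately obtain f where f: "f 0 = a" "f (1::real) = b" "\<And>t. f t \<in> K"
      "\<And>s t i. s \<in> {0..1} \<Longrightarrow> t \<in> {0..1} \<Longrightarrow> i \<in> I \<Longrightarrow> dist (f s) (f t) \<le> L * \<bar>s - t\<bar> + i"
      using ex[of e] by (meson add_left_mono order_trans)
    then have "f \<in> P \<inter> \<Inter>(G ` I)" by (auto simp: P_def G_def)
    then show "P \<inter> \<Inter>(G ` I) \<noteq> {}" by blast
  qed (use closed in auto)
  then obtain f where f: "f \<in> P" "\<And>e. e > 0 \<Longrightarrow> f \<in> G e" by auto
  show thesis
  proof (rule that)
    have "f 0 = a \<and> f 1 = b" using f(2)[of 1] unfolding G_def by force
    then show "f 0 = a" "f 1 = b" by auto
    show "f t \<in> K" for t using f(1) by (auto simp: P_def)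
    show "dist (f s) (f t) \<le> L * \<bar>s - t\<bar>" if "s \<in> {0..1}" "t \<in> {0..1}" for s t
      by (rule field_le_epsilon) (use f(2) that in \<open>auto simp: G_def\<close>)
  qed
qed

text \<open>The path integral counts multiplicity. Along an injective path this is at most one, so
  the integral over \<open>K\<close> becomes an upper bound; the Lipschitz condition makes the path
  rectifiable.\<close>

lemma continuum_injective_lipschitz_path:
  fixes K :: "'a::metric_space set"
  assumes K: "compact K" "connected K" and fin: "hausdorff_outer 1 K < top"
    and ab: "a \<in> K" "b \<in> K" "a \<noteq> b"
  obtains f L where "f 0 = a" "f (1::real) = b" "\<And>t. f t \<in> K" "inj_on f {0..1}" "(0::real) \<le> L"
    "\<And>s t. s \<in> {0..1} \<Longrightarrow> t \<in> {0..1} \<Longrightarrow> dist (f s) (f t) \<le> L * \<bar>s - t\<bar>"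
proof -
  \<comment> \<open>A path with the least possible Lipschitz constant on \<open>{0..1}\<close> is injective: cutting out a loop and
    rescaling would lower the constant.\<close>
  define Lip where "Lip L \<longleftrightarrow> (\<exists>f. f 0 = a \<and> f (1::real) = b \<and> (\<forall>t. f t \<in> K) \<and>
    (\<forall>s\<in>{0..1}. \<forall>t\<in>{0..1}. dist (f s) (f t) \<le> L * \<bar>s - t\<bar>))" for L
  obtain L0 where L0: "hausdorff_outer 1 K < ennreal L0"
    using fin
  proof (cases "hausdorff_outer 1 K")
    case (real r)
    then show thesis using that[of "r + 1"] by (simp add: ennreal_less_iff)
  qed simp
  have "Lip L0"
    unfolding Lip_def
    by (rule lipschitz_path_compactness[OF K(1) continuum_approximate_path[OF K L0 ab(1,2)]]) blast+
  have low: "dist a b \<le> L" if Lip: "Lip L" for L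
  proof -
    obtain f where "f 0 = a" "f (1::real) = b"
      "\<forall>s\<in>{0..1}. \<forall>t\<in>{0..1}. dist (f s) (f t) \<le> L * \<bar>s - t\<bar>"
      using Lip unfolding Lip_def by blast
    moreover from this(3)[rule_format, of 0 1] have "dist (f 0) (f 1) \<le> L" by simp
    ultimately show ?thesis by simp
  qed
  define m where "m = Inf (Collect Lip)"
  have bdd: "bdd_below (Collect Lip)" using low by (intro bdd_belowI[of _ "dist a b"]) auto
  have ne: "Collect Lip \<noteq> {}" using \<open>Lip L0\<close> by blast
  \<comment> \<open>Every admissible constant is at least \<open>dist a b\<close>, and
    \<open>a \<noteq> b\<close>, so the infimum is positive and shrinking it by the factor
    \<open>1 - h\<close> is strict.\<close>
  have "dist a b \<le> m" unfolding m_def using low by (intro cInf_greatest[OF ne]) auto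
  then have m0: "m > 0" using ab by (simp add: less_le_trans[of 0 "dist a b"])
  have min: "m \<le> L" if "Lip L" for L unfolding m_def using that by (intro cInf_lower bdd) auto
  obtain f where f: "f 0 = a" "f (1::real) = b" "\<And>t. f t \<in> K"
    "\<And>s t. s \<in> {0..1} \<Longrightarrow> t \<in> {0..1} \<Longrightarrow> dist (f s) (f t) \<le> m * \<bar>s - t\<bar>"
  proof (rule lipschitz_path_compactness[OF K(1)])
    fix e :: real assume e: "e > 0"
    then obtain L where L: "Lip L" "L < m + e"
      using cInf_lessD[OF ne, of "m + e"] unfolding m_def by auto
    then obtain f where f: "f 0 = a" "f (1::real) = b" "\<And>t. f t \<in> K"
      "\<And>s t. s \<in> {0..1} \<Longrightarrow> t \<in> {0..1} \<Longrightarrow> dist (f s) (f t) \<le> L * \<bar>s - t\<bar>"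
      unfolding Lip_def by blast
    have "L * \<bar>s - t\<bar> \<le> m * \<bar>s - t\<bar> + e" if "s \<in> {0..1}" "t \<in> {0..1}" for s t :: real
    proof -
      have "L * \<bar>s - t\<bar> \<le> (m + e) * \<bar>s - t\<bar>" using L by (intro mult_right_mono) auto
      also have "e * \<bar>s - t\<bar> \<le> e * 1" using that e by (intro mult_left_mono) auto
      then have "(m + e) * \<bar>s - t\<bar> \<le> m * \<bar>s - t\<bar> + e" by (simp add: distrib_right)
      finally show ?thesis .
    qed
    then show "\<exists>f. f 0 = a \<and> f (1::real) = b \<and> (\<forall>t. f t \<in> K) \<and>
        (\<forall>s\<in>{0..1}. \<forall>t\<in>{0..1}. dist (f s) (f t) \<le> m * \<bar>s - t\<bar> + e)"
      using f by (intro exI[of _ f]) (meson order_trans)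
  qed blast
  have no_loop: False if st: "0 \<le> s" "s < t" "t \<le> 1" "f s = f t" for s t
  proof -
    define h where "h = t - s"
    have h: "0 < h" "h \<le> 1" using st by (auto simp: h_def)
    \<comment> \<open>The loop between \<open>s\<close> and \<open>t\<close> is skipped and the
      remaining parameter length \<open>1 - h\<close> is stretched to the unit interval, so the
      constant drops to \<open>m * (1 - h)\<close>.\<close>
    define g where "g \<tau> = (if \<tau> * (1 - h) \<le> s then f (\<tau> * (1 - h)) else f (\<tau> * (1 - h) + h))" for \<tau>
    have le: "dist (g p) (g q) \<le> (m * (1 - h)) * (q - p)" if "0 \<le> p" "p \<le> q" "q \<le> 1" for p q
    proof -
      define p' q' where "p' = p * (1 - h)" and "q' = q * (1 - h)"
      have pq: "0 \<le> p'" "p' \<le> q'" "q' \<le> 1 - h"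
        using that h mult_right_mono[of q 1 "1 - h"] by (auto simp: p'_def q'_def intro: mult_right_mono)
      have "dist (g p) (g q) \<le> m * (q' - p')"
      proof -
        consider "q' \<le> s" | "p' \<le> s" "s < q'" | "s < p'" using pq by linarith
        then show ?thesis
        proof cases
          case 1
          then show ?thesis using f(4)[of p' q'] pq st by (simp add: g_def p'_def q'_def)
        next
          case 2
          have "dist (f p') (f (q' + h)) \<le> dist (f p') (f s) + dist (f t) (f (q' + h))"
            using dist_triangle[of "f p'" "f (q' + h)" "f s"] st by simp
          also have "\<dots> \<le> m * (s - p') + m * (q' + h - t)"
            using f(4)[of p' s] f(4)[of t "q' + h"] pq st 2 h by (auto simp: h_def abs_if split: if_splits)
          also have "\<dots> = m * (q' - p')" by (simp add: h_def algebra_simps)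
          finally show ?thesis using 2 by (simp add: g_def p'_def q'_def)
        next
          case 3
          then show ?thesis using f(4)[of "p' + h" "q' + h"] pq st h by (simp add: g_def p'_def q'_def)
        qed
      qed
      then show ?thesis by (simp add: p'_def q'_def algebra_simps)
    qed
    have "Lip (m * (1 - h))"
      unfolding Lip_def
    proof (intro exI[of _ g] conjI ballI allI)
      show "g 0 = a" using f st by (simp add: g_def)
      \<comment> \<open>If the loop extends to the end, then \<open>t = 1\<close> and
        \<open>g 1\<close> takes the value \<open>f s = f t = b\<close>.\<close>
      show "g 1 = b"
      proof (cases "1 - h \<le> s")
        case True
        then have "t = 1" using st by (simp add: h_def)
        then show ?thesis using f st True by (simp add: g_def h_def)
      next
        case False then show ?thesis using f by (simp add: g_def)
      qed
      show "g t \<in> K" for t using f by (simp add: g_def)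
      show "dist (g p) (g q) \<le> m * (1 - h) * \<bar>p - q\<bar>" if "p \<in> {0..1}" "q \<in> {0..1}" for p q
        using le[of p q] le[of q p] that by (cases "p \<le> q") (auto simp: dist_commute)
    qed
    then have "m \<le> m * (1 - h)" by (rule min)
    moreover have "0 < m * h" using m0 h by simp
    ultimately show False by (simp add: algebra_simps)
  qed
  have "inj_on f {0..1}"
    by (intro inj_onI) (metis atLeastAtMost_iff linorder_neqE_linordered_idom no_loop)
  then show thesis using that[of f m] f m0 by auto
qed

section \<open>Integrals along Lipschitz and injective paths\<close>

lemma lipschitz_path_rectifiable:
  fixes f :: "real \<Rightarrow> 'a::metric_space"
  assumes "a \<le> b" "0 \<le> L"
    and "\<And>s t. s \<in> {a..b} \<Longrightarrow> t \<in> {a..b} \<Longrightarrow> dist (f s) (f t) \<le> L * \<bar>s - t\<bar>"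
  shows "(a, b, f) \<in> cpaths" "rectifiable (a, b, f)"
proof -
  have "L-lipschitz_on {a..b} f"
    using assms by (intro lipschitz_onI) (auto simp: dist_real_def)
  then have "continuous_on {a..b} f" by (rule lipschitz_on_continuous_on)
  then show "(a, b, f) \<in> cpaths" using assms by (simp add: cpaths_def)
  have "cpath_length (a, b, f) \<le> ennreal (L * (b - a))"
    unfolding cpath_length_def prod.case
  proof (rule SUP_least, clarify)
    fix n :: nat and t :: "nat \<Rightarrow> real"
    assume t: "mono_on {..n} t" "t ` {..n} \<subseteq> {a..b}"
    have "(\<Sum>i<n. ennreal (dist (f (t i)) (f (t (Suc i))))) \<le> (\<Sum>i<n. ennreal (L * (t (Suc i) - t i)))"
    proof (rule sum_mono)
      fix i assume "i \<in> {..<n}"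
      then have "t i \<le> t (Suc i)" "t i \<in> {a..b}" "t (Suc i) \<in> {a..b}"
        using t by (auto simp: mono_on_def image_subset_iff)
      then show "ennreal (dist (f (t i)) (f (t (Suc i)))) \<le> ennreal (L * (t (Suc i) - t i))"
        using assms(3)[of "t i" "t (Suc i)"] by (intro ennreal_leI) (simp add: abs_if split: if_splits)
    qed
    also have "\<dots> = ennreal (\<Sum>i<n. L * (t (Suc i) - t i))"
      using t assms(2) by (intro sum_ennreal) (auto simp: mono_on_def intro!: mult_nonneg_nonneg)
    also have "(\<Sum>i<n. L * (t (Suc i) - t i)) = L * (t n - t 0)"
      by (simp add: sum_lessThan_telescope flip: sum_distrib_left)
    also have "ennreal (L * (t n - t 0)) \<le> ennreal (L * (b - a))"
      using t assms(2) by (intro ennreal_leI mult_left_mono) (auto simp: image_subset_iff intro!: diff_mono)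
    finally show "(\<Sum>i<n. ennreal (dist (f (t i)) (f (t (Suc i))))) \<le> ennreal (L * (b - a))" .
  qed
  then show "rectifiable (a, b, f)" by (auto simp: rectifiable_def less_top[symmetric] top_unique)
qed

text \<open>Each point has at most one preimage, and points outside \<open>K\<close> have none, so
  the multiplicity is dominated by the indicator of \<open>K\<close>.\<close>

lemma path_integral_injective_le:
  assumes "inj_on f {a..b}" "f ` {a..b} \<subseteq> K"
  shows "path_integral h (a, b, f) \<le> (\<integral>\<^sup>+ x\<in>K. h x \<partial>hausdorff_measure 1)"
  unfolding path_integral_def prod.case
proof (rule nn_integral_mono)
  fix x
  have "emeasure (count_space UNIV) {s \<in> {a..b}. f s = x} \<le> indicator K x"
  proof (cases "\<exists>s\<in>{a..b}. f s = x")
    case True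
    then obtain s where "s \<in> {a..b}" "f s = x" by blast
    then have "{s \<in> {a..b}. f s = x} = {s}" "x \<in> K" using assms by (auto simp: inj_on_def)
    then show ?thesis by simp
  next
    case False
    then have "{s \<in> {a..b}. f s = x} = {}" by blast
    then show ?thesis by (simp only: emeasure_empty) simp
  qed
  then show "emeasure (count_space UNIV) {s \<in> {a..b}. f s = x} * h x \<le> h x * indicator K x"
    by (subst (2) mult.commute) (rule mult_right_mono, auto)
qed

section \<open>Oscillation on spheres\<close>

lemma closed_sphere_metric: "closed (sphere (x::'a::metric_space) r)"
  unfolding sphere_def by (intro closed_Collect_eq continuous_intros)

text \<open>
  A component has to be nontrivial so that its \<open>H\<^sup>1\<close> measure is positive: only countably many
  components of a set of finite \<open>H\<^sup>1\<close> measure then matter.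
\<close>

definition encloses :: "'a::metric_space set \<Rightarrow> 'a \<Rightarrow> bool" where
  "encloses S y \<longleftrightarrow> (\<exists>K\<in>components S. \<exists>V. (\<exists>a\<in>K. \<exists>b\<in>K. a \<noteq> b) \<and>
     open V \<and> compact (closure V) \<and> y \<in> V \<and> frontier V \<subseteq> K)"

text \<open>In the chart, the image of the sphere separates the image of \<open>y\<close> from a
  point outside a disc. One component of this image already does so, and the complementary component
  around the image of \<open>y\<close> is carried back to the required neighbourhood
  \<open>V\<close>.\<close>

lemma sphere_component_encloses:
  fixes x :: "'a::metric_space" and W :: "(real^2) set"
  assumes "open U" "x \<in> U" "open W" "U homeomorphic W"
  obtains c where "c > 0" "compact (cball x c)"
    "\<And>s y. 0 < s \<Longrightarrow> s < c \<Longrightarrow> y \<in> ball x s \<Longrightarrow> encloses (sphere x s) y"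
proof -
  obtain f g where fg: "homeomorphism U W f g" using assms(4) by (auto simp: homeomorphic_def)
  have gf: "\<And>z. z \<in> U \<Longrightarrow> g (f z) = z" and fg': "\<And>z. z \<in> W \<Longrightarrow> f (g z) = z"
    and fU: "f ` U = W" and gW: "g ` W = U"
    and cf: "continuous_on U f" and cg: "continuous_on W g"
    using fg by (auto simp: homeomorphism_def)
  define w where "w = f x"
  have "w \<in> W" using assms(2) fU by (auto simp: w_def)
  then obtain e where e: "e > 0" "cball w e \<subseteq> W" using assms(3) open_contains_cball by blast
  have bW: "ball w e \<subseteq> W" using e(2) ball_subset_cball by blast
  have g_open: "open (g ` A)" if "open A" "A \<subseteq> W" for A
  proof -
    have "openin (top_of_set W) A" using that by (simp add: open_subset)
    then have "openin (top_of_set U) (g ` A)"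
      using fg homeomorphism_imp_open_map homeomorphism_symD by blast
    then show ?thesis using assms(1) openin_open_trans by blast
  qed
  have f_open: "open (f ` A)" if "open A" "A \<subseteq> U" for A
  proof -
    have "openin (top_of_set U) A" using that by (simp add: open_subset)
    then have "openin (top_of_set W) (f ` A)"
      using fg homeomorphism_imp_open_map by blast
    then show ?thesis using assms(3) openin_open_trans by blast
  qed
  define Q where "Q = g ` cball w e"
  have Q: "compact Q" unfolding Q_def
    using e(2) by (intro compact_continuous_image continuous_on_subset[OF cg]) auto
  have "open (g ` ball w e)" by (intro g_open bW) auto
  moreover have "x \<in> g ` ball w e"
    using gf[OF assms(2)] e(1) unfolding w_def by (intro image_eqI[of _ _ "f x"]) auto
  \<comment> \<open>Closed balls of radius at most \<open>c\<close> lie in the compact set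
    \<open>Q\<close>, hence they and their spheres are compact, which is not automatic in a metric
    space.\<close>
  ultimately obtain c where c: "c > 0" "cball x c \<subseteq> g ` ball w e"
    using open_contains_cball by blast
  have OU: "g ` ball w e \<subseteq> U" using gW bW by blast
  have cU: "cball x c \<subseteq> U" using c(2) OU by blast
  have "g ` ball w e \<subseteq> Q" unfolding Q_def using ball_subset_cball by blast
  then have cQ: "cball x c \<subseteq> Q" using c(2) by blast
  have cc: "compact (cball x s)" if "s \<le> c" for s
  proof -
    have "cball x s \<subseteq> Q" using cQ that subset_cball by blast
    then show ?thesis using closed_Int_compact[OF closed_cball Q, of x s] by (simp add: Int_absorb2)
  qed
  show thesis
  proof (rule that[OF c(1) cc])
    fix s y assume s: "0 < s" "s < c" and y: "y \<in> ball x s"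
    have sub: "sphere x s \<subseteq> cball x c" "ball x s \<subseteq> cball x c" "cball x s \<subseteq> cball x c"
      using s by auto
    have cS: "compact (sphere x s)"
      using closed_Int_compact[OF closed_sphere_metric cc[OF less_imp_le[OF s(2)]], of x s] by (simp add: Int_absorb2)
    define S where "S = f ` sphere x s"
    define B where "B = f ` ball x s"
    have S: "compact S" unfolding S_def
      using sub cU by (intro compact_continuous_image continuous_on_subset[OF cf] cS) auto
    have "f ` cball x c \<subseteq> ball w e" using c(2) fg' bW by force
    then have Sb: "S \<subseteq> ball w e" and Bb: "B \<subseteq> ball w e" using sub by (auto simp: S_def B_def)
    have oB: "open B" unfolding B_def using sub cU by (intro f_open) auto
    have injf: "\<And>p q. p \<in> cball x c \<Longrightarrow> q \<in> cball x c \<Longrightarrow> f p = f q \<Longrightarrow> p = q"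
      using gf cU by (metis subsetD)
    have "compact (f ` cball x s)"
      using sub cU s by (intro compact_continuous_image continuous_on_subset[OF cf] cc) auto
    then have "closure B \<subseteq> f ` cball x s"
      unfolding B_def by (intro closure_minimal compact_imp_closed) auto
    then have frB: "frontier B \<subseteq> S"
    proof (intro subsetI)
      fix z assume cl: "closure B \<subseteq> f ` cball x s" and z: "z \<in> frontier B"
      then have "z \<in> f ` cball x s" "z \<notin> B" using oB by (auto simp: frontier_def interior_open)
      then obtain q where q: "q \<in> cball x s" "z = f q" by blast
      then have "q \<notin> ball x s" using \<open>z \<notin> B\<close> by (auto simp: B_def)
      then have "q \<in> sphere x s" using q(1) by simp
      then show "z \<in> S" using q(2) by (auto simp: S_def)
    qed
    have "f p \<noteq> f q" if "p \<in> ball x s" "q \<in> sphere x s" for p q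
      using injf[of p q] that sub by auto
    then have BS: "B \<inter> S = {}" unfolding B_def S_def by blast
    define y' where "y' = f y"
    have y'B: "y' \<in> B" using y by (auto simp: y'_def B_def)
    obtain q where q: "q \<notin> ball w e" using not_bounded_UNIV[where ?'a = "real^2"]
      by (metis UNIV_eq_I bounded_ball)
    \<comment> \<open>A connected set from a point of \<open>B\<close> to the point \<open>q\<close>
      outside the disc meets the frontier of \<open>B\<close>, which lies in
      \<open>S\<close>.\<close>
    have "\<not> connected_component (- S) y' q"
    proof
      assume "connected_component (- S) y' q"
      then obtain T where T: "connected T" "T \<subseteq> - S" "y' \<in> T" "q \<in> T"
        by (auto simp: connected_component_def)
      have "T \<inter> frontier B \<noteq> {}"
        using T y'B q Bb by (intro connected_Int_frontier) auto
      then show False using T frB by blast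
    qed
    \<comment> \<open>This is the topological core: a closed set in the plane that separates two
      points has a component that separates them.\<close>
    then obtain K' where K': "K' \<in> components S" "\<not> connected_component (- K') y' q"
      using separation_by_component_closed_pointwise[OF compact_imp_closed[OF S]] by blast
    have K'S: "K' \<subseteq> S" using K'(1) by (rule in_components_subset)
    have K'c: "closed K'" using closed_components[OF compact_imp_closed[OF S] K'(1)] .
    have K'b: "K' \<subseteq> ball w e" using K'S Sb by blast
    have y'K: "y' \<notin> K'" using K'S BS y'B by blast
    have qK: "q \<notin> K'" using K'b q by blast
    define V' where "V' = connected_component_set (- K') y'"
    have oV': "open V'" unfolding V'_def using K'c by (intro open_connected_component) auto
    have yV': "y' \<in> V'" unfolding V'_def using y'K by (simp add: connected_component_refl)
    \<comment> \<open>The complement of the disc is connected and contains \<open>q\<close>, so a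
      point of \<open>V'\<close> outside the disc would connect \<open>y'\<close> to
      \<open>q\<close> in the complement of \<open>K'\<close>.\<close>
    have V'b: "V' \<subseteq> ball w e"
    proof (rule ccontr)
      assume "\<not> V' \<subseteq> ball w e"
      then obtain z where z: "z \<in> V'" "z \<notin> ball w e" by blast
      have "connected (- ball w e)"
        by (intro connected_complement_bounded_convex) auto
      then have "connected_component (- ball w e) z q"
        using z(2) q by (auto simp: connected_component_def)
      then have "connected_component (- K') z q"
        by (rule connected_component_of_subset) (use K'b in auto)
      then show False
        using z(1) K'(2) unfolding V'_def by (auto dest: connected_component_trans)
    qed
    have frV': "frontier V' \<subseteq> K'"
    proof -
      have "frontier V' \<subseteq> frontier (- K')"
        unfolding V'_def by (rule frontier_of_connected_component_subset)
      also have "\<dots> \<subseteq> K'" using K'c by (simp add: frontier_subset_eq)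
      finally show ?thesis .
    qed
    \<comment> \<open>A single point does not disconnect the plane.\<close>
    have nontriv: "\<exists>a\<in>K'. \<exists>b\<in>K'. a \<noteq> b"
    proof (rule ccontr)
      assume "\<not> ?thesis"
      moreover have "K' \<noteq> {}" using K'(1) by (rule in_components_nonempty)
      ultimately obtain k where k: "K' = {k}" by blast
      have "connected (- {k})" by (rule connected_punctured_universe) auto
      then have "connected_component (- K') y' q"
        using y'K qK k by (auto simp: connected_component_def)
      then show False using K'(2) by blast
    qed
    have SW: "S \<subseteq> W" using Sb bW by blast
    have "g (f k) = k" if "k \<in> sphere x s" for k using gf that sub cU by blast
    then have gS: "g ` S = sphere x s" unfolding S_def by (auto simp: image_iff)
    define K where "K = g ` K'"
    have "f (g k) = k" if "k \<in> K'" for k using fg' that K'S SW by blast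
    then have fK: "f ` K = K'" unfolding K_def by (auto simp: image_iff)
    have KS: "K \<subseteq> sphere x s" unfolding K_def using K'S gS by blast
    have K: "K \<in> components (sphere x s)"
      unfolding in_components_maximal
    proof (intro conjI allI impI)
      show "K \<noteq> {}" using nontriv by (auto simp: K_def)
      show "K \<subseteq> sphere x s" by (rule KS)
      show "connected K" unfolding K_def
        using K'S SW in_components_connected[OF K'(1)]
        by (intro connected_continuous_image continuous_on_subset[OF cg]) auto
      fix D assume D: "D \<noteq> {} \<and> K \<subseteq> D \<and> D \<subseteq> sphere x s \<and> connected D"
      then have DU: "D \<subseteq> U" using sub cU by blast
      have "connected (f ` D)" using D DU by (intro connected_continuous_image continuous_on_subset[OF cf]) auto
      moreover have "f ` D \<subseteq> S" using D by (auto simp: S_def)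
      moreover have "K' \<subseteq> f ` D" using D fK by blast
      ultimately have "f ` D = K'"
        using K'(1) D unfolding in_components_maximal by (metis image_is_empty)
      then have "g ` f ` D = K" by (simp add: K_def)
      moreover have "g (f k) = k" if "k \<in> D" for k using gf that DU by blast
      then have "g ` f ` D = D" by (auto simp: image_iff)
      ultimately show "D = K" by simp
    qed
    define V where "V = g ` V'"
    have V'W: "V' \<subseteq> W" using V'b bW by blast
    have oV: "open V" unfolding V_def by (intro g_open oV' V'W)
    have cV': "closure V' \<subseteq> cball w e" using V'b ball_subset_cball by (intro closure_minimal) auto
    then have "compact (closure V')" by (meson bounded_cball bounded_subset compact_closure bounded_closure closure_subset)
    then have cptV: "compact (g ` closure V')"
      using cV' e(2) by (intro compact_continuous_image continuous_on_subset[OF cg]) auto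
    have clV: "closure V \<subseteq> g ` closure V'"
      unfolding V_def using compact_imp_closed[OF cptV] closure_subset
      by (intro closure_minimal image_mono)
    have frV: "frontier V \<subseteq> K"
    proof
      fix z assume "z \<in> frontier V"
      then have z: "z \<in> closure V" "z \<notin> V" using oV by (auto simp: frontier_def interior_open)
      then obtain z' where z': "z' \<in> closure V'" "z = g z'" using clV by blast
      then have "z' \<notin> V'" using z(2) by (auto simp: V_def)
      then have "z' \<in> frontier V'" using z' oV' by (auto simp: frontier_def interior_open)
      then show "z \<in> K" using frV' z' by (auto simp: K_def)
    qed
    have "compact (closure V)"
      using closed_Int_compact[OF closed_closure cptV, of V] clV by (simp add: Int_absorb2)
    moreover have "y = g y'" unfolding y'_def using y sub cU by (intro gf[symmetric]) blast
    then have "y \<in> V" unfolding V_def using yV' by blast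
    moreover have "\<exists>a\<in>K. \<exists>b\<in>K. a \<noteq> b"
      using nontriv K'S SW fg' unfolding K_def by (metis imageI subsetD)
    ultimately show "encloses (sphere x s) y"
      using K oV frV unfolding encloses_def by blast
  qed simp
qed

text \<open>Connectedness gives each nontrivial component positive length. The components are
  disjoint subsets of a set of finite length, so their lengths are summable.\<close>

lemma countable_nontrivial_components:
  fixes S :: "'a::metric_space set"
  assumes S: "closed S" "hausdorff_outer 1 S < top"
  shows "countable {K \<in> components S. \<exists>a\<in>K. \<exists>b\<in>K. a \<noteq> b}"
proof -
  let ?CC = "{K \<in> components S. \<exists>a\<in>K. \<exists>b\<in>K. a \<noteq> b}"
  let ?H = "hausdorff_measure 1 :: 'a measure"
  have cl: "closed K" if "K \<in> components S" for K using closed_components[OF S(1) that] .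
  have le: "emeasure ?H K \<le> emeasure ?H S" if "K \<subseteq> S" for K
    using S(1) that by (intro emeasure_mono) auto
  have fin: "emeasure ?H K < top" if "K \<subseteq> S" for K
    using le[OF that] S by (simp add: emeasure_hausdorff_measure)
  have "(measure ?H) summable_on ?CC"
  proof (rule nonneg_bdd_above_summable_on)
    show "bdd_above (sum (measure ?H) ` {F. F \<subseteq> ?CC \<and> finite F})"
    proof (rule bdd_aboveI2)
      fix F assume "F \<in> {F. F \<subseteq> ?CC \<and> finite F}"
      then have F: "F \<subseteq> components S" "finite F" by auto
      have "sum (measure ?H) F = measure ?H (\<Union>K\<in>F. K)"
      proof (rule measure_finite_Union[symmetric])
        show "disjoint_family_on (\<lambda>K. K) F"
          using F(1) components_eq[of _ S] by (auto simp: disjoint_family_on_def)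
        show "(\<lambda>K. K) ` F \<subseteq> sets ?H" using F cl by auto
        show "emeasure ?H K \<noteq> \<infinity>" if "K \<in> F" for K
          using fin[OF in_components_subset, of K] F(1) that by auto
      qed (use F in auto)
      also have "\<dots> \<le> measure ?H S"
      proof -
        have "(\<Union>K\<in>F. K) \<subseteq> S" using F(1) in_components_subset by blast
        then show ?thesis
          unfolding measure_def using le fin[of S] by (intro enn2real_mono) auto
      qed
      finally show "sum (measure ?H) F \<le> measure ?H S" .
    qed
  qed simp
  then have cnt: "countable {K \<in> ?CC. measure ?H K \<noteq> 0}" by (rule summable_countable_real)
  have "measure ?H K \<noteq> 0" if K: "K \<in> ?CC" for K
  proof -
    obtain a b where ab: "a \<in> K" "b \<in> K" "a \<noteq> b" using K by blast
    have "ennreal (dist a b) \<le> emeasure ?H K"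
      using hausdorff_outer_1_ge_dist[OF in_components_connected ab(1,2), of S] K cl[of K]
      by (simp add: emeasure_hausdorff_measure)
    moreover have "ennreal (dist a b) > 0" using ab by simp
    ultimately have "emeasure ?H K > 0" by (rule less_le_trans[rotated])
    then show ?thesis
      using fin[OF in_components_subset, of K] K by (auto simp: measure_def enn2real_eq_0_iff)
  qed
  then have "?CC \<subseteq> {K \<in> ?CC. measure ?H K \<noteq> 0}" by auto
  then show ?thesis using cnt by (rule countable_subset)
qed

section \<open>Oscillation on components\<close>

lemma weakly_monotone_enclosed_bounds:
  assumes "weakly_monotone u" "open V" "compact (closure V)" "y \<in> V" "frontier V \<subseteq> K"
  shows "ereal (u y) \<le> (SUP a\<in>K. ereal (u a))" "(INF a\<in>K. ereal (u a)) \<le> ereal (u y)"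
proof -
  have "ereal (u y) \<le> (SUP a\<in>V. ereal (u a))" using assms by (intro SUP_upper) auto
  also have "\<dots> \<le> (SUP a\<in>frontier V. ereal (u a))"
    using assms by (auto simp: weakly_monotone_def)
  also have "\<dots> \<le> (SUP a\<in>K. ereal (u a))" using assms by (intro SUP_subset_mono) auto
  finally show "ereal (u y) \<le> (SUP a\<in>K. ereal (u a))" .
  have "(INF a\<in>K. ereal (u a)) \<le> (INF a\<in>frontier V. ereal (u a))"
    using assms by (intro INF_superset_mono) auto
  also have "\<dots> \<le> (INF a\<in>V. ereal (u a))"
    using assms by (auto simp: weakly_monotone_def)
  also have "\<dots> \<le> ereal (u y)" using assms by (intro INF_lower) auto
  finally show "(INF a\<in>K. ereal (u a)) \<le> ereal (u y)" .
qed

text \<open>An injective path within \<open>K\<close> has \<open>h\<close>-integral below one and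
  therefore lies outside \<open>\<Gamma>\<close>. The upper gradient inequality applies to such a
  path from \<open>a\<close> to \<open>b\<close>.\<close>

lemma continuum_oscillation_le:
  fixes u :: "'a::metric_space \<Rightarrow> real"
  assumes ug: "\<And>a b \<gamma>. (a, b, \<gamma>) \<in> cpaths - \<Gamma> \<Longrightarrow> rectifiable (a, b, \<gamma>) \<Longrightarrow>
      ennreal \<bar>u (\<gamma> a) - u (\<gamma> b)\<bar> \<le> path_integral \<rho> (a, b, \<gamma>)"
    and h: "\<And>c. c \<in> \<Gamma> \<Longrightarrow> 1 \<le> path_integral h c" "(\<integral>\<^sup>+ x\<in>K. h x \<partial>hausdorff_measure 1) < 1"
    and K: "compact K" "connected K" "hausdorff_outer 1 K < top" "a \<in> K" "b \<in> K"
  shows "ennreal \<bar>u a - u b\<bar> \<le> (\<integral>\<^sup>+ x\<in>K. \<rho> x \<partial>hausdorff_measure 1)"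
proof (cases "a = b")
  case False
  obtain f L where f: "f 0 = a" "f (1::real) = b" "\<And>t. f t \<in> K" "inj_on f {0..1}" "(0::real) \<le> L"
    "\<And>s t. s \<in> {0..1} \<Longrightarrow> t \<in> {0..1} \<Longrightarrow> dist (f s) (f t) \<le> L * \<bar>s - t\<bar>"
    using continuum_injective_lipschitz_path[OF K False] by metis
  have fK: "f ` {0..1} \<subseteq> K" using f(3) by blast
  have rect: "(0, 1, f) \<in> cpaths" "rectifiable (0, 1, f)"
    using lipschitz_path_rectifiable[of 0 1 L f] f(5,6) by auto
  have "(0, 1, f) \<notin> \<Gamma>"
    using h(1)[of "(0, 1, f)"] path_integral_injective_le[OF f(4) fK, of h] h(2) by auto
  then have "ennreal \<bar>u (f 0) - u (f 1)\<bar> \<le> path_integral \<rho> (0, 1, f)"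
    using rect by (intro ug) auto
  also have "\<dots> \<le> (\<integral>\<^sup>+ x\<in>K. \<rho> x \<partial>hausdorff_measure 1)"
    by (rule path_integral_injective_le[OF f(4) fK])
  finally show ?thesis using f by simp
qed simp

text \<open>On the points enclosed by one component, values of \<open>u\<close> differ by at most
  the integral of \<open>\<rho>\<close> over that component. The nontrivial components are countable
  and disjoint, so summation yields at most the integral over \<open>S\<close>.\<close>

lemma upper_integral_image_le:
  fixes u :: "'a::metric_space \<Rightarrow> real"
  assumes u: "weakly_monotone u"
    and ug: "\<And>a b \<gamma>. (a, b, \<gamma>) \<in> cpaths - \<Gamma> \<Longrightarrow> rectifiable (a, b, \<gamma>) \<Longrightarrow>
      ennreal \<bar>u (\<gamma> a) - u (\<gamma> b)\<bar> \<le> path_integral \<rho> (a, b, \<gamma>)"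
    and h: "\<And>c. c \<in> \<Gamma> \<Longrightarrow> 1 \<le> path_integral h c" "(\<integral>\<^sup>+ x\<in>S. h x \<partial>hausdorff_measure 1) < 1"
    and S: "compact S" "hausdorff_outer 1 S < top"
    and \<rho>: "\<rho> \<in> borel_measurable borel"
    and A: "\<And>y. y \<in> A \<Longrightarrow> encloses S y"
  shows "upper_integral lebesgue (indicator (u ` A)) \<le> (\<integral>\<^sup>+ x\<in>S. \<rho> x \<partial>hausdorff_measure 1)"
proof (cases "(\<integral>\<^sup>+ x\<in>S. \<rho> x \<partial>hausdorff_measure 1) = top")
  case False
  note [measurable] = \<rho>
  define CC where "CC = {K \<in> components S. \<exists>a\<in>K. \<exists>b\<in>K. a \<noteq> b}"
  have CC: "countable CC"
    unfolding CC_def by (rule countable_nontrivial_components[OF compact_imp_closed[OF S(1)] S(2)])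
  \<comment> \<open>Indices outside the range of the enumeration get the empty set.\<close>
  define D where "D i = (if i \<in> to_nat_on CC ` CC then from_nat_into CC i else {})" for i
  have Dval: "D (to_nat_on CC K) = K" if "K \<in> CC" for K
    using from_nat_into_to_nat_on[OF CC that] that unfolding D_def by simp
  have D: "D i \<in> CC \<or> D i = {}" for i
  proof (cases "i \<in> to_nat_on CC ` CC")
    case True
    then obtain K where "K \<in> CC" "i = to_nat_on CC K" by blast
    then show ?thesis using Dval by simp
  qed (simp add: D_def)
  have cptK: "compact K" if "K \<in> CC" for K
  proof -
    have "K \<in> components S" using that by (simp add: CC_def)
    then have "closed K" "K \<subseteq> S"
      using closed_components[OF compact_imp_closed[OF S(1)]] in_components_subset by auto
    then show ?thesis using closed_Int_compact[OF _ S(1), of K] by (simp add: Int_absorb2)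
  qed
  have [measurable]: "D i \<in> sets borel" for i
    using D[of i] cptK[of "D i"] borel_closed[OF compact_imp_closed, of "D i"] by auto
  have [measurable]: "S \<in> sets borel" using borel_closed[OF compact_imp_closed[OF S(1)]] .
  have DS: "D i \<subseteq> S" for i using D[of i] in_components_subset by (auto simp: CC_def)
  have disj: "disjoint_family D"
  proof (unfold disjoint_family_on_def, intro ballI impI)
    fix i j :: nat assume ij: "i \<noteq> j"
    show "D i \<inter> D j = {}"
    proof (cases "i \<in> to_nat_on CC ` CC \<and> j \<in> to_nat_on CC ` CC")
      case True
      then obtain K K' where K: "K \<in> CC" "K' \<in> CC" "i = to_nat_on CC K" "j = to_nat_on CC K'" by blast
      then have "D i = K" "D j = K'" using Dval by simp_all
      moreover have "K \<noteq> K'" using K ij by auto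
      ultimately show ?thesis using K components_eq[of K S K'] by (auto simp: CC_def)
    qed (auto simp: D_def)
  qed
  define enc where "enc K y \<longleftrightarrow> (\<exists>V. open V \<and> compact (closure V) \<and> y \<in> V \<and> frontier V \<subseteq> K)"
    for K :: "'a set" and y
  have one: "upper_integral lebesgue (indicator (u ` {y. enc K y})) \<le> (\<integral>\<^sup>+ x\<in>K. \<rho> x \<partial>hausdorff_measure 1)"
    if K: "K \<in> CC" for K
  proof -
    have KS: "K \<subseteq> S" and Kc: "connected K"
      using K in_components_subset in_components_connected by (auto simp: CC_def)
    have mono: "(\<integral>\<^sup>+ x\<in>K. k x \<partial>hausdorff_measure 1) \<le> (\<integral>\<^sup>+ x\<in>S. k x \<partial>hausdorff_measure 1)" for k
      using KS by (intro nn_integral_mono) (auto split: split_indicator)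
    have finK: "hausdorff_outer 1 K < top" using hausdorff_outer_mono[OF KS] S(2) by (rule le_less_trans)
    obtain m where m: "0 \<le> m" "(\<integral>\<^sup>+ x\<in>K. \<rho> x \<partial>hausdorff_measure 1) = ennreal m"
      using mono[of \<rho>] False by (cases "(\<integral>\<^sup>+ x\<in>K. \<rho> x \<partial>hausdorff_measure 1)") (auto simp: top_unique)
    have osc: "\<bar>u a - u b\<bar> \<le> m" if "a \<in> K" "b \<in> K" for a b
    proof -
      have "ennreal \<bar>u a - u b\<bar> \<le> (\<integral>\<^sup>+ x\<in>K. \<rho> x \<partial>hausdorff_measure 1)"
        by (rule continuum_oscillation_le[where \<Gamma> = \<Gamma> and h = h])
          (use ug h(1) le_less_trans[OF mono h(2)] cptK[OF K] Kc finK that in auto)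
      then show ?thesis using m by simp
    qed
    have le: "u y - u y' \<le> m" if "enc K y" "enc K y'" for y y'
    proof (rule ccontr)
      assume n: "\<not> u y - u y' \<le> m"
      \<comment> \<open>\<open>u\<close> need not attain its extrema on \<open>K\<close>, so two
        points of \<open>K\<close> are chosen with an error \<open>\<eta>\<close> each;
        \<open>2 * \<eta>\<close> is exactly the excess over \<open>m\<close>.\<close>
      define \<eta> where "\<eta> = (u y - u y' - m) / 2"
      have \<eta>: "\<eta> > 0" using n by (simp add: \<eta>_def)
      have "ereal (u y - \<eta>) < ereal (u y)" using \<eta> by simp
      also have "\<dots> \<le> (SUP a\<in>K. ereal (u a))"
        using that(1) weakly_monotone_enclosed_bounds(1)[OF u] unfolding enc_def by blast
      finally obtain a where a: "a \<in> K" "u y - \<eta> < u a" by (auto simp: less_SUP_iff)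
      have "(INF a\<in>K. ereal (u a)) \<le> ereal (u y')"
        using that(2) weakly_monotone_enclosed_bounds(2)[OF u] unfolding enc_def by blast
      also have "\<dots> < ereal (u y' + \<eta>)" using \<eta> by simp
      finally obtain b where b: "b \<in> K" "u b < u y' + \<eta>" by (auto simp: INF_less_iff)
      have "u a - u b > m" using a(2) b(2) unfolding \<eta>_def by (simp add: field_simps)
      then show False using osc[OF a(1) b(1)] by simp
    qed
    have "upper_integral lebesgue (indicator (u ` {y. enc K y})) \<le> ennreal m"
      using m(1) by (rule upper_integral_indicator_le) (use le in \<open>auto simp: abs_le_iff\<close>)
    then show ?thesis using m(2) by simp
  qed
  have cover: "indicator (u ` A) t \<le> (\<Sum>i. indicator (u ` {y. enc (D i) y}) t :: ennreal)" for t
  proof (cases "t \<in> u ` A")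
    case True
    then obtain y where y: "y \<in> A" "t = u y" by blast
    then obtain K where K: "K \<in> CC" "enc K y" using A[OF y(1)] unfolding CC_def enc_def encloses_def by blast
    have "D (to_nat_on CC K) = K" using K(1) by (rule Dval)
    then have "indicator (u ` A) t \<le> (\<Sum>i\<in>{to_nat_on CC K}. indicator (u ` {y. enc (D i) y}) t :: ennreal)"
      using K y True by auto
    also have "\<dots> \<le> (\<Sum>i. indicator (u ` {y. enc (D i) y}) t)" by (rule sum_le_suminf) auto
    finally show ?thesis .
  qed simp
  \<comment> \<open>The supremum over an empty frontier is \<open>-\<infinity>\<close>, which weak
    monotonicity forbids for a nonempty \<open>V\<close>. Hence the empty values of \<open>D\<close>
    enclose no point.\<close>
  have nonenc: "\<not> enc {} y" for y
  proof
    assume "enc {} y"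
    then obtain V where "open V" "compact (closure V)" "y \<in> V" "frontier V \<subseteq> {}" unfolding enc_def by blast
    from weakly_monotone_enclosed_bounds(1)[OF u this] show False by (simp add: bot_ereal_def)
  qed
  have "upper_integral lebesgue (indicator (u ` A))
      \<le> upper_integral lebesgue (\<lambda>t. \<Sum>i. indicator (u ` {y. enc (D i) y}) t)"
    by (rule upper_integral_mono[OF cover])
  also have "\<dots> \<le> (\<Sum>i. upper_integral lebesgue (indicator (u ` {y. enc (D i) y})))"
    by (rule upper_integral_suminf)
  also have "\<dots> \<le> (\<Sum>i. (\<integral>\<^sup>+ x\<in>D i. \<rho> x \<partial>hausdorff_measure 1))"
  proof (intro suminf_le summableI)
    fix i
    show "upper_integral lebesgue (indicator (u ` {y. enc (D i) y})) \<le> (\<integral>\<^sup>+ x\<in>D i. \<rho> x \<partial>hausdorff_measure 1)"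
    proof (cases "D i \<in> CC")
      case False
      then have "D i = {}" using D[of i] by blast
      then have "u ` {y. enc (D i) y} = {}" using nonenc by auto
      then show ?thesis using upper_integral_indicator_le[of 0 "{}"] by simp
    qed (rule one)
  qed
  also have "\<dots> = (\<integral>\<^sup>+ x\<in>(\<Union>i. D i). \<rho> x \<partial>hausdorff_measure 1)"
    by (rule nn_integral_disjoint_family[symmetric]) (auto simp: disj)
  also have "\<dots> \<le> (\<integral>\<^sup>+ x\<in>S. \<rho> x \<partial>hausdorff_measure 1)"
    using DS by (intro nn_integral_mono) (auto split: split_indicator)
  finally show ?thesis .
qed simp

section \<open>Functions of small integral from vanishing modulus\<close>

text \<open>Where a finite \<open>x\<close> exceeds \<open>\<epsilon>\<close>, it is at most
  \<open>\<epsilon> powr (1 - p)\<close> times its \<open>p\<close>-th power, as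
  \<open>1 - p\<close> is nonpositive. This turns small \<open>p\<close>-integrals into small
  integrals over sets of finite measure, in place of Hoelder's inequality.\<close>

lemma ennreal_le_powr:
  assumes "p \<ge> 1" "\<epsilon> > 0"
  shows "x \<le> ennreal \<epsilon> + ennreal (\<epsilon> powr (1 - p)) * ennreal_powr x p"
proof (cases x)
  case (real v)
  show ?thesis
  proof (cases "v \<le> \<epsilon>")
    case True
    then have "x \<le> ennreal \<epsilon>" using real by (simp add: ennreal_leI)
    then show ?thesis by (simp add: add_increasing2)
  next
    case False
    then have v: "v > \<epsilon>" "v > 0" using assms by auto
    have "v = v powr (1 - p) * v powr p" using v by (simp flip: powr_add)
    also have "\<dots> \<le> \<epsilon> powr (1 - p) * v powr p"
      using v assms by (intro mult_right_mono powr_mono2') auto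
    finally have "ennreal v \<le> ennreal (\<epsilon> powr (1 - p)) * ennreal (v powr p)"
      by (simp add: ennreal_leI flip: ennreal_mult)
    then show ?thesis using real by (simp add: ennreal_powr_def add_increasing)
  qed
next
  case top
  then show ?thesis using assms by (simp add: ennreal_powr_def ennreal_mult_top)
qed

lemma ennreal_powr_measurable [measurable]:
  assumes [measurable]: "h \<in> borel_measurable M"
  shows "(\<lambda>x. ennreal_powr (h x) p) \<in> borel_measurable M"
  unfolding ennreal_powr_def by measurable

lemma modulus_zero_obtain:
  fixes Q :: "'a::metric_space set"
  assumes "modulus p \<Gamma> = 0" "p \<ge> 1" "Q \<in> sets borel" "emeasure (hausdorff_measure 2) Q < \<infinity>" "\<eta> > 0"
  obtains h where "h \<in> borel_measurable borel" "\<And>c. c \<in> \<Gamma> \<Longrightarrow> 1 \<le> path_integral h c"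
    "(\<integral>\<^sup>+ x\<in>Q. h x \<partial>hausdorff_measure 2) \<le> ennreal \<eta>"
proof -
  obtain q where q: "q \<ge> 0" "emeasure (hausdorff_measure 2) Q = ennreal q"
    using assms(4) by (cases "emeasure (hausdorff_measure 2) Q") auto
  \<comment> \<open>The constant part contributes \<open>\<epsilon> * q \<le> \<eta> / 2\<close>,
    the power part at most the other half; \<open>q + 1\<close> keeps the denominator
    positive.\<close>
  define \<epsilon> where "\<epsilon> = \<eta> / (2 * (q + 1))"
  have \<epsilon>: "\<epsilon> > 0" using q assms by (simp add: \<epsilon>_def)
  have "\<epsilon> * q \<le> \<epsilon> * (q + 1)" using \<epsilon> by simp
  also have "\<dots> = \<eta> / 2" using q by (simp add: \<epsilon>_def field_simps)
  finally have \<epsilon>q: "\<epsilon> * q \<le> \<eta> / 2" .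
  define B where "B = \<epsilon> powr (1 - p)"
  have B: "B > 0" using \<epsilon> by (simp add: B_def)
  have "modulus p \<Gamma> < ennreal (\<eta> / 2 / B)" using assms B by simp
  then obtain h where h: "h \<in> borel_measurable borel" "\<forall>c\<in>\<Gamma>. path_integral h c \<ge> 1"
    "(\<integral>\<^sup>+ x. ennreal_powr (h x) p \<partial>hausdorff_measure 2) < ennreal (\<eta> / 2 / B)"
    unfolding modulus_def INF_less_iff by auto
  note [measurable] = h(1) assms(3)
  have "(\<integral>\<^sup>+ x\<in>Q. h x \<partial>hausdorff_measure 2) \<le>
    (\<integral>\<^sup>+ x. ennreal \<epsilon> * indicator Q x + ennreal B * ennreal_powr (h x) p \<partial>hausdorff_measure 2)"
    using ennreal_le_powr[OF assms(2) \<epsilon>] unfolding B_def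
    by (intro nn_integral_mono) (auto split: split_indicator)
  also have "\<dots> = ennreal \<epsilon> * emeasure (hausdorff_measure 2) Q +
      ennreal B * (\<integral>\<^sup>+ x. ennreal_powr (h x) p \<partial>hausdorff_measure 2)"
    by (subst nn_integral_add) (auto simp: nn_integral_cmult nn_integral_cmult_indicator)
  also have "\<dots> \<le> ennreal (\<eta> / 2) + ennreal B * ennreal (\<eta> / 2 / B)"
    using h(3) q \<epsilon>q \<epsilon> by (intro add_mono mult_left_mono) (auto simp: ennreal_leI simp flip: ennreal_mult)
  also have "\<dots> = ennreal \<eta>"
    using B assms(5) by (simp flip: ennreal_mult ennreal_plus)
  finally show thesis using that[OF h(1)] h(2) by blast
qed

section \<open>Images of balls\<close>

text \<open>For radii \<open>s\<close> between \<open>r\<close> and \<open>2 * r\<close> that are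
  not exceptional, the outer measure of the image of \<open>ball x r\<close> is at most the integral
  of \<open>\<rho>\<close> over the sphere of radius \<open>s\<close>. Integrating over
  \<open>s\<close> produces the factor \<open>r\<close>, and Eilenberg's inequality turns the
  iterated integral into one over the larger ball.\<close>

lemma image_ball_estimate:
  fixes u :: "'a::{metric_space, second_countable_topology} \<Rightarrow> real"
  assumes surf: "metric_surface TYPE('a)" and p: "p \<ge> 1" and u: "weakly_monotone u"
    and wug: "weak_upper_gradient p u \<rho>"
  shows "\<exists>c>0. compact (cball x c) \<and> (\<forall>r. 0 < r \<longrightarrow> 2 * r \<le> c \<longrightarrow>
    ennreal r * upper_integral lebesgue (indicator (u ` ball x r))
      \<le> ennreal (4 / pi) * (\<integral>\<^sup>+ y\<in>ball x (2 * r). \<rho> y \<partial>hausdorff_measure 2))"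
proof -
  have "\<exists>U (W :: (real^2) set). open U \<and> x \<in> U \<and> open W \<and> U homeomorphic W"
    using surf by (simp add: metric_surface_def)
  then obtain U and W :: "(real^2) set" where "open U" "x \<in> U" "open W" "U homeomorphic W"
    by (elim exE conjE)
  from sphere_component_encloses[OF this] obtain c where c: "c > 0" "compact (cball x c)"
    and enc: "\<And>s y. 0 < s \<Longrightarrow> s < c \<Longrightarrow> y \<in> ball x s \<Longrightarrow> encloses (sphere x s) y"
    by blast
  obtain \<Gamma> where mod: "modulus p \<Gamma> = 0" and ug: "\<And>a b \<gamma>. (a, b, \<gamma>) \<in> cpaths - \<Gamma> \<Longrightarrow> rectifiable (a, b, \<gamma>) \<Longrightarrow>
      ennreal \<bar>u (\<gamma> a) - u (\<gamma> b)\<bar> \<le> path_integral \<rho> (a, b, \<gamma>)"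
    and \<rho>: "\<rho> \<in> borel_measurable borel"
    using wug unfolding weak_upper_gradient_def by blast
  note [measurable] = \<rho>
  \<comment> \<open>\<open>T\<close> is a finite number below the outer measure of the image, which
    may a priori be infinite; the error terms are chosen in terms of \<open>T\<close>.\<close>
  have main: "ennreal r * ennreal T \<le> ennreal (4 / pi) * (\<integral>\<^sup>+ y\<in>ball x (2 * r). \<rho> y \<partial>hausdorff_measure 2)"
    if r: "0 < r" "2 * r \<le> c" and T: "0 \<le> T" "ennreal T \<le> upper_integral lebesgue (indicator (u ` ball x r))" for r T
  proof (rule ennreal_le_epsilon)
    fix e :: real assume e: "0 < e"
    let ?B = "ball x (2 * r)"
    have [measurable]: "?B \<in> sets borel" by simp
    have "emeasure (hausdorff_measure 2) ?B \<le> emeasure (hausdorff_measure 2) (cball x c)"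
      using r by (intro emeasure_mono) auto
    also have "\<dots> < \<infinity>" using surf c(2) by (simp add: metric_surface_def)
    finally have finB: "emeasure (hausdorff_measure 2) ?B < \<infinity>" .
    then obtain q where q: "q \<ge> 0" "emeasure (hausdorff_measure 2) ?B = ennreal q"
      by (cases "emeasure (hausdorff_measure 2) ?B") auto
    \<comment> \<open>Each of two error terms is at most \<open>e'\<close>, and
      \<open>4 / pi * (e' + e') = e\<close>.\<close>
    define e' where "e' = e * pi / 8"
    have e': "e' > 0" using e by (simp add: e'_def)
    define \<eta> where "\<eta> = e' / (T + 1)"
    define \<delta> where "\<delta> = e' / (q + 1)"
    have \<eta>: "\<eta> > 0" "T * \<eta> \<le> e'" using e' T(1) by (auto simp: \<eta>_def field_simps)
    have \<delta>: "\<delta> > 0" "\<delta> * q \<le> e'" using e' q by (auto simp: \<delta>_def field_simps)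
    obtain h where h: "h \<in> borel_measurable borel" "\<And>c. c \<in> \<Gamma> \<Longrightarrow> 1 \<le> path_integral h c"
      "(\<integral>\<^sup>+ x\<in>?B. h x \<partial>hausdorff_measure 2) \<le> ennreal \<eta>"
      using modulus_zero_obtain[OF mod p _ finB \<eta>(1)] by auto
    note [measurable] = h(1)
    \<comment> \<open>The last two terms make the bound \<open>T\<close> hold also for the exceptional spheres, on which
      \<open>h\<close> has integral at least \<open>1\<close> or whose \<open>H\<^sup>1\<close> measure is infinite.\<close>
    define g where "g y = (\<rho> y + (ennreal T * h y + ennreal \<delta>)) * indicator ?B y" for y
    have [measurable]: "g \<in> borel_measurable borel" unfolding g_def by measurable
    have "(\<integral>\<^sup>+ y. g y \<partial>hausdorff_measure 2) = (\<integral>\<^sup>+ y\<in>?B. \<rho> y \<partial>hausdorff_measure 2) +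
      (ennreal T * (\<integral>\<^sup>+ y\<in>?B. h y \<partial>hausdorff_measure 2) + ennreal \<delta> * emeasure (hausdorff_measure 2) ?B)"
      unfolding g_def by (simp add: distrib_right nn_integral_add nn_integral_cmult nn_integral_cmult_indicator mult.assoc)
    also have "\<dots> \<le> (\<integral>\<^sup>+ y\<in>?B. \<rho> y \<partial>hausdorff_measure 2) + (ennreal e' + ennreal e')"
    proof (intro add_mono order_refl)
      have "ennreal T * (\<integral>\<^sup>+ y\<in>?B. h y \<partial>hausdorff_measure 2) \<le> ennreal T * ennreal \<eta>"
        using h(3) by (intro mult_left_mono) auto
      also have "\<dots> \<le> ennreal e'" using \<eta> T(1) by (simp add: ennreal_leI flip: ennreal_mult)
      finally show "ennreal T * (\<integral>\<^sup>+ y\<in>?B. h y \<partial>hausdorff_measure 2) \<le> ennreal e'" .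
      show "ennreal \<delta> * emeasure (hausdorff_measure 2) ?B \<le> ennreal e'"
        unfolding q(2) using \<delta> q(1) by (simp add: ennreal_leI flip: ennreal_mult)
    qed
    finally have int_g: "(\<integral>\<^sup>+ y. g y \<partial>hausdorff_measure 2) \<le> (\<integral>\<^sup>+ y\<in>?B. \<rho> y \<partial>hausdorff_measure 2) + (ennreal e' + ennreal e')" .
    have "ennreal T * ennreal (2 * r - r) \<le>
      upper_integral lebesgue (\<lambda>s. \<integral>\<^sup>+ y\<in>{y. dist x y = s}. g y \<partial>hausdorff_measure 1)"
    proof (rule upper_integral_ge_interval)
      fix s assume s: "s \<in> {r<..<2 * r}"
      have S: "{y. dist x y = s} = sphere x s" by auto
      have [measurable]: "sphere x s \<in> sets borel" using closed_sphere_metric by (rule borel_closed)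
      have gS: "(\<integral>\<^sup>+ y\<in>sphere x s. g y \<partial>hausdorff_measure 1) =
         (\<integral>\<^sup>+ y\<in>sphere x s. (\<rho> y + (ennreal T * h y + ennreal \<delta>)) \<partial>hausdorff_measure 1)"
        using s by (intro nn_integral_cong) (auto simp: g_def split: split_indicator)
      have ge: "(\<integral>\<^sup>+ y\<in>sphere x s. k y \<partial>hausdorff_measure 1) \<le> (\<integral>\<^sup>+ y\<in>sphere x s. g y \<partial>hausdorff_measure 1)"
        if "\<And>y. k y \<le> \<rho> y + (ennreal T * h y + ennreal \<delta>)" for k
        unfolding gS using that by (intro nn_integral_mono mult_right_mono) auto
      have "compact (sphere x s)"
      proof -
        have "sphere x s \<subseteq> cball x c" using s r by auto
        then show ?thesis using closed_Int_compact[OF closed_sphere_metric c(2), of x s] by (simp add: Int_absorb2)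
      qed
      note cS = this
      consider "hausdorff_outer 1 (sphere x s) = top" | "1 \<le> (\<integral>\<^sup>+ y\<in>sphere x s. h y \<partial>hausdorff_measure 1)"
        | "hausdorff_outer 1 (sphere x s) < top" "(\<integral>\<^sup>+ y\<in>sphere x s. h y \<partial>hausdorff_measure 1) < 1"
        using less_top not_le by blast
      then have "ennreal T \<le> (\<integral>\<^sup>+ y\<in>sphere x s. g y \<partial>hausdorff_measure 1)"
      proof cases
        case 1
        then have "(\<integral>\<^sup>+ y\<in>sphere x s. ennreal \<delta> \<partial>hausdorff_measure 1) = top"
          using \<delta>(1) by (simp add: nn_integral_cmult_indicator emeasure_hausdorff_measure ennreal_mult_top)
        moreover have "(\<integral>\<^sup>+ y\<in>sphere x s. ennreal \<delta> \<partial>hausdorff_measure 1) \<le> (\<integral>\<^sup>+ y\<in>sphere x s. g y \<partial>hausdorff_measure 1)"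
          by (intro ge) (simp add: add_increasing)
        ultimately show ?thesis by (simp add: top_unique)
      next
        case 2
        then have "ennreal T * 1 \<le> ennreal T * (\<integral>\<^sup>+ y\<in>sphere x s. h y \<partial>hausdorff_measure 1)"
          by (intro mult_left_mono) auto
        also have "\<dots> = (\<integral>\<^sup>+ y\<in>sphere x s. (ennreal T * h y) \<partial>hausdorff_measure 1)"
          by (subst nn_integral_cmult[symmetric]) (auto simp: mult.assoc)
        also have "\<dots> \<le> (\<integral>\<^sup>+ y\<in>sphere x s. g y \<partial>hausdorff_measure 1)"
          by (intro ge) (simp add: add_increasing add_increasing2)
        finally show ?thesis by simp
      next
        case 3
        have "ennreal T \<le> upper_integral lebesgue (indicator (u ` ball x r))" by (rule T(2))
        also have "\<dots> \<le> upper_integral lebesgue (indicator (u ` ball x s))"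
          using s by (intro upper_integral_mono) (auto split: split_indicator)
        also have "\<dots> \<le> (\<integral>\<^sup>+ y\<in>sphere x s. \<rho> y \<partial>hausdorff_measure 1)"
        proof (rule upper_integral_image_le[where \<Gamma> = \<Gamma> and h = h, OF u ug h(2) 3(2) cS 3(1) \<rho>])
          fix y assume "y \<in> ball x s"
          then show "encloses (sphere x s) y"
            using s r by (intro enc) auto
        qed
        also have "\<dots> \<le> (\<integral>\<^sup>+ y\<in>sphere x s. g y \<partial>hausdorff_measure 1)"
          by (intro ge) (simp add: add_increasing2)
        finally show ?thesis .
      qed
      then show "ennreal T \<le> (\<integral>\<^sup>+ y\<in>{y. dist x y = s}. g y \<partial>hausdorff_measure 1)"
        unfolding S .
    qed (use r in auto)
    also have "\<dots> \<le> ennreal (4 / pi) * (\<integral>\<^sup>+ y. g y \<partial>hausdorff_measure 2)"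
    proof (rule eilenberg)
      show "\<bar>dist x y - dist x z\<bar> \<le> dist y z" for y z
        using abs_dist_diff_le[of y x z] by (simp add: dist_commute)
    qed measurable
    also have "\<dots> \<le> ennreal (4 / pi) * ((\<integral>\<^sup>+ y\<in>?B. \<rho> y \<partial>hausdorff_measure 2) + (ennreal e' + ennreal e'))"
      by (rule mult_left_mono[OF int_g]) simp
    also have "\<dots> = ennreal (4 / pi) * (\<integral>\<^sup>+ y\<in>?B. \<rho> y \<partial>hausdorff_measure 2) + ennreal e"
    proof -
      have "ennreal (4 / pi) * (ennreal e' + ennreal e') = ennreal (4 / pi * (e' + e'))"
        using e' by (simp flip: ennreal_plus ennreal_mult)
      also have "4 / pi * (e' + e') = e" by (simp add: e'_def)
      finally show ?thesis by (simp add: distrib_left)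
    qed
    finally show "ennreal r * ennreal T \<le> ennreal (4 / pi) * (\<integral>\<^sup>+ y\<in>?B. \<rho> y \<partial>hausdorff_measure 2) + ennreal e"
      by (simp add: mult.commute)
  qed
  show ?thesis
  proof (intro exI[of _ c] conjI allI impI c)
    fix r :: real assume r: "0 < r" "2 * r \<le> c"
    let ?T = "upper_integral lebesgue (indicator (u ` ball x r))"
    let ?R = "ennreal (4 / pi) * (\<integral>\<^sup>+ y\<in>ball x (2 * r). \<rho> y \<partial>hausdorff_measure 2)"
    show "ennreal r * ?T \<le> ?R"
    proof (cases ?T)
      case (real T)
      then show ?thesis using main[OF r, of T] by simp
    next
      case top
      show ?thesis
      proof (cases ?R)
        case (real R)
        then have "ennreal r * ennreal ((R + 1) / r) \<le> ennreal R"
          using main[OF r, of "(R + 1) / r"] top r by simp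
        then have "ennreal (R + 1) \<le> ennreal R" using r real by (simp flip: ennreal_mult)
        then show ?thesis using real by simp
      qed simp
    qed
  qed
qed

section \<open>Regularity and covering\<close>

text \<open>Sets squeezed between closed and open sets of small difference form a sigma-algebra.
  Nonempty closed sets belong to it because each is the intersection of its neighbourhoods
  \<open>U n\<close>.\<close>

lemma finite_borel_measure_regular:
  fixes M :: "'a::metric_space measure"
  assumes M: "finite_measure M" "sets M = sets borel" and E: "E \<in> sets borel" and e: "e > 0"
  shows "\<exists>F U. closed F \<and> open U \<and> F \<subseteq> E \<and> E \<subseteq> U \<and> measure M (U - F) < e"
proof -
  interpret finite_measure M by (rule M)
  have cl: "F \<in> sets M" if "closed F" for F using that M(2) by (simp add: borel_closed)
  have op: "F \<in> sets M" if "open F" for F using that M(2) by (simp add: borel_open)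
  have "E \<in> sigma_sets UNIV (Collect closed)"
    using E by (simp add: borel_eq_closed)
  then show ?thesis using e
  proof (induction arbitrary: e rule: sigma_sets.induct)
    case (Basic C)
    then have C: "closed C" by simp
    show ?case
    proof (cases "C = {}")
      case True
      then show ?thesis using Basic by (intro exI[of _ "{}"]) auto
    next
      case False
      define U where "U n = {x. infdist x C < 1 / real (Suc n)}" for n
      have oU: "open (U n)" for n unfolding U_def by (intro open_Collect_less continuous_intros)
      have CU: "C \<subseteq> U n" for n unfolding U_def by (auto simp: infdist_zero)
      have Int: "(\<Inter>n. U n - C) = {}"
      proof (rule ccontr)
        assume "(\<Inter>n. U n - C) \<noteq> {}"
        then obtain x where x: "\<And>n. x \<in> U n" "x \<notin> C" by auto
        then have "infdist x C > 0"
          using C False in_closed_iff_infdist_zero[of C x] infdist_nonneg[of x C] by auto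
        then obtain n where "1 / real (Suc n) < infdist x C"
          using nat_approx_posE by blast
        then show False using x(1)[of n] by (simp add: U_def)
      qed
      have "(\<lambda>n. measure M (U n - C)) \<longlonglongrightarrow> measure M (\<Inter>n. U n - C)"
      proof (rule finite_Lim_measure_decseq)
        show "range (\<lambda>n. U n - C) \<subseteq> sets M" using op[OF oU] cl[OF C] by auto
        have "1 / real (Suc n) \<le> 1 / real (Suc m)" if "m \<le> n" for m n
          using that by (simp add: frac_le)
        then show "decseq (\<lambda>n. U n - C)"
          unfolding decseq_def U_def by (fastforce intro: less_le_trans)
      qed
      then have "(\<lambda>n. measure M (U n - C)) \<longlonglongrightarrow> 0" unfolding Int by simp
      then have "\<forall>\<^sub>F n in sequentially. measure M (U n - C) < e"
        using Basic by (auto dest: order_tendstoD)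
      then obtain n where "measure M (U n - C) < e" by (auto simp: eventually_sequentially)
      then show ?thesis using C oU CU by blast
    qed
  next
    case Empty
    then show ?case by (intro exI[of _ "{}"]) auto
  next
    case (Compl A)
    from Compl.IH[OF Compl.prems] obtain F U
      where FU: "closed F" "open U" "F \<subseteq> A" "A \<subseteq> U" "measure M (U - F) < e"
      by (elim exE conjE)
    have "closed (- U) \<and> open (- F) \<and> - U \<subseteq> UNIV - A \<and> UNIV - A \<subseteq> - F"
      using FU(1-4) by auto
    moreover have "- F - - U = U - F" by auto
    then have "measure M (- F - - U) < e" using FU(5) by (simp only:)
    ultimately show ?case by blast
  next
    case (Union A)
    \<comment> \<open>Half of \<open>e\<close> is spread over the individual approximations; the
      rest leaves room for replacing the union of all \<open>F i\<close> by a finite, hence closed,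
      union.\<close>
    have "\<exists>F U. closed F \<and> open U \<and> F \<subseteq> A i \<and> A i \<subseteq> U \<and> measure M (U - F) < e / 2 * (1/2) ^ Suc i" for i
      using Union.prems by (intro Union.IH) simp
    then obtain F U where FU: "\<And>i. closed (F i)" "\<And>i. open (U i)" "\<And>i. F i \<subseteq> A i" "\<And>i. A i \<subseteq> U i"
      "\<And>i. measure M (U i - F i) < e / 2 * (1/2) ^ Suc i" by metis
    have sets: "U i - F i \<in> sets M" for i using op[OF FU(2)] cl[OF FU(1)] by auto
    have sm: "summable (\<lambda>i. e / 2 * (1/2) ^ Suc i :: real)"
      using power_half_series by (intro summable_mult) (rule sums_summable)
    have sm': "summable (\<lambda>i. measure M (U i - F i))"
      by (rule summable_comparison_test'[OF sm, of 0]) (use FU(5) in \<open>auto intro: less_imp_le\<close>)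
    have "measure M (\<Union>i. U i - F i) \<le> (\<Sum>i. measure M (U i - F i))"
      using sets sm' by (intro finite_measure_subadditive_countably) auto
    also have "\<dots> \<le> (\<Sum>i. e / 2 * (1/2) ^ Suc i)"
      using FU(5) sm sm' by (intro suminf_le less_imp_le)
    also have "\<dots> = e / 2"
      using sums_unique[OF sums_mult[OF power_half_series, of "e / 2"]] by simp
    finally have half: "measure M (\<Union>i. U i - F i) \<le> e / 2" .
    define G where "G n = (\<Union>i\<in>{..n}. F i)" for n
    have G: "closed (G n)" for n unfolding G_def using FU(1) by (intro closed_UN) auto
    define V where "V = (\<Union>i. U i)"
    have V: "open V" unfolding V_def using FU(2) by auto
    have lim: "(\<lambda>n. measure M (V - G n)) \<longlonglongrightarrow> measure M (\<Inter>n. V - G n)"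
    proof (rule finite_Lim_measure_decseq)
      show "range (\<lambda>n. V - G n) \<subseteq> sets M" using op[OF V] cl[OF G] by auto
      show "decseq (\<lambda>n. V - G n)" unfolding decseq_def G_def by force
    qed
    have "measure M (\<Inter>n. V - G n) \<le> measure M (\<Union>i. U i - F i)"
    proof (rule finite_measure_mono)
      show "(\<Inter>n. V - G n) \<subseteq> (\<Union>i. U i - F i)" by (auto simp: V_def G_def)
    qed (use sets in auto)
    then have "measure M (\<Inter>n. V - G n) < e" using half Union.prems by simp
    then have "\<forall>\<^sub>F n in sequentially. measure M (V - G n) < e"
      by (rule order_tendstoD(2)[OF lim])
    then obtain n where n: "measure M (V - G n) < e" by (auto simp: eventually_sequentially)
    have "G n \<subseteq> (\<Union>i. A i)" "(\<Union>i. A i) \<subseteq> V" using FU(3,4) unfolding G_def V_def by blast+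
    then show ?case using n G V by (intro exI[of _ "G n"] exI[of _ V] conjI)
  qed
qed

lemma finite_borel_measure_outer_regular:
  fixes M :: "'a::metric_space measure"
  assumes M: "finite_measure M" "sets M = sets borel" and E: "E \<in> sets borel" and e: "e > 0"
  obtains U where "open U" "E \<subseteq> U" "emeasure M U \<le> emeasure M E + ennreal e"
proof -
  interpret finite_measure M by (rule M)
  obtain F U where FU: "closed F" "open U" "F \<subseteq> E" "E \<subseteq> U" "measure M (U - F) < e"
    using finite_borel_measure_regular[OF M E e] by blast
  have s: "E \<in> sets M" "U \<in> sets M" "F \<in> sets M" using FU E M(2) by (auto simp: borel_open borel_closed)
  have "emeasure M U \<le> emeasure M (E \<union> (U - F))"
    using s FU by (intro emeasure_mono) auto
  also have "\<dots> \<le> emeasure M E + emeasure M (U - F)" using s by (intro emeasure_subadditive) auto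
  also have "emeasure M (U - F) \<le> ennreal e" using FU(5) by (simp add: emeasure_eq_measure ennreal_leI)
  finally show thesis using that FU by (simp add: add_left_mono)
qed

section \<open>Vitali covering\<close>

text \<open>Every ball meets a selected one with \<open>r x \<le> 3 / 2 * r y\<close>, so the
  centres are at distance less than \<open>5 / 2 * r y\<close>, which is below
  \<open>4 * r y\<close>. Covering the centres instead of whole balls keeps the factor at
  \<open>4\<close>.\<close>

lemma vitali_covering_balls:
  fixes r :: "'a::metric_space \<Rightarrow> real"
  assumes r: "\<And>x. x \<in> I \<Longrightarrow> 0 < r x \<and> r x \<le> R"
  obtains D where "D \<subseteq> I" "\<And>x y. x \<in> D \<Longrightarrow> y \<in> D \<Longrightarrow> x \<noteq> y \<Longrightarrow> ball x (r x) \<inter> ball y (r y) = {}"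
    "\<And>x. x \<in> I \<Longrightarrow> \<exists>y\<in>D. x \<in> ball y (4 * r y)"
proof -
  define meets where "meets x y \<longleftrightarrow> ball x (r x) \<inter> ball y (r y) \<noteq> {}" for x y
  \<comment> \<open>The last condition, that a ball meeting \<open>D\<close> meets a large enough
    member of \<open>D\<close>, survives unions of chains and replaces a choice of the largest balls
    first.\<close>
  define \<Omega> where "\<Omega> = {D. D \<subseteq> I \<and> (\<forall>x\<in>D. \<forall>y\<in>D. x \<noteq> y \<longrightarrow> \<not> meets x y) \<and>
    (\<forall>x\<in>I. (\<exists>y\<in>D. meets x y) \<longrightarrow> (\<exists>y\<in>D. meets x y \<and> r x \<le> 3 / 2 * r y))}"
  have "\<exists>M\<in>\<Omega>. \<forall>X\<in>\<Omega>. M \<subseteq> X \<longrightarrow> X = M"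
  proof (rule subset_Zorn')
    fix C assume C: "subset.chain \<Omega> C"
    then have C\<Omega>: "\<And>D. D \<in> C \<Longrightarrow> D \<in> \<Omega>" and Cc: "\<And>D D'. D \<in> C \<Longrightarrow> D' \<in> C \<Longrightarrow> D \<subseteq> D' \<or> D' \<subseteq> D"
      by (auto simp: subset_chain_def)
    show "\<Union>C \<in> \<Omega>"
      unfolding \<Omega>_def
    proof (intro CollectI conjI ballI impI)
      show "\<Union>C \<subseteq> I" using C\<Omega> unfolding \<Omega>_def by blast
      fix x y assume xy: "x \<in> \<Union>C" "y \<in> \<Union>C" "x \<noteq> y"
      then obtain D D' where D: "D \<in> C" "D' \<in> C" "x \<in> D" "y \<in> D'" by blast
      then obtain D'' where "D'' \<in> C" "x \<in> D''" "y \<in> D''" using Cc[OF D(1,2)] by blast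
      then show "\<not> meets x y" using C\<Omega>[of D''] xy(3) unfolding \<Omega>_def by blast
    next
      fix x assume x: "x \<in> I" "\<exists>y\<in>\<Union>C. meets x y"
      then obtain D where D: "D \<in> C" "\<exists>y\<in>D. meets x y" by blast
      then have "\<exists>y\<in>D. meets x y \<and> r x \<le> 3 / 2 * r y" using C\<Omega>[OF D(1)] x(1) unfolding \<Omega>_def by blast
      then show "\<exists>y\<in>\<Union>C. meets x y \<and> r x \<le> 3 / 2 * r y" using D(1) by blast
    qed
  qed
  then obtain M where M: "M \<in> \<Omega>" and max: "\<And>X. X \<in> \<Omega> \<Longrightarrow> M \<subseteq> X \<Longrightarrow> X = M" by blast
  have MI: "M \<subseteq> I" and Mdisj: "\<And>x y. x \<in> M \<Longrightarrow> y \<in> M \<Longrightarrow> x \<noteq> y \<Longrightarrow> \<not> meets x y"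
    and Mdom: "\<And>x. x \<in> I \<Longrightarrow> \<exists>y\<in>M. meets x y \<Longrightarrow> \<exists>y\<in>M. meets x y \<and> r x \<le> 3 / 2 * r y"
    using M unfolding \<Omega>_def by blast+
  have sym: "meets x y = meets y x" for x y unfolding meets_def by blast
  have all: "\<exists>y\<in>M. meets x y" if x: "x \<in> I" for x
  proof (rule ccontr)
    assume n: "\<not> (\<exists>y\<in>M. meets x y)"
    define J where "J = {x \<in> I. \<not> (\<exists>y\<in>M. meets x y)}"
    have J: "x \<in> J" using x n by (simp add: J_def)
    \<comment> \<open>Among the balls that miss \<open>M\<close>, \<open>x0\<close> has nearly the
      largest radius: \<open>r a \<le> s < 3 / 2 * r x0\<close> for each of them. Adding
      \<open>x0\<close> therefore keeps the domination condition and contradicts maximality.\<close>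
    define s where "s = Sup (r ` J)"
    have bdd: "bdd_above (r ` J)" using r by (intro bdd_aboveI2[of _ _ R]) (auto simp: J_def)
    have s: "r y \<le> s" if "y \<in> J" for y unfolding s_def using that by (intro cSup_upper bdd) auto
    have "0 < s" using s[OF J] r[OF x] by simp
    then have "2 / 3 * s < s" by simp
    then obtain x0 where x0: "x0 \<in> J" "2 / 3 * s < r x0"
      using less_cSup_iff[OF _ bdd, of "2 / 3 * s"] J unfolding s_def[symmetric] by blast
    have x0I: "x0 \<in> I" and x0M: "\<And>y. y \<in> M \<Longrightarrow> \<not> meets x0 y" using x0(1) by (auto simp: J_def)
    have self: "meets x0 x0" using r[OF x0I] by (auto simp: meets_def)
    have "insert x0 M \<in> \<Omega>"
      unfolding \<Omega>_def
    proof (intro CollectI conjI ballI impI)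
      show "insert x0 M \<subseteq> I" using MI x0I by simp
      fix a b assume "a \<in> insert x0 M" "b \<in> insert x0 M" "a \<noteq> b"
      then show "\<not> meets a b" using Mdisj x0M sym by auto
    next
      fix a assume a: "a \<in> I" "\<exists>y\<in>insert x0 M. meets a y"
      show "\<exists>y\<in>insert x0 M. meets a y \<and> r a \<le> 3 / 2 * r y"
      proof (cases "\<exists>y\<in>M. meets a y")
        case True
        then show ?thesis using Mdom[OF a(1)] by blast
      next
        case False
        then have "a \<in> J" "meets a x0" using a by (auto simp: J_def)
        then show ?thesis using s[of a] x0(2) by (intro bexI[of _ x0]) auto
      qed
    qed
    then have "insert x0 M = M" using max by blast
    then show False using x0M self by blast
  qed
  show thesis
  proof (rule that[OF MI])
    show "ball x (r x) \<inter> ball y (r y) = {}" if "x \<in> M" "y \<in> M" "x \<noteq> y" for x y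
      using Mdisj[OF that] by (simp add: meets_def)
    fix x assume x: "x \<in> I"
    obtain y where y: "y \<in> M" "meets x y" "r x \<le> 3 / 2 * r y" using Mdom[OF x all[OF x]] by blast
    then obtain z where z: "dist x z < r x" "dist y z < r y" by (auto simp: meets_def)
    have "dist y x \<le> dist y z + dist x z" by (metis dist_commute dist_triangle)
    also have "\<dots> < 4 * r y" using z y(3) r[of y] MI y(1) by force
    finally show "\<exists>y\<in>M. x \<in> ball y (4 * r y)" using y(1) by auto
  qed
qed

section \<open>The coarea inequality\<close>

lemma closure_level_meets_open:
  "open B \<Longrightarrow> closure {x. u x = t} \<inter> B \<noteq> {} \<longleftrightarrow> t \<in> u ` B"
  using open_Int_closure_eq_empty[of B "{x. u x = t}"] by (auto simp: Int_commute)

lemma diameter_ball_le: "0 \<le> r \<Longrightarrow> diameter (ball (x::'a::metric_space) r) \<le> 2 * r"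
proof -
  assume r: "0 \<le> r"
  have "dist y z \<le> 2 * r" if "y \<in> ball x r" "z \<in> ball x r" for y z
    using dist_triangle3[of y z x] that by simp
  then show ?thesis
    using r by (auto simp: diameter_def intro!: cSUP_least)
qed

section \<open>Points with bounded growth at small scales\<close>

text \<open>Vitali selection gives disjoint balls of radius \<open>r\<close> in \<open>U\<close>
  whose fourfold enlargements cover \<open>G\<close>. The factor \<open>200\<close> is
  \<open>100\<close> from the growth condition times \<open>2\<close> from the diameter of a ball of
  radius \<open>4 * r\<close>.\<close>

lemma good_part_estimate:
  fixes u :: "'a::{metric_space, second_countable_topology} \<Rightarrow> real" and M :: "'a measure"
  assumes sets: "sets M = sets borel" and U: "open U"
    and G: "\<And>x \<delta>. x \<in> G \<Longrightarrow> \<delta> > 0 \<Longrightarrow> \<exists>r. 0 < r \<and> r < \<delta> \<and> ball x r \<subseteq> U \<and>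
      emeasure M (ball x (8 * r)) \<le> 100 * emeasure M (ball x r) \<and>
      ennreal (4 * r) * upper_integral lebesgue (indicator (u ` ball x (4 * r)))
        \<le> ennreal (4 / pi) * emeasure M (ball x (8 * r))"
  shows "upper_integral lebesgue (\<lambda>t. hausdorff_outer 1 (G \<inter> closure {x. u x = t}))
    \<le> ennreal (4 / pi * 200) * emeasure M U"
proof (rule upper_integral_hausdorff_slices)
  fix \<delta> :: real assume \<delta>: "\<delta> > 0"
  \<comment> \<open>The enlarged balls have radius \<open>4 * r\<close>, so
    \<open>r < \<delta> / 8\<close> keeps their diameter below \<open>\<delta>\<close>.\<close>
  have "\<exists>r. 0 < r \<and> r < \<delta> / 8 \<and> ball x r \<subseteq> U \<and>
      emeasure M (ball x (8 * r)) \<le> 100 * emeasure M (ball x r) \<and>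
      ennreal (4 * r) * upper_integral lebesgue (indicator (u ` ball x (4 * r)))
        \<le> ennreal (4 / pi) * emeasure M (ball x (8 * r))" if "x \<in> G" for x
    using G[OF that, of "\<delta> / 8"] \<delta> by simp
  then obtain r where r: "\<And>x. x \<in> G \<Longrightarrow> 0 < r x" "\<And>x. x \<in> G \<Longrightarrow> r x < \<delta> / 8"
      "\<And>x. x \<in> G \<Longrightarrow> ball x (r x) \<subseteq> U"
      "\<And>x. x \<in> G \<Longrightarrow> emeasure M (ball x (8 * r x)) \<le> 100 * emeasure M (ball x (r x))"
      "\<And>x. x \<in> G \<Longrightarrow> ennreal (4 * r x) * upper_integral lebesgue (indicator (u ` ball x (4 * r x)))
        \<le> ennreal (4 / pi) * emeasure M (ball x (8 * r x))" by metis
  have "0 < r x \<and> r x \<le> \<delta> / 8" if "x \<in> G" for x using r(1,2)[OF that] by simp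
  from vitali_covering_balls[of G r, OF this] obtain D where D: "D \<subseteq> G"
    "\<And>x y. x \<in> D \<Longrightarrow> y \<in> D \<Longrightarrow> x \<noteq> y \<Longrightarrow> ball x (r x) \<inter> ball y (r y) = {}"
    "\<And>x. x \<in> G \<Longrightarrow> \<exists>y\<in>D. x \<in> ball y (4 * r y)" by blast
  have inj: "inj_on (\<lambda>x. ball x (r x)) D"
  proof (rule inj_onI)
    fix x y assume xy: "x \<in> D" "y \<in> D" "ball x (r x) = ball y (r y)"
    have "x \<in> ball x (r x)" using r(1) D(1) xy(1) by auto
    then show "x = y" using D(2)[OF xy(1,2)] xy(3) by blast
  qed
  have "countable ((\<lambda>x. ball x (r x)) ` D)"
    by (rule countable_disjoint_open_subsets) (use D(2) in \<open>auto simp: disjoint_def\<close>)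
  then have cD: "countable D" using inj countable_image_inj_on by blast
  \<comment> \<open>One enumeration serves for both families: \<open>k = 1\<close> gives the
    disjoint balls, \<open>k = 4\<close> the covering ones. Indices outside its range are sent to
    the empty set.\<close>
  define sel where "sel k i = (if i \<in> to_nat_on D ` D then ball (from_nat_into D i) (k * r (from_nat_into D i)) else {})"
    for k :: real and i
  have sel: "sel k (to_nat_on D x) = ball x (k * r x)" if "x \<in> D" for x k
    using from_nat_into_to_nat_on[OF cD that] that by (simp add: sel_def)
  have cases: "(\<exists>x\<in>D. i = to_nat_on D x) \<or> (\<forall>k. sel k i = {})" for i
    by (auto simp: sel_def)
  have sel_sets: "sel k i \<in> sets M" for k i unfolding sets sel_def by auto
  have disj: "disjoint_family (sel 1)"
    unfolding disjoint_family_on_def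
  proof (intro ballI impI)
    fix i j :: nat assume ij: "i \<noteq> j"
    show "sel 1 i \<inter> sel 1 j = {}"
    proof (cases "(\<exists>x\<in>D. i = to_nat_on D x) \<and> (\<exists>y\<in>D. j = to_nat_on D y)")
      case True
      then obtain x y where xy: "x \<in> D" "y \<in> D" "i = to_nat_on D x" "j = to_nat_on D y" by blast
      then have "x \<noteq> y" using ij by blast
      then show ?thesis using D(2)[OF xy(1,2)] xy sel[of _ 1] by simp
    next
      case False
      then show ?thesis using cases[of i] cases[of j] by auto
    qed
  qed
  have le: "ennreal (diameter (sel 4 i)) * upper_integral lebesgue (indicator {t. closure {x. u x = t} \<inter> sel 4 i \<noteq> {}})
      \<le> ennreal (4 / pi * 200) * emeasure M (sel 1 i)" for i
  proof (cases "\<exists>x\<in>D. i = to_nat_on D x")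
    case True
    then obtain x where x: "x \<in> D" "i = to_nat_on D x" by blast
    then have xG: "x \<in> G" using D(1) by blast
    have s: "sel 4 i = ball x (4 * r x)" "sel 1 i = ball x (r x)" using x sel[of x 4] sel[of x 1] by simp_all
    have set: "{t. closure {x. u x = t} \<inter> ball x (4 * r x) \<noteq> {}} = u ` ball x (4 * r x)"
      using closure_level_meets_open[of "ball x (4 * r x)" u] by blast
    let ?T = "upper_integral lebesgue (indicator (u ` ball x (4 * r x)))"
    have "ennreal (diameter (ball x (4 * r x))) * ?T \<le> ennreal (2 * (4 * r x)) * ?T"
      using diameter_ball_le[of "4 * r x" x] r(1)[OF xG] by (intro mult_right_mono ennreal_leI) auto
    also have "\<dots> = 2 * (ennreal (4 * r x) * ?T)"
      using r(1)[OF xG] by (subst ennreal_mult) (auto simp: mult.assoc)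
    also have "\<dots> \<le> 2 * (ennreal (4 / pi) * (100 * emeasure M (ball x (r x))))"
      using order_trans[OF r(5)[OF xG] mult_left_mono[OF r(4)[OF xG]]] by (intro mult_left_mono) auto
    also have "\<dots> = ennreal (4 / pi * 200) * emeasure M (ball x (r x))"
    proof -
      have "ennreal (4 / pi * 200) = 2 * (ennreal (4 / pi) * 100)"
        by (simp add: ennreal_mult flip: ennreal_numeral ennreal_mult'')
      then show ?thesis by (simp only: mult.assoc)
    qed
    finally show ?thesis unfolding s set .
  next
    case False
    then have "sel 4 i = {}" using cases by blast
    then show ?thesis by simp
  qed
  show "\<exists>A::nat \<Rightarrow> 'a set. G \<subseteq> (\<Union>i. A i) \<and> (\<forall>i. bounded (A i) \<and> diameter (A i) \<le> \<delta>) \<and>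
    (\<Sum>i. ennreal (diameter (A i)) * upper_integral lebesgue (indicator {t. closure {x. u x = t} \<inter> A i \<noteq> {}}))
      \<le> ennreal (4 / pi * 200) * emeasure M U"
  proof (intro exI[of _ "sel 4"] conjI allI)
    show "G \<subseteq> (\<Union>i. sel 4 i)"
    proof
      fix x assume "x \<in> G"
      then obtain y where "y \<in> D" "x \<in> ball y (4 * r y)" using D(3) by blast
      then have "x \<in> sel 4 (to_nat_on D y)" using sel by simp
      then show "x \<in> (\<Union>i. sel 4 i)" by blast
    qed
    show "bounded (sel 4 i)" for i by (simp add: sel_def)
    show "diameter (sel 4 i) \<le> \<delta>" for i
    proof (cases "\<exists>x\<in>D. i = to_nat_on D x")
      case True
      then obtain x where x: "x \<in> D" "i = to_nat_on D x" by blast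
      then have xG: "x \<in> G" using D(1) by blast
      show ?thesis using x sel[of x 4] diameter_ball_le[of "4 * r x" x] r(1,2)[OF xG] by simp
    next
      case False
      then have "sel 4 i = {}" using cases by blast
      then show ?thesis using \<delta> by simp
    qed
    have "(\<Sum>i. ennreal (diameter (sel 4 i)) * upper_integral lebesgue (indicator {t. closure {x. u x = t} \<inter> sel 4 i \<noteq> {}}))
      \<le> (\<Sum>i. ennreal (4 / pi * 200) * emeasure M (sel 1 i))"
      using le by (intro suminf_le summableI)
    also have "\<dots> = ennreal (4 / pi * 200) * emeasure M (\<Union>i. sel 1 i)"
      using sel_sets disj by (subst suminf_emeasure[symmetric]) auto
    also have "\<dots> \<le> ennreal (4 / pi * 200) * emeasure M U"
    proof (intro mult_left_mono emeasure_mono)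
      have "sel 1 i \<subseteq> U" for i
      proof (cases "\<exists>x\<in>D. i = to_nat_on D x")
        case True
        then obtain x where x: "x \<in> D" "i = to_nat_on D x" by blast
        then show ?thesis using sel[of x 1] r(3)[of x] D(1) by auto
      next
        case False
        then show ?thesis using cases[of i] by auto
      qed
      then show "(\<Union>i. sel 1 i) \<subseteq> U" by blast
      show "U \<in> sets M" using U sets by (simp add: borel_open)
    qed simp
    finally show "(\<Sum>i. ennreal (diameter (sel 4 i)) * upper_integral lebesgue (indicator {t. closure {x. u x = t} \<inter> sel 4 i \<noteq> {}}))
      \<le> ennreal (4 / pi * 200) * emeasure M U" .
  qed
qed

section \<open>Points of rapid decay\<close>

text \<open>Going down by a factor \<open>8\<close> in radius divides the measure by at least
  \<open>100\<close> but the squared radius only by \<open>64\<close>. The rate is the same for all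
  centres in \<open>N\<close>, so \<open>\<delta>\<close> is uniform.\<close>

lemma nondoubling_decay:
  fixes M :: "'a::metric_space measure"
  assumes M: "finite_measure M" "sets M = sets borel" and r0: "r0 > 0"
    and N: "\<And>x r. x \<in> N \<Longrightarrow> 0 < r \<Longrightarrow> r \<le> r0 \<Longrightarrow> 100 * measure M (ball x r) \<le> measure M (ball x (8 * r))"
    and \<epsilon>: "\<epsilon> > 0"
  obtains \<delta> where "\<delta> > 0" "\<And>x r. x \<in> N \<Longrightarrow> 0 < r \<Longrightarrow> r < \<delta> \<Longrightarrow> measure M (ball x r) \<le> \<epsilon> * r\<^sup>2"
proof -
  interpret finite_measure M by (rule M)
  define V where "V = measure M (space M)"
  have V: "0 \<le> V" "\<And>A. measure M A \<le> V" by (auto simp: V_def bounded_measure)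
  have geom: "measure M (ball x (r0 / 8 ^ k)) \<le> V / 100 ^ k" if "x \<in> N" for x k
  proof (induction k)
    case 0
    then show ?case using V by simp
  next
    case (Suc k)
    have "100 * measure M (ball x (r0 / 8 ^ Suc k)) \<le> measure M (ball x (8 * (r0 / 8 ^ Suc k)))"
    proof (rule N[OF that])
      show "r0 / 8 ^ Suc k \<le> r0"
        using r0 one_le_power[of "8::real" "Suc k"] by (simp add: divide_le_eq del: power_Suc)
    qed (use r0 in simp)
    then show ?case using Suc by simp
  qed
  \<comment> \<open>The factor \<open>64\<close> is the loss \<open>8\<^sup>2\<close> from placing
    \<open>r\<close> between the grid radii \<open>r0 / 8 ^ Suc k\<close> and
    \<open>r0 / 8 ^ k\<close>.\<close>
  define c where "c = 64 * V / r0\<^sup>2"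
  have c: "0 \<le> c" using V by (simp add: c_def)
  have "(\<lambda>k. (64/100::real) ^ k) \<longlonglongrightarrow> 0" by (rule LIMSEQ_realpow_zero) auto
  then have "(\<lambda>k. c * (64/100) ^ k) \<longlonglongrightarrow> c * 0" by (intro tendsto_mult tendsto_const)
  then have "\<forall>\<^sub>F k in sequentially. c * (64/100) ^ k < \<epsilon>"
    using \<epsilon> by (intro order_tendstoD(2)) auto
  then obtain k0 where k0: "\<And>k. k \<ge> k0 \<Longrightarrow> c * (64/100) ^ k < \<epsilon>"
    by (auto simp: eventually_sequentially)
  show thesis
  proof (rule that[of "r0 / 8 ^ k0"])
    show "r0 / 8 ^ k0 > 0" using r0 by simp
    fix x r assume x: "x \<in> N" and r: "0 < r" "r < r0 / 8 ^ k0"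
    define n where "n = (LEAST n. r0 / 8 ^ n \<le> r)"
    obtain m where "r0 / r < 8 ^ m" using real_arch_pow[of 8 "r0 / r"] by auto
    then have "r0 / 8 ^ m \<le> r" using r by (simp add: field_simps)
    then have n: "r0 / 8 ^ n \<le> r" unfolding n_def by (rule LeastI)
    have "n > k0"
    proof (rule ccontr)
      assume "\<not> n > k0"
      then have "(8::real) ^ n \<le> 8 ^ k0" by (intro power_increasing) auto
      then have "r0 / 8 ^ k0 \<le> r0 / 8 ^ n" using r0 by (intro divide_left_mono) auto
      then show False using n r by simp
    qed
    then obtain k where k: "n = Suc k" "k \<ge> k0" by (cases n) auto
    then have "r < r0 / 8 ^ k"
      using not_less_Least[of k "\<lambda>n. r0 / 8 ^ n \<le> r"] by (auto simp: n_def)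
    then have "measure M (ball x r) \<le> measure M (ball x (r0 / 8 ^ k))"
      by (intro finite_measure_mono) (auto simp: M(2))
    also have "\<dots> \<le> V / 100 ^ k" by (rule geom[OF x])
    also have "\<dots> = c * (64/100) ^ k * (r0 / 8 ^ Suc k)\<^sup>2"
    proof -
      have "(8::real) ^ k * 8 ^ k = 64 ^ k" by (simp flip: power_mult_distrib)
      then have sq: "(r0 / 8 ^ Suc k)\<^sup>2 = r0\<^sup>2 / (64 * 64 ^ k)"
        by (simp add: power2_eq_square)
      have pd: "(64 / 100 :: real) ^ k = 64 ^ k / 100 ^ k" by (rule power_divide)
      show ?thesis unfolding sq pd using r0 by (simp add: c_def)
    qed
    also have "\<dots> \<le> \<epsilon> * r\<^sup>2"
    proof (rule mult_mono)
      show "c * (64/100) ^ k \<le> \<epsilon>" using k0[OF k(2)] by simp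
      show "(r0 / 8 ^ Suc k)\<^sup>2 \<le> r\<^sup>2" using n k r0 by (intro power_mono) auto
    qed (use \<epsilon> in auto)
    finally show "measure M (ball x r) \<le> \<epsilon> * r\<^sup>2" .
  qed
qed

text \<open>A nearly efficient cover of \<open>N\<close> for the two-dimensional measure is replaced
  by balls centred in \<open>N\<close>. Decay of \<open>M\<close> makes each product of diameter and
  image size at most a small multiple of the squared radius, and the squared radii have a sum
  controlled by \<open>hausdorff_outer 2 N\<close>.\<close>

lemma bad_part_estimate:
  fixes u :: "'a::metric_space \<Rightarrow> real" and M :: "'a measure"
  assumes M: "finite_measure M" "sets M = sets borel" and r0: "r0 > 0"
    and N: "\<And>x r. x \<in> N \<Longrightarrow> 0 < r \<Longrightarrow> r \<le> r0 \<Longrightarrow> 100 * measure M (ball x r) \<le> measure M (ball x (8 * r))"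
    and est: "\<And>x r. x \<in> N \<Longrightarrow> 0 < r \<Longrightarrow> r \<le> r0 \<Longrightarrow>
      ennreal r * upper_integral lebesgue (indicator (u ` ball x r))
        \<le> ennreal (4 / pi) * emeasure M (ball x (2 * r))"
    and fin: "hausdorff_outer 2 N < top"
  shows "upper_integral lebesgue (\<lambda>t. hausdorff_outer 1 (N \<inter> closure {x. u x = t})) = 0"
proof -
  interpret finite_measure M by (rule M)
  have "upper_integral lebesgue (\<lambda>t. hausdorff_outer 1 (N \<inter> closure {x. u x = t})) \<le> ennreal e"
    if e: "e > 0" for e :: real
  proof (rule upper_integral_hausdorff_slices)
    fix \<delta>' :: real assume \<delta>': "\<delta>' > 0"
    obtain H where H: "0 \<le> H" "hausdorff_outer 2 N = ennreal H"
      using fin by (cases "hausdorff_outer 2 N") auto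
    \<comment> \<open>\<open>c\<close> collects the constants of the final sum, which becomes
      \<open>\<epsilon> * c = e\<close>; the summand \<open>1\<close> at the end is the sum of the
      powers of one half.\<close>
    define c where "c = 64 / pi * (4 / pi * (H + 1) + 1)"
    have c: "c > 0" unfolding c_def using H by (intro mult_pos_pos add_nonneg_pos) auto
    define \<epsilon> where "\<epsilon> = e / c"
    have \<epsilon>: "\<epsilon> > 0" using e c by (simp add: \<epsilon>_def)
    obtain \<delta>0 where \<delta>0: "\<delta>0 > 0" "\<And>x r. x \<in> N \<Longrightarrow> 0 < r \<Longrightarrow> r < \<delta>0 \<Longrightarrow> measure M (ball x r) \<le> \<epsilon> * r\<^sup>2"
      using nondoubling_decay[OF M r0 N \<epsilon>] by blast
    \<comment> \<open>Radii will be at most \<open>2 * \<delta>\<close>, so balls of twice the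
      radius and diameters of balls stay within the limits \<open>\<delta>0\<close> and
      \<open>\<delta>'\<close>.\<close>
    define \<delta> where "\<delta> = min \<delta>0 (min \<delta>' r0) / 8"
    have \<delta>: "\<delta> > 0" "8 * \<delta> \<le> \<delta>0" "8 * \<delta> \<le> \<delta>'" "8 * \<delta> \<le> r0"
      using \<delta>0 \<delta>' r0 by (auto simp: \<delta>_def)
    have "hausdorff_pre 2 \<delta> N \<le> hausdorff_outer 2 N"
      unfolding hausdorff_outer_def using \<delta> by (intro SUP_upper) auto
    also have "\<dots> < ennreal (H + 1)" using H by (simp add: ennreal_less_iff del: ennreal_plus)
    finally obtain C :: "nat \<Rightarrow> 'a set" where C: "N \<subseteq> (\<Union>i. C i)"
      "\<And>i. bounded (C i)" "\<And>i. diameter (C i) \<le> \<delta>"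
      "(\<Sum>i. hausdorff_gauge 2 (C i)) < ennreal (H + 1)"
      unfolding hausdorff_pre_def INF_less_iff by blast
    \<comment> \<open>The added term makes the radius positive and larger than the diameter even for
      a one-point set, so the open ball contains \<open>C i\<close>; the powers of one half keep the
      sum of squares finite.\<close>
    define r where "r i = diameter (C i) + min \<delta> ((1/2) ^ Suc i)" for i
    have d0: "0 \<le> diameter (C i)" for i using C(2) by (rule diameter_ge_0)
    have r: "0 < r i" "r i \<le> 2 * \<delta>" "diameter (C i) < r i" for i
    proof -
      have h: "0 < min \<delta> ((1/2) ^ Suc i)" "min \<delta> ((1/2) ^ Suc i) \<le> \<delta>" using \<delta>(1) by auto
      show "0 < r i" "r i \<le> 2 * \<delta>" "diameter (C i) < r i"
        unfolding r_def using h d0[of i] C(3)[of i] by linarith+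
    qed
    have r2: "(r i)\<^sup>2 \<le> 2 * (diameter (C i))\<^sup>2 + 2 * (1/2) ^ Suc i" for i
    proof -
      let ?h = "min \<delta> ((1/2) ^ Suc i) :: real"
      have "0 \<le> ?h" "?h \<le> (1/2) ^ Suc i" using \<delta> by auto
      moreover have "(1/2) ^ Suc i \<le> (1::real)" by (rule power_le_one) auto
      ultimately have "?h * ?h \<le> (1/2) ^ Suc i * 1" by (intro mult_mono) auto
      moreover have "0 \<le> (diameter (C i) - ?h)\<^sup>2" by simp
      ultimately show ?thesis by (simp add: r_def power2_eq_square algebra_simps)
    qed
    \<comment> \<open>Centres are taken in \<open>N\<close>, where the estimates hold. The choice
      has meaning only if \<open>C i\<close> meets \<open>N\<close>; otherwise \<open>A i\<close> is
      empty.\<close>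
    define y where "y i = (SOME y. y \<in> C i \<inter> N)" for i
    have y: "y i \<in> C i" "y i \<in> N" if "C i \<inter> N \<noteq> {}" for i
      using some_in_eq[of "C i \<inter> N"] that by (auto simp: y_def)
    define A where "A i = (if C i \<inter> N = {} then {} else ball (y i) (r i))" for i
    have diamA: "diameter (A i) \<le> 2 * r i" for i
      using diameter_ball_le[of "r i" "y i"] r(1)[of i] by (auto simp: A_def)
    have le: "ennreal (diameter (A i)) * upper_integral lebesgue (indicator {t. closure {x. u x = t} \<inter> A i \<noteq> {}})
        \<le> ennreal (64 / pi * \<epsilon>) * (ennreal (4 / pi) * hausdorff_gauge 2 (C i) + ennreal ((1/2) ^ Suc i))" for i
    proof (cases "C i \<inter> N = {}")
      case False
      note y = y[OF False]
      have A: "A i = ball (y i) (r i)" using False by (simp add: A_def)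
      have set: "{t. closure {x. u x = t} \<inter> ball (y i) (r i) \<noteq> {}} = u ` ball (y i) (r i)"
        using closure_level_meets_open[of "ball (y i) (r i)" u] by blast
      let ?T = "upper_integral lebesgue (indicator (u ` ball (y i) (r i)))"
      have "ennreal (diameter (A i)) * ?T \<le> ennreal (2 * r i) * ?T"
        using diamA by (intro mult_right_mono ennreal_leI) auto
      also have "\<dots> = 2 * (ennreal (r i) * ?T)"
        using r(1)[of i] by (subst ennreal_mult) (auto simp: mult.assoc)
      also have "\<dots> \<le> 2 * (ennreal (4 / pi) * emeasure M (ball (y i) (2 * r i)))"
        using r[of i] \<delta> by (intro mult_left_mono est y) auto
      also have "\<dots> \<le> 2 * (ennreal (4 / pi) * ennreal (\<epsilon> * (2 * r i)\<^sup>2))"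
        unfolding emeasure_eq_measure using r[of i] \<delta>
        by (intro mult_left_mono ennreal_leI \<delta>0(2) y) auto
      also have "\<dots> = ennreal (2 * (4 / pi * (\<epsilon> * (2 * r i)\<^sup>2)))"
      proof -
        have "ennreal (4 / pi * (\<epsilon> * (2 * r i)\<^sup>2)) = ennreal (4 / pi) * ennreal (\<epsilon> * (2 * r i)\<^sup>2)"
          by (rule ennreal_mult') simp
        moreover have "ennreal (2 * (4 / pi * (\<epsilon> * (2 * r i)\<^sup>2))) = ennreal 2 * ennreal (4 / pi * (\<epsilon> * (2 * r i)\<^sup>2))"
          by (rule ennreal_mult') simp
        ultimately show ?thesis by (simp only: ennreal_numeral)
      qed
      also have "\<dots> \<le> ennreal (64 / pi * \<epsilon> * ((diameter (C i))\<^sup>2 + (1/2) ^ Suc i))"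
      proof (rule ennreal_leI)
        have "2 * (4 / pi * (\<epsilon> * (2 * r i)\<^sup>2)) = 32 / pi * \<epsilon> * (r i)\<^sup>2"
          by (simp add: power2_eq_square)
        also have "\<dots> \<le> 32 / pi * \<epsilon> * (2 * (diameter (C i))\<^sup>2 + 2 * (1/2) ^ Suc i)"
          using \<epsilon> r2[of i] by (intro mult_left_mono) auto
        finally show "2 * (4 / pi * (\<epsilon> * (2 * r i)\<^sup>2)) \<le> 64 / pi * \<epsilon> * ((diameter (C i))\<^sup>2 + (1/2) ^ Suc i)"
          by (simp add: algebra_simps)
      qed
      also have "\<dots> = ennreal (64 / pi * \<epsilon>) * (ennreal ((diameter (C i))\<^sup>2) + ennreal ((1/2) ^ Suc i))"
      proof -
        have "ennreal ((diameter (C i))\<^sup>2 + (1/2) ^ Suc i) = ennreal ((diameter (C i))\<^sup>2) + ennreal ((1/2) ^ Suc i)"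
          by (rule ennreal_plus) auto
        moreover have "ennreal (64 / pi * \<epsilon> * ((diameter (C i))\<^sup>2 + (1/2) ^ Suc i)) =
            ennreal (64 / pi * \<epsilon>) * ennreal ((diameter (C i))\<^sup>2 + (1/2) ^ Suc i)"
          using \<epsilon> by (intro ennreal_mult') simp
        ultimately show ?thesis by (simp only:)
      qed
      also have "ennreal ((diameter (C i))\<^sup>2) = ennreal (4 / pi) * hausdorff_gauge 2 (C i)"
        using False by (auto simp: hausdorff_gauge_def unit_ball_vol_2 power2_eq_square simp flip: ennreal_mult)
      finally show ?thesis unfolding A set .
    qed (simp add: A_def)
    show "\<exists>A::nat \<Rightarrow> 'a set. N \<subseteq> (\<Union>i. A i) \<and> (\<forall>i. bounded (A i) \<and> diameter (A i) \<le> \<delta>') \<and>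
      (\<Sum>i. ennreal (diameter (A i)) * upper_integral lebesgue (indicator {t. closure {x. u x = t} \<inter> A i \<noteq> {}})) \<le> ennreal e"
    proof (intro exI[of _ A] conjI allI)
      show "N \<subseteq> (\<Union>i. A i)"
      proof
        fix x assume x: "x \<in> N"
        then obtain i where i: "x \<in> C i" using C(1) by blast
        then have ne: "C i \<inter> N \<noteq> {}" using x by blast
        have "dist (y i) x \<le> diameter (C i)" using y(1)[OF ne] i by (rule diameter_bounded_bound[OF C(2)])
        then have "x \<in> A i" using r(3)[of i] ne by (simp add: A_def)
        then show "x \<in> (\<Union>i. A i)" by blast
      qed
      show "bounded (A i)" for i by (simp add: A_def)
      show "diameter (A i) \<le> \<delta>'" for i using diamA[of i] r(2)[of i] \<delta> by linarith
      have "(\<Sum>i. ennreal (diameter (A i)) * upper_integral lebesgue (indicator {t. closure {x. u x = t} \<inter> A i \<noteq> {}}))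
        \<le> (\<Sum>i. ennreal (64 / pi * \<epsilon>) * (ennreal (4 / pi) * hausdorff_gauge 2 (C i) + ennreal ((1/2) ^ Suc i)))"
        using le by (intro suminf_le summableI)
      also have "\<dots> = ennreal (64 / pi * \<epsilon>) * (ennreal (4 / pi) * (\<Sum>i. hausdorff_gauge 2 (C i)) + (\<Sum>i. ennreal ((1/2) ^ Suc i)))"
        by (simp add: suminf_add[symmetric] del: power_Suc)
      also have "(\<Sum>i. ennreal ((1/2) ^ Suc i)) = ennreal 1"
        by (rule suminf_ennreal_eq[OF _ power_half_series]) auto
      also have "ennreal (64 / pi * \<epsilon>) * (ennreal (4 / pi) * (\<Sum>i. hausdorff_gauge 2 (C i)) + ennreal 1)
        \<le> ennreal (64 / pi * \<epsilon>) * (ennreal (4 / pi) * ennreal (H + 1) + ennreal 1)"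
        using C(4) by (intro mult_left_mono add_right_mono) auto
      also have "\<dots> = ennreal (64 / pi * \<epsilon> * (4 / pi * (H + 1) + 1))"
      proof -
        have "ennreal (4 / pi) * ennreal (H + 1) + ennreal 1 = ennreal (4 / pi * (H + 1) + 1)"
        proof -
          have "ennreal (4 / pi * (H + 1)) = ennreal (4 / pi) * ennreal (H + 1)"
            by (rule ennreal_mult') simp
          moreover have "ennreal (4 / pi * (H + 1) + 1) = ennreal (4 / pi * (H + 1)) + ennreal 1"
            using H by (intro ennreal_plus) auto
          ultimately show ?thesis by (simp only:)
        qed
        moreover have "ennreal (64 / pi * \<epsilon> * (4 / pi * (H + 1) + 1)) =
            ennreal (64 / pi * \<epsilon>) * ennreal (4 / pi * (H + 1) + 1)"
          using \<epsilon> by (intro ennreal_mult') simp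
        ultimately show ?thesis by (simp only:)
      qed
      also have "64 / pi * \<epsilon> * (4 / pi * (H + 1) + 1) = e"
      proof -
        have "64 / pi * \<epsilon> * (4 / pi * (H + 1) + 1) = \<epsilon> * c" by (simp add: c_def)
        then show ?thesis using c by (simp add: \<epsilon>_def)
      qed
      finally show "(\<Sum>i. ennreal (diameter (A i)) * upper_integral lebesgue (indicator {t. closure {x. u x = t} \<inter> A i \<noteq> {}})) \<le> ennreal e" .
    qed
  qed
  then have "upper_integral lebesgue (\<lambda>t. hausdorff_outer 1 (N \<inter> closure {x. u x = t})) \<le> 0 + ennreal e"
    if "e > 0" for e using that by simp
  then have "upper_integral lebesgue (\<lambda>t. hausdorff_outer 1 (N \<inter> closure {x. u x = t})) \<le> 0"
    by (rule ennreal_le_epsilon)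
  then show ?thesis by simp
qed

section \<open>From local estimates to the whole surface\<close>

text \<open>On a relatively compact open set the weighted measure is finite, so regularity and decay
  apply. \<open>E\<close> is covered by the points \<open>G\<close> of bounded growth at arbitrarily
  small scales and by sets \<open>N j\<close> on which the opposite growth holds at all scales up to
  \<open>1 / real (Suc j)\<close>; the \<open>N j\<close> contribute nothing.\<close>

lemma coarea_local:
  fixes u :: "'a::{metric_space, second_countable_topology} \<Rightarrow> real" and \<rho> :: "'a \<Rightarrow> ennreal"
  assumes surf: "metric_surface TYPE('a)" and p: "p \<ge> 1" and u: "weakly_monotone u"
    and wug: "weak_upper_gradient p u \<rho>" and loc: "locally_p_integrable p \<rho>"
    and O: "open O'" "compact (closure O')" and E: "E \<in> sets borel" "E \<subseteq> O'"
  shows "upper_integral lebesgue (\<lambda>t. hausdorff_outer 1 (E \<inter> closure {x. u x = t}))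
    \<le> ennreal (4 / pi * 200) * (\<integral>\<^sup>+ x\<in>E. \<rho> x \<partial>hausdorff_measure 2)"
proof -
  have [measurable]: "\<rho> \<in> borel_measurable borel" "O' \<in> sets borel" "closure O' \<in> sets borel" "E \<in> sets borel"
    using loc O E by (auto simp: locally_p_integrable_def)
  define M where "M = density (hausdorff_measure 2) (\<lambda>x. \<rho> x * indicator O' x)"
  have setsM: "sets M = sets borel" by (simp add: M_def)
  have emM: "emeasure M A = (\<integral>\<^sup>+ x\<in>A. \<rho> x \<partial>hausdorff_measure 2)" if "A \<in> sets borel" "A \<subseteq> O'" for A
    unfolding M_def using that
    by (subst emeasure_density) (auto intro!: nn_integral_cong split: split_indicator)
  have H2O: "emeasure (hausdorff_measure 2) (closure O') < \<infinity>"
    using surf O(2) by (simp add: metric_surface_def)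
  have "emeasure M (space M) = (\<integral>\<^sup>+ x\<in>O'. \<rho> x \<partial>hausdorff_measure 2)"
    unfolding M_def by (subst emeasure_density) (auto intro!: nn_integral_cong split: split_indicator)
  \<comment> \<open>The case \<open>\<epsilon> = 1\<close> of \<open>ennreal_le_powr\<close> turns
    local \<open>p\<close>-integrability into local integrability.\<close>
  also have "\<dots> \<le> (\<integral>\<^sup>+ x. indicator (closure O') x + ennreal_powr (\<rho> x) p * indicator (closure O') x \<partial>hausdorff_measure 2)"
    using ennreal_le_powr[OF p, of 1] closure_subset[of O']
    by (intro nn_integral_mono) (auto split: split_indicator)
  also have "\<dots> = emeasure (hausdorff_measure 2) (closure O') + (\<integral>\<^sup>+ x\<in>closure O'. ennreal_powr (\<rho> x) p \<partial>hausdorff_measure 2)"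
    by (subst nn_integral_add) auto
  also have "\<dots> < \<infinity>" using H2O loc O(2) by (simp add: locally_p_integrable_def)
  finally have finM: "finite_measure M" by (intro finite_measureI) auto
  interpret finite_measure M by (rule finM)
  obtain c where c: "\<And>x. c x > 0" "\<And>x r. 0 < r \<Longrightarrow> 2 * r \<le> c x \<Longrightarrow>
    ennreal r * upper_integral lebesgue (indicator (u ` ball x r))
      \<le> ennreal (4 / pi) * (\<integral>\<^sup>+ y\<in>ball x (2 * r). \<rho> y \<partial>hausdorff_measure 2)"
    using image_ball_estimate[OF surf p u wug] by metis
  have est: "ennreal r * upper_integral lebesgue (indicator (u ` ball x r))
      \<le> ennreal (4 / pi) * emeasure M (ball x (2 * r))" if "0 < r" "2 * r \<le> c x" "ball x (2 * r) \<subseteq> O'" for x r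
    using c(2)[OF that(1,2)] emM[OF _ that(3)] by simp
  define G where "G = {x \<in> E. \<forall>\<delta>>0. \<exists>r. 0 < r \<and> r < \<delta> \<and> emeasure M (ball x (8 * r)) \<le> 100 * emeasure M (ball x r)}"
  define N where "N j = {x \<in> E. (\<forall>r. 0 < r \<longrightarrow> r \<le> 1 / real (Suc j) \<longrightarrow>
      100 * measure M (ball x r) \<le> measure M (ball x (8 * r))) \<and> 2 / real (Suc j) \<le> c x \<and> ball x (2 / real (Suc j)) \<subseteq> O'}" for j
  have cover: "E \<subseteq> G \<union> (\<Union>j. N j)"
  proof
    fix x assume x: "x \<in> E"
    show "x \<in> G \<union> (\<Union>j. N j)"
    proof (cases "x \<in> G")
      case False
      then obtain \<delta> where \<delta>: "\<delta> > 0" "\<And>r. 0 < r \<Longrightarrow> r < \<delta> \<Longrightarrow> 100 * emeasure M (ball x r) \<le> emeasure M (ball x (8 * r))"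
        using x unfolding G_def by (auto simp: not_le) (meson less_imp_le)
      have \<delta>': "100 * measure M (ball x r) \<le> measure M (ball x (8 * r))" if "0 < r" "r < \<delta>" for r
        using \<delta>(2)[OF that] by (simp add: emeasure_eq_measure flip: ennreal_mult'' ennreal_numeral)
      obtain d where d: "d > 0" "ball x d \<subseteq> O'" using O(1) E(2) x open_contains_ball by blast
      have "0 < min \<delta> (min (c x) d) / 2" using \<delta> c(1)[of x] d by simp
      then obtain j where j: "1 / real (Suc j) < min \<delta> (min (c x) d) / 2" using nat_approx_posE by blast
      then have "1 / real (Suc j) < \<delta>" "2 / real (Suc j) \<le> c x" "2 / real (Suc j) \<le> d" using \<delta>(1) by auto
      then have "x \<in> N j" unfolding N_def using x \<delta>' d by (auto simp del: of_nat_Suc)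
      then show ?thesis by blast
    qed blast
  qed
  have bad: "upper_integral lebesgue (\<lambda>t. hausdorff_outer 1 (N j \<inter> closure {x. u x = t})) = 0" for j
  proof (rule bad_part_estimate[OF finM setsM, of "1 / real (Suc j)"])
    show "0 < 1 / real (Suc j)" by simp
    show "100 * measure M (ball x r) \<le> measure M (ball x (8 * r))" if "x \<in> N j" "0 < r" "r \<le> 1 / real (Suc j)" for x r
      using that by (simp add: N_def del: of_nat_Suc)
    show "ennreal r * upper_integral lebesgue (indicator (u ` ball x r))
      \<le> ennreal (4 / pi) * emeasure M (ball x (2 * r))" if "x \<in> N j" "0 < r" "r \<le> 1 / real (Suc j)" for x r
    proof (rule est[OF that(2)])
      have r: "2 * r \<le> 2 / real (Suc j)" using that(3) by simp
      then show "2 * r \<le> c x" using that(1) by (simp add: N_def del: of_nat_Suc)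
      show "ball x (2 * r) \<subseteq> O'" using that(1) subset_ball[OF r, of x] by (auto simp: N_def simp del: of_nat_Suc)
    qed
    have "hausdorff_outer 2 (N j) \<le> hausdorff_outer 2 (closure O')"
      using E(2) closure_subset[of O'] by (intro hausdorff_outer_mono) (auto simp: N_def)
    then show "hausdorff_outer 2 (N j) < top"
      using H2O by (simp add: emeasure_hausdorff_measure)
  qed
  have good: "upper_integral lebesgue (\<lambda>t. hausdorff_outer 1 (G \<inter> closure {x. u x = t}))
    \<le> ennreal (4 / pi * 200) * emeasure M E"
  proof (rule ennreal_le_epsilon)
    fix e :: real assume e: "e > 0"
    define e' where "e' = e / (4 / pi * 200)"
    have e': "e' > 0" using e by (simp add: e'_def)
    \<comment> \<open>Outer regularity provides an open set to hold the disjoint Vitali balls, at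
      the cost \<open>e'\<close>, which the factor \<open>4 / pi * 200\<close> turns into
      \<open>e\<close>.\<close>
    obtain U where U: "open U" "E \<subseteq> U" "emeasure M U \<le> emeasure M E + ennreal e'"
      using finite_borel_measure_outer_regular[OF finM setsM E(1) e'] by blast
    have "upper_integral lebesgue (\<lambda>t. hausdorff_outer 1 (G \<inter> closure {x. u x = t}))
      \<le> ennreal (4 / pi * 200) * emeasure M U"
    proof (rule good_part_estimate[OF setsM U(1)])
      fix x and \<delta> :: real assume x: "x \<in> G" and \<delta>: "\<delta> > 0"
      then have xE: "x \<in> E" by (simp add: G_def)
      obtain d where d: "d > 0" "ball x d \<subseteq> O'" using O(1) E(2) xE open_contains_ball by blast
      obtain d' where d': "d' > 0" "ball x d' \<subseteq> U" using U xE open_contains_ball by blast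
      \<comment> \<open>The divisor \<open>8\<close> serves the balls of radius
        \<open>2 * (4 * r)\<close>, which must lie in \<open>O'\<close> and satisfy the ball
        estimate.\<close>
      have "0 < min \<delta> (min d' (min (c x) d / 8))" using d d' \<delta> c(1)[of x] by simp
      then obtain r where r: "0 < r" "r < min \<delta> (min d' (min (c x) d / 8))"
        "emeasure M (ball x (8 * r)) \<le> 100 * emeasure M (ball x r)"
        using x unfolding G_def by blast
      have "ball x r \<subseteq> U" using d'(2) r(2) subset_ball[of r d' x] by auto
      moreover have "ball x (2 * (4 * r)) \<subseteq> O'" using d(2) r(2) subset_ball[of "2 * (4 * r)" d x] by auto
      then have "ennreal (4 * r) * upper_integral lebesgue (indicator (u ` ball x (4 * r)))
        \<le> ennreal (4 / pi) * emeasure M (ball x (2 * (4 * r)))"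
        using r by (intro est) auto
      ultimately show "\<exists>r. 0 < r \<and> r < \<delta> \<and> ball x r \<subseteq> U \<and>
          emeasure M (ball x (8 * r)) \<le> 100 * emeasure M (ball x r) \<and>
          ennreal (4 * r) * upper_integral lebesgue (indicator (u ` ball x (4 * r)))
            \<le> ennreal (4 / pi) * emeasure M (ball x (8 * r))"
        using r by (intro exI[of _ r]) simp
    qed
    also have "\<dots> \<le> ennreal (4 / pi * 200) * (emeasure M E + ennreal e')"
      using U(3) by (intro mult_left_mono) auto
    also have "\<dots> = ennreal (4 / pi * 200) * emeasure M E + ennreal e"
      using e by (simp add: distrib_left e'_def flip: ennreal_mult)
    finally show "upper_integral lebesgue (\<lambda>t. hausdorff_outer 1 (G \<inter> closure {x. u x = t}))
      \<le> ennreal (4 / pi * 200) * emeasure M E + ennreal e" .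
  qed
  have "upper_integral lebesgue (\<lambda>t. hausdorff_outer 1 (E \<inter> closure {x. u x = t}))
    \<le> upper_integral lebesgue (\<lambda>t. hausdorff_outer 1 (G \<inter> closure {x. u x = t}) +
      (\<Sum>j. hausdorff_outer 1 (N j \<inter> closure {x. u x = t})))"
  proof (rule upper_integral_mono)
    fix t
    let ?L = "closure {x. u x = t}"
    have "hausdorff_outer 1 (E \<inter> ?L) \<le> hausdorff_outer 1 ((G \<inter> ?L) \<union> (\<Union>j. N j \<inter> ?L))"
      using cover by (intro hausdorff_outer_mono) auto
    also have "\<dots> \<le> hausdorff_outer 1 (G \<inter> ?L) + hausdorff_outer 1 (\<Union>j. N j \<inter> ?L)"
      by (rule hausdorff_outer_Un)
    also have "\<dots> \<le> hausdorff_outer 1 (G \<inter> ?L) + (\<Sum>j. hausdorff_outer 1 (N j \<inter> ?L))"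
      by (intro add_left_mono hausdorff_outer_subadditive)
    finally show "hausdorff_outer 1 (E \<inter> ?L) \<le> \<dots>" .
  qed
  also have "\<dots> \<le> upper_integral lebesgue (\<lambda>t. hausdorff_outer 1 (G \<inter> closure {x. u x = t})) +
      (\<Sum>j. upper_integral lebesgue (\<lambda>t. hausdorff_outer 1 (N j \<inter> closure {x. u x = t})))"
    by (intro order_trans[OF upper_integral_add] add_left_mono upper_integral_suminf)
  also have "\<dots> \<le> ennreal (4 / pi * 200) * emeasure M E"
    using good unfolding bad by simp
  finally show ?thesis using emM[OF E] by simp
qed

text \<open>By the Lindelof property, countably many relatively compact open sets cover the surface.
  \<open>E\<close> is cut into disjoint pieces inside them: the left-hand side is countably
  subadditive and the integral of \<open>\<rho>\<close> is countably additive.\<close>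

lemma coarea_set:
  fixes u :: "'a::{metric_space, second_countable_topology} \<Rightarrow> real" and \<rho> :: "'a \<Rightarrow> ennreal"
  assumes surf: "metric_surface TYPE('a)" and p: "p \<ge> 1" and u: "weakly_monotone u"
    and wug: "weak_upper_gradient p u \<rho>" and loc: "locally_p_integrable p \<rho>"
    and E: "E \<in> sets borel"
  shows "upper_integral lebesgue (\<lambda>t. hausdorff_outer 1 (E \<inter> closure {x. u x = t}))
    \<le> ennreal (4 / pi * 200) * (\<integral>\<^sup>+ x\<in>E. \<rho> x \<partial>hausdorff_measure 2)"
proof -
  have [measurable]: "\<rho> \<in> borel_measurable borel" using loc by (simp add: locally_p_integrable_def)
  define \<O> where "\<O> = {B :: 'a set. open B \<and> compact (closure B)}"
  have "\<Union>\<O> = UNIV"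
  proof (intro set_eqI iffI UNIV_I)
    fix x :: 'a
    obtain c where c: "c > 0" "compact (cball x c)"
      using image_ball_estimate[OF surf p u wug, of x] by blast
    have "closure (ball x c) \<subseteq> cball x c" by (intro closure_minimal) auto
    then have "compact (closure (ball x c))"
      using closed_Int_compact[OF closed_closure c(2), of "ball x c"] by (simp add: Int_absorb2)
    then show "x \<in> \<Union>\<O>" using c(1) by (auto simp: \<O>_def intro!: exI[of _ "ball x c"])
  qed
  moreover obtain \<F> where \<F>: "\<F> \<subseteq> \<O>" "countable \<F>" "\<Union>\<F> = \<Union>\<O>"
    by (rule Lindelof[of \<O>]) (auto simp: \<O>_def)
  ultimately have UF: "\<Union>\<F> = UNIV" by simp
  then have ne: "\<F> \<noteq> {}" by auto
  define B where "B = from_nat_into \<F>"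
  have B: "open (B i)" "compact (closure (B i))" for i
    using from_nat_into[OF ne, of i] \<F>(1) by (auto simp: B_def \<O>_def)
  have UB: "(\<Union>i. B i) = UNIV"
    using range_from_nat_into[OF ne \<F>(2)] UF by (simp add: B_def)
  define S where "S i = E \<inter> disjointed B i" for i
  have [measurable]: "S i \<in> sets borel" for i
  proof -
    have "range (disjointed B) \<subseteq> sets borel"
      using B(1) by (intro sets.range_disjointed_sets) (auto intro: borel_open)
    then show ?thesis using E by (auto simp: S_def)
  qed
  have SE: "(\<Union>i. S i) = E" using UN_disjointed_eq[of B] UB by (auto simp: S_def)
  have disj: "disjoint_family S"
    using disjoint_family_disjointed[of B] by (auto simp: disjoint_family_on_def S_def)
  have "upper_integral lebesgue (\<lambda>t. hausdorff_outer 1 (E \<inter> closure {x. u x = t}))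
    \<le> upper_integral lebesgue (\<lambda>t. \<Sum>i. hausdorff_outer 1 (S i \<inter> closure {x. u x = t}))"
  proof (rule upper_integral_mono)
    fix t
    have "E \<inter> closure {x. u x = t} = (\<Union>i. S i \<inter> closure {x. u x = t})" using SE by blast
    then show "hausdorff_outer 1 (E \<inter> closure {x. u x = t}) \<le> (\<Sum>i. hausdorff_outer 1 (S i \<inter> closure {x. u x = t}))"
      by (simp only: hausdorff_outer_subadditive)
  qed
  also have "\<dots> \<le> (\<Sum>i. upper_integral lebesgue (\<lambda>t. hausdorff_outer 1 (S i \<inter> closure {x. u x = t})))"
    by (rule upper_integral_suminf)
  also have "\<dots> \<le> (\<Sum>i. ennreal (4 / pi * 200) * (\<integral>\<^sup>+ x\<in>S i. \<rho> x \<partial>hausdorff_measure 2))"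
  proof (intro suminf_le summableI coarea_local[OF surf p u wug loc B])
    show "S i \<subseteq> B i" for i using disjointed_subset[of B i] by (auto simp: S_def)
  qed auto
  also have "\<dots> = ennreal (4 / pi * 200) * (\<integral>\<^sup>+ x\<in>(\<Union>i. S i). \<rho> x \<partial>hausdorff_measure 2)"
    by (subst nn_integral_disjoint_family) (auto simp: disj)
  finally show ?thesis unfolding SE .
qed

theorem theorem3p6:
  fixes u :: "'a::{metric_space, second_countable_topology} \<Rightarrow> real"
    and \<rho> :: "'a \<Rightarrow> ennreal"
    and p :: real
  assumes "metric_surface TYPE('a)"
    and "p \<ge> 1"
    and "weakly_monotone u"
    and "weak_upper_gradient p u \<rho>"
    and "locally_p_integrable p \<rho>"
  shows "\<forall>g :: 'a \<Rightarrow> ennreal. g \<in> borel_measurable borel \<longrightarrow>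
    upper_integral lebesgue
        (\<lambda>t. \<integral>\<^sup>+ x\<in>closure {x. u x = t}. g x \<partial>hausdorff_measure 1)
      \<le> ennreal (4 / pi * 200) * (\<integral>\<^sup>+ x. g x * \<rho> x \<partial>hausdorff_measure 2)"
proof (intro allI impI upper_integral_slices_measurable)
  show "\<rho> \<in> borel_measurable borel" using assms(5) by (simp add: locally_p_integrable_def)
\<comment> \<open>\<open>coarea_set\<close> is the estimate for Borel sets from which the passage to
  Borel functions starts.\<close>
qed (use coarea_set[OF assms] in auto)

end
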